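(* Let $A=(a_{ij})$ be an $n\times n$ matrix with non-negative integer entries and $\det A\neq 0$, such that ${}^t\mathbf e A^{-1}\mathbf e=1$, where $\mathbf e=(1,\dots,1)$. Assume that the weights $q_j$ and the numbers $q'_k$ attached to $A$ (see context) are all strictly positive, and that $X_A$ is irreducible. Then the rational maps $\phi_A:X_d\to X_A$ and $q_A:X_A\to\overline{M}_A$ are birationally equivalent to quotient maps by finite groups, namely to $X_d\to X_d/\Gamma_A$ and $X_A\to X_A/H_A$ respectively. In particular, $X_A$ is birational to $X_d/\Gamma_A$, and $\overline{M}_A$ is birational to $X_A/H_A$.
   Context: Everything is over $\mathbb C$. For $A=(a_{ij})\in M_n(\mathbb Z_{\ge 0})$ with $\det A\ne0$, let $d$ be the smallest positive integer such that $B=(b_{ij}):=dA^{-1}$ has integer entries. Put $\mathbf q=(q_1,\dots,q_n):=B\mathbf e$ and $\mathbf q'=(q'_1,\dots,q'_n):={}^tB\,\mathbf e$, so $q_j=\sum_k b_{jk}$ and $q'_k=\sum_j b_{jk}$. The condition ${}^t\mathbf eA^{-1}\mathbf e=1$ means $\sum_j q_j=d=\sum_k q_k'$. $W\mathbb P^{n-1}(q_1,\dots,q_n)$ is the weighted projective space $(\mathbb C^n\setminus\{0\})/\sim$ with $(x_1,\dots,x_n)\sim(\lambda^{q_1}x_1,\dots,\lambda^{q_n}x_n)$ for $\lambda\in\mathbb C^*$. $F_A:=\sum_{i=1}^n\prod_{j=1}^n x_j^{a_{ij}}$ and $X_A:=\{F_A=0\}\subset W\mathbb P^{n-1}(q_1,\dots,q_n)$.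 $X_d:=\{\sum_{i=1}^n y_i^d=0\}\subset\mathbb P^{n-1}$ is the Fermat variety. The rational map $\phi_A:\mathbb P^{n-1}\to W\mathbb P^{n-1}(q_1,\dots,q_n)$ is $(y_1:\dots:y_n)\mapsto(x_1:\dots:x_n)$ with $x_j=\prod_{k}y_k^{b_{jk}}$; it maps $X_d$ to $X_A$. The rational map $q_A:W\mathbb P^{n-1}(q_1,\dots,q_n)\to\mathbb P^n$ is $$(x_1:\dots:x_n)\mapsto(u_0:\dots:u_n)=\Big(\prod_j x_j:\prod_j x_j^{a_{1j}}:\dots:\prod_j x_j^{a_{nj}}\Big).$$ On $X_d$ the composition is $q_A\circ\phi_A(y)=(\prod_k y_k^{q'_k}:y_1^d:\dots:y_n^d)$. The Shioda quotient $\overline{M}_A\subset\mathbb P^n$ is the closure of the image of $X_d$ under $q_A\circ\phi_A$. Let $\zeta$ be a primitive $d$-th root of unity. For $\mathbf k\in(\mathbb Z/d\mathbb Z)^n$ let $g_{\mathbf k}$ denote the map multiplying the $i$-th coordinate by $\zeta^{k_i}$ (acting on $\mathbb P^{n-1}$ or on $W\mathbb P^{n-1}(q_1,\dots,q_n)$). Then $$\Gamma(\mathbf q'):=\Big\{g_{\mathbf k}:\ \sum_j k_jq'_j\equiv0 \bmod d\Big\}\Big/\langle g_{(1,\dots,1)}\rangle,$$ a finite group acting on $X_d$. One has $\phi_A(g_{\mathbf k}y)=g_{B\mathbf k}\phi_A(y)$, which gives a homomorphism $\Gamma(\mathbf q')\to\mathrm{Aut}(X_A)$, $g_{\mathbf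 k}\mapsto g_{B\mathbf k}$. Its kernel is $\Gamma_A$ (equivalently, the subgroup generated by the images of the $g_{\mathbf k}$ with $B\mathbf k\equiv0\bmod d$) and its image is $H_A\subset\mathrm{Aut}(X_A)$. Two rational maps $f_i:X\to Y_i$ ($i=1,2$) of algebraic varieties are birationally equivalent if there are Zariski open (dense) subsets $U\subset X$, $U_i\subset Y_i$ and an isomorphism $\phi:U_1\to U_2$ with $\phi\circ f_1=f_2$ on $U$. *)

theory Defs
  imports
    "HOL-Analysis.Analysis"
    "HOL-Algebra.Bij"
    "HOL-Algebra.Coset"
    "HOL-Algebra.Generated_Groups"
    "HOL-Algebra.Elementary_Groups"
    "HOL-Algebra.Product_Groups"
begin

section \<open>Complex varieties as spaces with functions\<close>

text \<open>
  A variety is represented by its set of closed points, its Zariski topology, and for every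
  open set \<open>U\<close> the functions that are regular on \<open>U\<close>.  Functions are total in HOL;
  membership in \<open>regular X U\<close> only depends on the values on \<open>U\<close>.
\<close>

record 'a fspace =
  zar :: "'a topology"
  regular :: "'a set \<Rightarrow> ('a \<Rightarrow> complex) set"

abbreviation points :: "'a fspace \<Rightarrow> 'a set" where
  "points X \<equiv> topspace (zar X)"

inductive polyfun :: "(complex ^ 'n::finite \<Rightarrow> complex) \<Rightarrow> bool" where
  polyfun_const: "polyfun (\<lambda>x. c)"
| polyfun_coord: "polyfun (\<lambda>x. x $ i)"
| polyfun_add: "polyfun f \<Longrightarrow> polyfun g \<Longrightarrow> polyfun (\<lambda>x. f x + g x)"
| polyfun_mult: "polyfun f \<Longrightarrow> polyfun g \<Longrightarrow> polyfun (\<lambda>x. f x * g x)"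

definition zariski_open :: "(complex ^ 'n::finite) set \<Rightarrow> bool" where
  "zariski_open U \<longleftrightarrow> (\<exists>S. (\<forall>p\<in>S. polyfun p) \<and> - U = {x. \<forall>p\<in>S. p x = 0})"

lemma istopology_zariski: "istopology (zariski_open :: (complex ^ 'n::finite) set \<Rightarrow> bool)"
  unfolding istopology_def
proof (intro conjI allI impI)
  fix U V :: "(complex ^ 'n) set"
  assume "zariski_open U" "zariski_open V"
  then obtain S T where S: "\<forall>p\<in>S. polyfun p" "- U = {x. \<forall>p\<in>S. p x = 0}"
    and T: "\<forall>p\<in>T. polyfun p" "- V = {x. \<forall>p\<in>T. p x = 0}"
    unfolding zariski_open_def by blast
  define R where "R = (\<lambda>(p, r) x. p x * r x) ` (S \<times> T)"
  have "\<forall>p\<in>R. polyfun p"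
    using S(1) T(1) by (auto simp: R_def intro: polyfun_mult)
  moreover have "- (U \<inter> V) = {x. \<forall>p\<in>R. p x = 0}"
  proof -
    have "x \<in> - U \<union> - V \<longleftrightarrow> (\<forall>p\<in>S. \<forall>r\<in>T. p x * r x = 0)" for x
      unfolding S(2) T(2) by auto
    moreover have "(\<forall>p\<in>S. \<forall>r\<in>T. p x * r x = 0) \<longleftrightarrow> (\<forall>p\<in>R. p x = 0)" for x
      by (simp add: R_def split_beta)
    ultimately show ?thesis by blast
  qed
  ultimately show "zariski_open (U \<inter> V)"
    unfolding zariski_open_def by blast
next
  fix \<K> :: "(complex ^ 'n) set set"
  assume "\<forall>K\<in>\<K>. zariski_open K"
  then have "\<forall>K\<in>\<K>. \<exists>S. (\<forall>p\<in>S. polyfun p) \<and> - K = {x. \<forall>p\<in>S. p x = 0}"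
    by (simp add: zariski_open_def)
  then obtain S where S: "\<forall>K\<in>\<K>. (\<forall>p\<in>S K. polyfun p) \<and> - K = {x. \<forall>p\<in>S K. p x = 0}"
    by (rule bchoice [THEN exE])
  have "x \<in> - \<Union>\<K> \<longleftrightarrow> (\<forall>p\<in>\<Union>(S ` \<K>). p x = 0)" for x
  proof -
    have "x \<in> - K \<longleftrightarrow> (\<forall>p\<in>S K. p x = 0)" if "K \<in> \<K>" for K
      using S that by blast
    then show ?thesis by simp
  qed
  then have "- \<Union>\<K> = {x. \<forall>p\<in>\<Union>(S ` \<K>). p x = 0}" by blast
  moreover have "\<forall>p\<in>\<Union>(S ` \<K>). polyfun p" using S by blast
  ultimately show "zariski_open (\<Union>\<K>)"
    unfolding zariski_open_def by blast
qed

definition affine_space :: "(complex ^ 'n::finite) fspace" where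
  "affine_space = \<lparr>
     zar = topology zariski_open,
     regular = (\<lambda>U. {f. \<forall>x\<in>U. \<exists>V g h. zariski_open V \<and> x \<in> V \<and> V \<subseteq> U \<and>
        polyfun g \<and> polyfun h \<and> (\<forall>y\<in>V. h y \<noteq> 0 \<and> f y = g y / h y)})\<rparr>"

lemma openin_affine_space: "openin (zar affine_space) U \<longleftrightarrow> zariski_open U"
  by (simp add: affine_space_def istopology_zariski)

lemma points_affine_space [simp]: "points affine_space = UNIV"
proof -
  have "zariski_open (UNIV :: (complex ^ 'n) set)"
    unfolding zariski_open_def
    by (rule exI[of _ "{\<lambda>x. 1}"]) (auto intro: polyfun_const)
  then have "openin (zar affine_space) (UNIV :: (complex ^ 'n) set)"
    by (simp add: openin_affine_space)
  then show ?thesis by (rule openin_subset [THEN top.extremum_uniqueI])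
qed

text \<open>
  The induced structure on a subset: on an open subset it is the open subvariety, on a closed
  subset the closed subvariety with its reduced structure.
\<close>

definition sub_fspace :: "'a fspace \<Rightarrow> 'a set \<Rightarrow> 'a fspace" where
  "sub_fspace X Z = \<lparr>
     zar = subtopology (zar X) Z,
     regular = (\<lambda>W. {f. \<forall>x\<in>W. \<exists>U g. openin (zar X) U \<and> x \<in> U \<and> g \<in> regular X U \<and>
        (\<forall>y\<in>U \<inter> W. f y = g y)})\<rparr>"

text \<open>
  The quotient by a group \<open>G\<close> of self-maps: its points are the orbits, and a function is regular
  iff its pull-back is.  For finite groups this is the usual quotient variety; for the weighted
  scalings of the punctured affine space it is the weighted projective space.
\<close>

definition orbit_of :: "('a \<Rightarrow> 'a) set \<Rightarrow> 'a \<Rightarrow> 'a set" where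
  "orbit_of G x = (\<lambda>g. g x) ` G"

definition quot_fspace :: "'a fspace \<Rightarrow> ('a \<Rightarrow> 'a) set \<Rightarrow> 'a set fspace" where
  "quot_fspace X G = \<lparr>
     zar = topology (\<lambda>V. V \<subseteq> orbit_of G ` points X \<and>
        openin (zar X) {x \<in> points X. orbit_of G x \<in> V}),
     regular = (\<lambda>V. {f. f \<circ> orbit_of G \<in> regular X {x \<in> points X. orbit_of G x \<in> V}})\<rparr>"

lemma openin_quot_fspace:
  "openin (zar (quot_fspace X G)) V \<longleftrightarrow>
     V \<subseteq> orbit_of G ` points X \<and> openin (zar X) {x \<in> points X. orbit_of G x \<in> V}"
proof -
  have "istopology (\<lambda>V. V \<subseteq> orbit_of G ` points X \<and>
      openin (zar X) {x \<in> points X. orbit_of G x \<in> V})" (is "istopology ?P")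
    unfolding istopology_def
  proof (intro conjI allI impI)
    fix S T assume ST: "?P S" "?P T"
    have "{x \<in> points X. orbit_of G x \<in> S \<inter> T}
        = {x \<in> points X. orbit_of G x \<in> S} \<inter> {x \<in> points X. orbit_of G x \<in> T}"
      by blast
    with ST show "openin (zar X) {x \<in> points X. orbit_of G x \<in> S \<inter> T}"
      by (simp add: openin_Int)
    from ST show "S \<inter> T \<subseteq> orbit_of G ` points X" by blast
  next
    fix \<K> assume K: "\<forall>K\<in>\<K>. ?P K"
    have "{x \<in> points X. orbit_of G x \<in> \<Union>\<K>}
        = \<Union>((\<lambda>K. {x \<in> points X. orbit_of G x \<in> K}) ` \<K>)"
      by blast
    with K show "openin (zar X) {x \<in> points X. orbit_of G x \<in> \<Union>\<K>}"
      by auto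
    from K show "\<Union>\<K> \<subseteq> orbit_of G ` points X" by blast
  qed
  then show ?thesis by (simp add: quot_fspace_def)
qed

lemma points_quot_fspace: "points (quot_fspace X G) = orbit_of G ` points X"
proof -
  have "{x \<in> points X. orbit_of G x \<in> orbit_of G ` points X} = points X" by blast
  then have "openin (zar (quot_fspace X G)) (orbit_of G ` points X)"
    by (simp add: openin_quot_fspace)
  then have "orbit_of G ` points X \<subseteq> points (quot_fspace X G)"
    by (rule openin_subset)
  moreover have "points (quot_fspace X G) \<subseteq> orbit_of G ` points X"
    using openin_topspace openin_quot_fspace by blast
  ultimately show ?thesis by (rule subset_antisym [rotated])
qed

definition morphism :: "'a fspace \<Rightarrow> 'b fspace \<Rightarrow> ('a \<Rightarrow> 'b) \<Rightarrow> bool" where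
  "morphism X Y f \<longleftrightarrow> continuous_map (zar X) (zar Y) f \<and>
     (\<forall>V. openin (zar Y) V \<longrightarrow>
        (\<forall>h\<in>regular Y V. h \<circ> f \<in> regular X {x \<in> points X. f x \<in> V}))"

definition isomorphism :: "'a fspace \<Rightarrow> 'b fspace \<Rightarrow> ('a \<Rightarrow> 'b) \<Rightarrow> bool" where
  "isomorphism X Y f \<longleftrightarrow> morphism X Y f \<and>
     (\<exists>g. morphism Y X g \<and> (\<forall>x\<in>points X. g (f x) = x) \<and> (\<forall>y\<in>points Y. f (g y) = y))"

definition aut_group :: "'a fspace \<Rightarrow> ('a \<Rightarrow> 'a) monoid" where
  "aut_group X = (BijGroup (points X))\<lparr>carrier := {f \<in> Bij (points X). isomorphism X X f}\<rparr>"

definition irreducible_fspace :: "'a fspace \<Rightarrow> bool" where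
  "irreducible_fspace X \<longleftrightarrow> points X \<noteq> {} \<and>
     (\<forall>C D. closedin (zar X) C \<and> closedin (zar X) D \<and> points X = C \<union> D \<longrightarrow>
        C = points X \<or> D = points X)"

definition dense_open :: "'a fspace \<Rightarrow> 'a set \<Rightarrow> bool" where
  "dense_open X U \<longleftrightarrow> openin (zar X) U \<and> Abstract_Topology.closure_of (zar X) U = points X"

text \<open>A rational map is given by a representative: a morphism \<open>f\<close> on a dense open set \<open>D\<close>.\<close>

definition rational_map :: "'a fspace \<Rightarrow> 'b fspace \<Rightarrow> 'a set \<Rightarrow> ('a \<Rightarrow> 'b) \<Rightarrow> bool" where
  "rational_map X Y D f \<longleftrightarrow> dense_open X D \<and> morphism (sub_fspace X D) Y f"

definition birationally_equivalent_maps ::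
  "'a fspace \<Rightarrow> 'b fspace \<Rightarrow> 'a set \<Rightarrow> ('a \<Rightarrow> 'b) \<Rightarrow> 'c fspace \<Rightarrow> 'a set \<Rightarrow> ('a \<Rightarrow> 'c) \<Rightarrow> bool" where
  "birationally_equivalent_maps X Y\<^sub>1 D\<^sub>1 f\<^sub>1 Y\<^sub>2 D\<^sub>2 f\<^sub>2 \<longleftrightarrow>
     rational_map X Y\<^sub>1 D\<^sub>1 f\<^sub>1 \<and> rational_map X Y\<^sub>2 D\<^sub>2 f\<^sub>2 \<and>
     (\<exists>U U\<^sub>1 U\<^sub>2 h. dense_open X U \<and> dense_open Y\<^sub>1 U\<^sub>1 \<and> dense_open Y\<^sub>2 U\<^sub>2 \<and>
        U \<subseteq> D\<^sub>1 \<inter> D\<^sub>2 \<and> f\<^sub>1 ` U \<subseteq> U\<^sub>1 \<and> f\<^sub>2 ` U \<subseteq> U\<^sub>2 \<and>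
        isomorphism (sub_fspace Y\<^sub>1 U\<^sub>1) (sub_fspace Y\<^sub>2 U\<^sub>2) h \<and>
        (\<forall>x\<in>U. h (f\<^sub>1 x) = f\<^sub>2 x))"

definition birational :: "'a fspace \<Rightarrow> 'b fspace \<Rightarrow> bool" where
  "birational X Y \<longleftrightarrow> (\<exists>U V h. dense_open X U \<and> dense_open Y V \<and>
     isomorphism (sub_fspace X U) (sub_fspace Y V) h)"


section \<open>Weighted projective space\<close>

definition wscale :: "int ^ 'n::finite \<Rightarrow> complex \<Rightarrow> complex ^ 'n \<Rightarrow> complex ^ 'n" where
  "wscale q c x = (\<chi> j. c powi (q $ j) * x $ j)"

definition scalings :: "int ^ 'n::finite \<Rightarrow> (complex ^ 'n \<Rightarrow> complex ^ 'n) set" where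
  "scalings q = wscale q ` (- {0})"

definition wproj :: "int ^ 'n::finite \<Rightarrow> (complex ^ 'n) set fspace" where
  "wproj q = quot_fspace (sub_fspace affine_space (- {0})) (scalings q)"

text \<open>The point with homogeneous coordinates \<open>x\<close>.\<close>

abbreviation wpt :: "int ^ 'n::finite \<Rightarrow> complex ^ 'n \<Rightarrow> (complex ^ 'n) set" where
  "wpt q x \<equiv> orbit_of (scalings q) x"

abbreviation proj :: "(complex ^ 'n::finite) set fspace" where
  "proj \<equiv> wproj (vec 1)"

text \<open>
  The function on a quotient (whose points are classes, i.e. sets) induced by a function that is
  constant on the classes.
\<close>

definition descend :: "('a \<Rightarrow> 'b) \<Rightarrow> 'a set \<Rightarrow> 'b" where
  "descend f P = the_elem (f ` P)"

lemma descend_eq: "x \<in> P \<Longrightarrow> (\<And>y. y \<in> P \<Longrightarrow> f y = f x) \<Longrightarrow> descend f P = f x"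
proof -
  assume "x \<in> P" and const: "\<And>y. y \<in> P \<Longrightarrow> f y = f x"
  have "f ` P = (\<lambda>_. f x) ` P" by (rule image_cong [OF refl const])
  also have "\<dots> = {f x}" using \<open>x \<in> P\<close> by (rule image_constant)
  finally have "f ` P = {f x}" .
  then show "descend f P = f x" by (simp add: descend_def)
qed

lemma wscale_wscale: "wscale q b (wscale q c x) = wscale q (b * c) x"
  by (simp add: wscale_def vec_eq_iff power_int_mult_distrib)

lemma wpt_wscale:
  assumes "c \<noteq> 0" shows "wpt q (wscale q c x) = wpt q x"
proof -
  have "b \<in> (\<lambda>b. b * c) ` (- {0})" if "b \<noteq> 0" for b
    using assms that by (intro image_eqI[of _ _ "b / c"]) auto
  then have units: "(\<lambda>b. b * c) ` (- {0}) = - {0}"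
    using assms by auto
  have "wpt q (wscale q c x) = (\<lambda>b. wscale q b x) ` ((\<lambda>b. b * c) ` (- {0}))"
    by (simp add: orbit_of_def scalings_def image_image wscale_wscale)
  also have "\<dots> = wpt q x"
    unfolding units by (simp add: orbit_of_def scalings_def image_image)
  finally show ?thesis .
qed

lemma descend_wpt:
  assumes "\<And>c. c \<noteq> 0 \<Longrightarrow> f (wscale q c x) = f x"
  shows "descend f (wpt q x) = f x"
proof -
  have "wscale q 1 x = x" by (simp add: wscale_def)
  then have "x \<in> wpt q x"
    unfolding orbit_of_def scalings_def image_image by (intro image_eqI[of _ _ 1]) auto
  moreover have "f y = f x" if "y \<in> wpt q x" for y
    using that assms unfolding orbit_of_def scalings_def by auto
  ultimately show ?thesis by (rule descend_eq)
qed


section \<open>Data attached to the exponent matrix\<close>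

definition Ainv :: "nat ^ 'n ^ 'n::finite \<Rightarrow> rat ^ 'n ^ 'n" where
  "Ainv A = matrix_inv (map_matrix of_nat A)"

definition dnum :: "nat ^ 'n ^ 'n::finite \<Rightarrow> nat" where
  "dnum A = (LEAST d. 0 < d \<and> (\<forall>i j. of_nat d * Ainv A $ i $ j \<in> \<int>))"

text \<open>The floor only converts the type: the entries of \<open>d A\<^sup>-\<^sup>1\<close> are integers by the choice of \<open>d\<close>.\<close>

definition Bmat :: "nat ^ 'n ^ 'n::finite \<Rightarrow> int ^ 'n ^ 'n" where
  "Bmat A = (\<chi> i j. \<lfloor>of_nat (dnum A) * Ainv A $ i $ j\<rfloor>)"

definition qwt :: "nat ^ 'n ^ 'n::finite \<Rightarrow> int ^ 'n" where
  "qwt A = Bmat A *v vec 1"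

definition qwt' :: "nat ^ 'n ^ 'n::finite \<Rightarrow> int ^ 'n" where
  "qwt' A = transpose (Bmat A) *v vec 1"

definition Fpoly :: "nat ^ 'n ^ 'n::finite \<Rightarrow> complex ^ 'n \<Rightarrow> complex" where
  "Fpoly A x = (\<Sum>i\<in>UNIV. \<Prod>j\<in>UNIV. (x $ j) ^ (A $ i $ j))"

definition XA :: "nat ^ 'n ^ 'n::finite \<Rightarrow> (complex ^ 'n) set fspace" where
  "XA A = sub_fspace (wproj (qwt A)) {P \<in> points (wproj (qwt A)). \<forall>x\<in>P. Fpoly A x = 0}"

definition Fermat :: "nat \<Rightarrow> (complex ^ 'n::finite) set fspace" where
  "Fermat d = sub_fspace proj {P \<in> points proj. \<forall>y\<in>P. (\<Sum>i\<in>UNIV. (y $ i) ^ d) = 0}"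

text \<open>
  The rational map \<open>\<phi>\<^sub>A\<close>.  Entries of \<open>B\<close> may be negative, so the representative lives on the
  points with all coordinates nonzero.
\<close>

definition phi_coords :: "nat ^ 'n ^ 'n::finite \<Rightarrow> complex ^ 'n \<Rightarrow> complex ^ 'n" where
  "phi_coords A y = (\<chi> j. \<Prod>k\<in>UNIV. (y $ k) powi (Bmat A $ j $ k))"

definition phiA :: "nat ^ 'n ^ 'n::finite \<Rightarrow> (complex ^ 'n) set \<Rightarrow> (complex ^ 'n) set" where
  "phiA A = descend (\<lambda>y. wpt (qwt A) (phi_coords A y))"

definition phi_dom :: "nat ^ 'n ^ 'n::finite \<Rightarrow> (complex ^ 'n) set set" where
  "phi_dom A = {P \<in> points (Fermat (dnum A)). \<forall>y\<in>P. \<forall>k. y $ k \<noteq> 0}"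

lemma phi_coords_wscale:
  fixes A :: "nat ^ 'n ^ 'n::finite"
  assumes "c \<noteq> 0"
  shows "phi_coords A (wscale (vec 1) c y) = wscale (qwt A) c (phi_coords A y)"
proof -
  have sum: "(\<Prod>k\<in>S. c powi f k) = c powi (\<Sum>k\<in>S. f k)"
    if "finite S" for S :: "'n set" and f :: "'n \<Rightarrow> int"
    using that
  proof (induction S rule: finite_induct)
    case (insert k S)
    then show ?case using power_int_add[of c "f k" "sum f S"] assms by simp
  qed simp
  have "phi_coords A (wscale (vec 1) c y) $ j = wscale (qwt A) c (phi_coords A y) $ j" for j
  proof -
    have "phi_coords A (wscale (vec 1) c y) $ j
        = (\<Prod>k\<in>UNIV. c powi (Bmat A $ j $ k)) * phi_coords A y $ j"
      by (simp add: phi_coords_def wscale_def power_int_mult_distrib prod.distrib)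
    also have "(\<Prod>k\<in>UNIV. c powi (Bmat A $ j $ k)) = c powi (qwt A $ j)"
      by (simp add: sum qwt_def matrix_vector_mult_def)
    finally show ?thesis by (simp add: wscale_def)
  qed
  then show ?thesis by (simp add: vec_eq_iff)
qed

lemma phiA_wpt: "phiA A (wpt (vec 1) y) = wpt (qwt A) (phi_coords A y)"
  unfolding phiA_def by (intro descend_wpt) (simp only: phi_coords_wscale wpt_wscale not_False_eq_True)

text \<open>
  The coordinates \<open>u\<^sub>0, \<dots>, u\<^sub>n\<close> of \<open>\<P>\<^sup>n\<close> are indexed by \<open>'n option\<close>, with \<open>None\<close> for \<open>u\<^sub>0\<close>.
\<close>

definition q_coords :: "nat ^ 'n ^ 'n::finite \<Rightarrow> complex ^ 'n \<Rightarrow> complex ^ 'n option" where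
  "q_coords A x = (\<chi> r. case r of None \<Rightarrow> \<Prod>j\<in>UNIV. x $ j
                        | Some i \<Rightarrow> \<Prod>j\<in>UNIV. (x $ j) ^ (A $ i $ j))"

definition qA :: "nat ^ 'n ^ 'n::finite \<Rightarrow> (complex ^ 'n) set \<Rightarrow> (complex ^ 'n option) set" where
  "qA A = descend (\<lambda>x. wpt (vec 1) (q_coords A x))"

definition q_dom :: "nat ^ 'n ^ 'n::finite \<Rightarrow> (complex ^ 'n) set set" where
  "q_dom A = {P \<in> points (XA A). \<forall>x\<in>P. q_coords A x \<noteq> 0}"

text \<open>
  The closure of the image of \<open>q\<^sub>A \<circ> \<phi>\<^sub>A\<close>, taken on the common domain of the
  representatives; the closure does not change when the domain shrinks to a dense open subset.
\<close>

definition shioda_quotient :: "nat ^ 'n ^ 'n::finite \<Rightarrow> (complex ^ 'n option) set fspace" where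
  "shioda_quotient A = sub_fspace proj
     (Abstract_Topology.closure_of (zar proj) ((qA A \<circ> phiA A) ` {P \<in> phi_dom A. phiA A P \<in> q_dom A}))"


section \<open>The finite groups\<close>

definition primitive_root_of_unity :: "nat \<Rightarrow> complex \<Rightarrow> bool" where
  "primitive_root_of_unity d \<zeta> \<longleftrightarrow> 0 < d \<and> \<zeta> ^ d = 1 \<and> (\<forall>m. 0 < m \<and> m < d \<longrightarrow> \<zeta> ^ m \<noteq> 1)"

text \<open>The diagonal map \<open>g\<^sub>k\<close> on \<open>W\<P>(q)\<close>, where \<open>k \<in> (\<int>/d)\<^sup>n\<close> is given by integer representatives.\<close>

definition gmap ::
  "int ^ 'n::finite \<Rightarrow> complex \<Rightarrow> ('n \<Rightarrow> int) \<Rightarrow> (complex ^ 'n) set \<Rightarrow> (complex ^ 'n) set" where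
  "gmap q \<zeta> k = descend (\<lambda>x. wpt q (\<chi> i. \<zeta> powi (k i) * x $ i))"

lemma gmap_wpt: "gmap q \<zeta> k (wpt q x) = wpt q (\<chi> i. \<zeta> powi (k i) * x $ i)"
proof -
  have "(\<chi> i. \<zeta> powi (k i) * wscale q c x $ i) = wscale q c (\<chi> i. \<zeta> powi (k i) * x $ i)" for c
    by (simp add: wscale_def vec_eq_iff)
  then show ?thesis
    unfolding gmap_def by (intro descend_wpt) (simp add: wpt_wscale)
qed

definition Bvec :: "nat ^ 'n ^ 'n::finite \<Rightarrow> ('n \<Rightarrow> int) \<Rightarrow> 'n \<Rightarrow> int" where
  "Bvec A k = (\<lambda>j. \<Sum>i\<in>UNIV. Bmat A $ j $ i * k i)"

definition ZdZn :: "nat \<Rightarrow> ('n::finite \<Rightarrow> int) monoid" where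
  "ZdZn d = product_group UNIV (\<lambda>_. integer_mod_group d)"

definition diag_group :: "nat ^ 'n ^ 'n::finite \<Rightarrow> ('n \<Rightarrow> int) monoid" where
  "diag_group A = (ZdZn (dnum A))\<lparr>carrier :=
     {k \<in> carrier (ZdZn (dnum A)). int (dnum A) dvd (\<Sum>j\<in>UNIV. k j * qwt' A $ j)}\<rparr>"

definition Gamma_grp :: "nat ^ 'n ^ 'n::finite \<Rightarrow> ('n \<Rightarrow> int) set monoid" where
  "Gamma_grp A = diag_group A Mod generate (diag_group A) {\<lambda>_. 1 mod int (dnum A)}"

definition act_Fermat ::
  "nat ^ 'n ^ 'n::finite \<Rightarrow> complex \<Rightarrow> ('n \<Rightarrow> int) set \<Rightarrow> (complex ^ 'n) set \<Rightarrow> (complex ^ 'n) set" where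
  "act_Fermat A \<zeta> = descend (\<lambda>k. restrict (gmap (vec 1) \<zeta> k) (points (Fermat (dnum A))))"

definition act_XA ::
  "nat ^ 'n ^ 'n::finite \<Rightarrow> complex \<Rightarrow> ('n \<Rightarrow> int) set \<Rightarrow> (complex ^ 'n) set \<Rightarrow> (complex ^ 'n) set" where
  "act_XA A \<zeta> = descend (\<lambda>k. restrict (gmap (qwt A) \<zeta> (Bvec A k)) (points (XA A)))"

definition GammaA :: "nat ^ 'n ^ 'n::finite \<Rightarrow> complex \<Rightarrow> ('n \<Rightarrow> int) set set" where
  "GammaA A \<zeta> = kernel (Gamma_grp A) (aut_group (XA A)) (act_XA A \<zeta>)"

definition HA ::
  "nat ^ 'n ^ 'n::finite \<Rightarrow> complex \<Rightarrow> ((complex ^ 'n) set \<Rightarrow> (complex ^ 'n) set) set" where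
  "HA A \<zeta> = act_XA A \<zeta> ` carrier (Gamma_grp A)"

definition Fermat_mod_GammaA :: "nat ^ 'n ^ 'n::finite \<Rightarrow> complex \<Rightarrow> (complex ^ 'n) set set fspace" where
  "Fermat_mod_GammaA A \<zeta> = quot_fspace (Fermat (dnum A)) (act_Fermat A \<zeta> ` GammaA A \<zeta>)"

definition XA_mod_HA :: "nat ^ 'n ^ 'n::finite \<Rightarrow> complex \<Rightarrow> (complex ^ 'n) set set fspace" where
  "XA_mod_HA A \<zeta> = quot_fspace (XA A) (HA A \<zeta>)"

end

(*
  On the tori, phi_A and q_A are monomial maps, i.e. restrictions of homomorphisms of tori, and
  such a map is the quotient by its kernel.  Concretely, every function that is regular on the
  source and constant on the fibres is locally a quotient of two polynomials; splitting these into
  semi-invariant components under the kernel (linear independence of characters) leaves quotients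
  of Laurent monomials, and a character trivial on the kernel is a monomial in the target
  coordinates.  Modulo the scalings, the fibres of phi_A are the Gamma_A-orbits and those of q_A
  the H_A-orbits, because A B = B A = d.  The torus part of X_A is dense by irreducibility, that of
  the Fermat variety by perturbing the coordinates.
*)
theory Submission
  imports Defs
begin

section \<open>Monomials and semi-invariant components of polynomials\<close>

text \<open>For a regular \<open>f\<close> the identity \<open>f b = a\<close> holds only on the
  cone over the variety, so isotypic components cannot be compared as polynomials. They are compared
  along one orbit instead: for fixed \<open>z\<close> the value of \<open>f\<close> is a constant
  \<open>v\<close>, and independence of characters is applied to
  \<open>t \<mapsto> u * a (t * z) + v * b (t * z)\<close>. No ideal of the variety enters. The same
  device, with the group of scalings in place of the kernel, makes fractions homogeneous. Open sets
  have to descend too, because a bijective morphism need not be an isomorphism. The two maps are not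
  equally easy. For phi_A, \<open>A B = B A = d\<close> alone identifies the characters trivial on
  the kernel. For q_A the coordinate u_0 cuts the group down to the \<open>k\<close> with
  \<open>k . q' = 0\<close> mod \<open>d\<close>, and the answer is duality over Z/d. Moreover the
  Shioda quotient is a closure, and it must be shown that the closure acquires no new points in the
  torus; the relation \<open>u_0^d = \<Prod> u_k^q'_k\<close> is too weak for this when
  \<open>d\<close> and the \<open>q'_k\<close> have a common factor.\<close>

definition lmon :: "('n::finite \<Rightarrow> int) \<Rightarrow> complex ^ 'n \<Rightarrow> complex" where
  "lmon m x = (\<Prod>k\<in>UNIV. (x $ k) powi m k)"

definition tor :: "(complex ^ 'n::finite) set" where
  "tor = {x. \<forall>k. x $ k \<noteq> 0}"

definition monmap :: "('m::finite \<Rightarrow> 'n::finite \<Rightarrow> int) \<Rightarrow> complex ^ 'n \<Rightarrow> complex ^ 'm" where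
  "monmap E x = (\<chi> j. lmon (E j) x)"

lemma monmap_nth [simp]: "monmap E x $ j = lmon (E j) x"
  by (simp add: monmap_def)

lemma lmon_mult: "lmon m (x * y) = lmon m x * lmon m y"
  by (simp add: lmon_def power_int_mult_distrib prod.distrib)

lemma lmon_one [simp]: "lmon m 1 = 1"
  by (simp add: lmon_def)

lemma lmon_zero [simp]: "lmon (\<lambda>_. 0) x = 1"
  by (simp add: lmon_def)

lemma lmon_nonzero: "x \<in> tor \<Longrightarrow> lmon m x \<noteq> 0"
  by (simp add: lmon_def tor_def)

lemma lmon_add: "x \<in> tor \<Longrightarrow> lmon (\<lambda>k. m k + m' k) x = lmon m x * lmon m' x"
  by (simp add: lmon_def tor_def power_int_add prod.distrib)

text \<open>The torus hypothesis of \<open>lmon_add\<close> is there because \<open>0\<close> to a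
  negative power is \<open>0\<close>. With natural exponents the rule holds at every point, as the
  expansion of a polynomial requires.\<close>

lemma lmon_add_nat:
  fixes m m' :: "'n::finite \<Rightarrow> nat"
  shows "lmon (\<lambda>k. int (m k + m' k)) x = lmon (\<lambda>k. int (m k)) x * lmon (\<lambda>k. int (m' k)) x"
proof -
  have "lmon (\<lambda>k. int (m k + m' k)) x = (\<Prod>k\<in>UNIV. x $ k ^ (m k + m' k))"
    unfolding lmon_def power_int_of_nat ..
  then show ?thesis
    by (simp add: lmon_def power_add prod.distrib)
qed

lemma lmon_diff: "x \<in> tor \<Longrightarrow> lmon (\<lambda>k. m k - m' k) x = lmon m x / lmon m' x"
  by (simp add: lmon_def tor_def power_int_diff prod_dividef)

lemma lmon_smult: "lmon (\<lambda>k. e * m k) x = lmon m x powi e"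
proof -
  have "(\<Prod>k\<in>S. f k powi e) = (\<Prod>k\<in>S. f k) powi e" if "finite S" for S and f :: "'a \<Rightarrow> complex"
    using that by (induction S rule: finite_induct) (auto simp: power_int_mult_distrib)
  then show ?thesis
    by (simp add: lmon_def mult.commute[of e] power_int_mult)
qed

lemma power_int_sum:
  fixes c :: complex
  assumes "c \<noteq> 0"
  shows "(\<Prod>k\<in>S. c powi f k) = c powi (\<Sum>k\<in>S. f k)"
proof (induction S rule: infinite_finite_induct)
  case (insert k S)
  then show ?case using assms by (simp add: power_int_add)
qed auto

lemma lmon_wscale:
  assumes "c \<noteq> 0"
  shows "lmon m (wscale q c x) = c powi (\<Sum>k\<in>UNIV. m k * q $ k) * lmon m x"
proof -
  have "(\<Prod>k\<in>UNIV. (c powi (q $ k)) powi m k) = c powi (\<Sum>k\<in>UNIV. m k * q $ k)"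
    using assms by (simp add: power_int_mult [symmetric] power_int_sum mult.commute)
  then show ?thesis
    by (simp add: lmon_def wscale_def power_int_mult_distrib prod.distrib)
qed

lemma lmon_sum:
  assumes "x \<in> tor" "finite S"
  shows "lmon (\<lambda>k. \<Sum>j\<in>S. f j k) x = (\<Prod>j\<in>S. lmon (f j) x)"
  using assms(2) by (induction S rule: finite_induct) (auto simp: lmon_add assms(1))

lemma lmon_monmap:
  assumes "x \<in> tor"
  shows "lmon r (monmap E x) = lmon (\<lambda>k. \<Sum>j\<in>UNIV. r j * E j k) x"
  unfolding lmon_sum[OF assms finite_class.finite_UNIV] lmon_smult by (simp add: lmon_def)

lemma monmap_mult: "monmap E (x * y) = monmap E x * monmap E y"
  by (simp add: vec_eq_iff lmon_mult)

lemma monmap_tor: "x \<in> tor \<Longrightarrow> monmap E x \<in> tor"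
  by (simp add: tor_def[of] lmon_nonzero[unfolded tor_def])

lemma monmap_one [simp]: "monmap E 1 = 1"
  by (simp add: vec_eq_iff)

lemma one_in_tor [simp]: "1 \<in> tor"
  by (simp add: tor_def)

lemma mult_in_tor: "x \<in> tor \<Longrightarrow> y \<in> tor \<Longrightarrow> x * y \<in> tor"
  by (simp add: tor_def)

lemma tor_nonzero: "x \<in> tor \<Longrightarrow> x \<noteq> 0"
  by (auto simp: tor_def)

lemma wscale_nth: "wscale q c x $ j = c powi (q $ j) * x $ j"
  by (simp add: wscale_def)

lemma wscale_eq_mult: "wscale q c x = wscale q c 1 * x"
  by (simp add: vec_eq_iff wscale_def)

lemma wscale_one_in_tor: "c \<noteq> 0 \<Longrightarrow> wscale q c 1 \<in> tor"
  by (simp add: tor_def wscale_def)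

lemma wscale_in_tor_iff: "c \<noteq> 0 \<Longrightarrow> wscale q c x \<in> tor \<longleftrightarrow> x \<in> tor"
  by (simp add: tor_def wscale_def)

lemma polyfun_sum: "(\<And>i. i \<in> S \<Longrightarrow> polyfun (f i)) \<Longrightarrow> polyfun (\<lambda>x. \<Sum>i\<in>S. f i x)"
  by (induction S rule: infinite_finite_induct) (auto intro: polyfun_const polyfun_add)

lemma polyfun_prod: "(\<And>i. i \<in> S \<Longrightarrow> polyfun (f i)) \<Longrightarrow> polyfun (\<lambda>x. \<Prod>i\<in>S. f i x)"
  by (induction S rule: infinite_finite_induct) (auto intro: polyfun_const polyfun_mult)

lemma polyfun_power: "polyfun f \<Longrightarrow> polyfun (\<lambda>x. f x ^ n)"
  by (induction n) (auto intro: polyfun_const polyfun_mult)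

lemma polyfun_diff:
  assumes "polyfun f" "polyfun g" shows "polyfun (\<lambda>x. f x - g x)"
  using polyfun_add[OF assms(1) polyfun_mult[OF polyfun_const[of "-1"] assms(2)]] by simp

lemma polyfun_lmon: "(\<And>k. 0 \<le> m k) \<Longrightarrow> polyfun (lmon m)"
  unfolding lmon_def
  by (intro polyfun_prod) (auto simp: power_int_def intro: polyfun_power polyfun_coord)

lemma polyfun_comp:
  assumes "polyfun p" and "\<And>j. polyfun (\<lambda>x. \<Phi> x $ j)"
  shows "polyfun (\<lambda>x. p (\<Phi> x))"
  using assms(1) by induction (auto intro: polyfun.intros assms(2))

lemma polyfun_continuous: "polyfun p \<Longrightarrow> continuous_on UNIV p"
  by (induction rule: polyfun.induct) (auto intro!: continuous_intros)

text \<open>\<open>polyfun\<close> is a property of functions and carries no coefficients; induction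
  on its rules recovers an expansion, whose terms can then be sorted by characters.\<close>

lemma polyfun_monomials:
  assumes "polyfun p"
  obtains M and c :: "('n::finite \<Rightarrow> nat) \<Rightarrow> complex"
  where "finite M" "\<And>x. p x = (\<Sum>m\<in>M. c m * lmon (\<lambda>k. int (m k)) x)"
proof -
  have "\<exists>M c. finite M \<and> (\<forall>x. p x = (\<Sum>m\<in>M. c m * lmon (\<lambda>k. int (m k)) x))"
    using assms
  proof induction
    case (polyfun_const c)
    show ?case
      by (intro exI[of _ "{\<lambda>_. 0}"] exI[of _ "\<lambda>_. c"]) simp
  next
    case (polyfun_coord i)
    have "lmon (\<lambda>k. int (if k = i then 1 else 0)) x = x $ i" for x :: "complex ^ 'n"
    proof -
      have "lmon (\<lambda>k. int (if k = i then 1 else 0)) x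
          = (\<Prod>k\<in>UNIV. if k = i then x $ k else 1)"
        unfolding lmon_def by (intro prod.cong) auto
      then show ?thesis by simp
    qed
    then show ?case
      by (intro exI[of _ "{\<lambda>k. if k = i then 1 else 0}"] exI[of _ "\<lambda>_. 1"]) simp
  next
    case (polyfun_add f g)
    then obtain M c N e where M: "finite M" "\<forall>x. f x = (\<Sum>m\<in>M. c m * lmon (\<lambda>k. int (m k)) x)"
      and N: "finite N" "\<forall>x. g x = (\<Sum>m\<in>N. e m * lmon (\<lambda>k. int (m k)) x)"
      by blast
    let ?c = "\<lambda>m. (if m \<in> M then c m else 0) + (if m \<in> N then e m else 0)"
    have "f x + g x = (\<Sum>m\<in>M \<union> N. ?c m * lmon (\<lambda>k. int (m k)) x)" for x
    proof -
      have "(\<Sum>m\<in>M. c m * lmon (\<lambda>k. int (m k)) x)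
          = (\<Sum>m\<in>M \<union> N. (if m \<in> M then c m else 0) * lmon (\<lambda>k. int (m k)) x)"
        using M(1) N(1) by (intro sum.mono_neutral_cong_left) auto
      moreover have "(\<Sum>m\<in>N. e m * lmon (\<lambda>k. int (m k)) x)
          = (\<Sum>m\<in>M \<union> N. (if m \<in> N then e m else 0) * lmon (\<lambda>k. int (m k)) x)"
        using M(1) N(1) by (intro sum.mono_neutral_cong_left) auto
      ultimately show ?thesis
        using M(2) N(2) by (simp only: distrib_right sum.distrib)
    qed
    then show ?case using M(1) N(1) by (intro exI[of _ "M \<union> N"] exI[of _ ?c]) blast
  next
    case (polyfun_mult f g)
    then obtain M c N e where M: "finite M" "\<forall>x. f x = (\<Sum>m\<in>M. c m * lmon (\<lambda>k. int (m k)) x)"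
      and N: "finite N" "\<forall>x. g x = (\<Sum>m\<in>N. e m * lmon (\<lambda>k. int (m k)) x)"
      by blast
    \<comment> \<open>Different pairs of exponents can have the same sum, so \<open>h\<close>
      collects the products of coefficients over each fibre of \<open>s\<close>.\<close>
    define s :: "('n \<Rightarrow> nat) \<times> ('n \<Rightarrow> nat) \<Rightarrow> 'n \<Rightarrow> nat" where "s = (\<lambda>(m, n) k. m k + n k)"
    define h where "h = (\<lambda>r. \<Sum>p\<in>{p \<in> M \<times> N. s p = r}. c (fst p) * e (snd p))"
    have fin: "finite (M \<times> N)" using M(1) N(1) by blast
    have "f x * g x = (\<Sum>r\<in>s ` (M \<times> N). h r * lmon (\<lambda>k. int (r k)) x)" for x
    proof -
      have "f x * g x = (\<Sum>p\<in>M \<times> N. (c (fst p) * e (snd p)) * lmon (\<lambda>k. int (s p k)) x)"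
        using M(2) N(2)
        by (simp add: sum_product sum.cartesian_product s_def split_beta lmon_add_nat mult_ac
            del: of_nat_add)
      also have "\<dots> = (\<Sum>r\<in>s ` (M \<times> N). \<Sum>p\<in>{p \<in> M \<times> N. s p = r}.
          (c (fst p) * e (snd p)) * lmon (\<lambda>k. int (s p k)) x)"
        by (rule sum.image_gen[OF fin])
      also have "\<dots> = (\<Sum>r\<in>s ` (M \<times> N). h r * lmon (\<lambda>k. int (r k)) x)"
        unfolding h_def sum_distrib_right by (intro sum.cong refl) auto
      finally show ?thesis .
    qed
    then show ?case using fin by (intro exI[of _ "s ` (M \<times> N)"] exI[of _ h]) blast
  qed
  then show thesis using that by blast
qed

section \<open>Isotypic components for a subgroup of the torus\<close>

text \<open>Artin's argument: the relation at \<open>s * t\<close> minus \<open>\<psi> s\<close>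
  times the relation at \<open>t\<close> removes the term of \<open>\<psi>\<close>, so by induction
  \<open>(\<rho> s - \<psi> s) * v \<rho> = 0\<close> for all \<open>s\<close>. Only products are
  used, so a submonoid \<open>K\<close> is enough.\<close>

lemma characters_independent:
  fixes C :: "(('a::monoid_mult) \<Rightarrow> 'b::field) set"
  assumes "finite C" and one: "1 \<in> K" and mult: "\<And>s t. s \<in> K \<Longrightarrow> t \<in> K \<Longrightarrow> s * t \<in> K"
    and char: "\<And>\<rho> s t. \<rho> \<in> C \<Longrightarrow> s \<in> K \<Longrightarrow> t \<in> K \<Longrightarrow> \<rho> (s * t) = \<rho> s * \<rho> t"
    and char_one: "\<And>\<rho>. \<rho> \<in> C \<Longrightarrow> \<rho> 1 = 1"
    and distinct: "\<And>\<rho> \<psi>. \<rho> \<in> C \<Longrightarrow> \<psi> \<in> C \<Longrightarrow> \<rho> \<noteq> \<psi> \<Longrightarrow> \<exists>t\<in>K. \<rho> t \<noteq> \<psi> t"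
    and zero: "\<And>t. t \<in> K \<Longrightarrow> (\<Sum>\<rho>\<in>C. \<rho> t * v \<rho>) = 0"
  shows "\<forall>\<rho>\<in>C. v \<rho> = 0"
  using assms(1) char char_one distinct zero
proof (induction C arbitrary: v rule: finite_induct)
  case empty
  then show ?case by simp
next
  case (insert \<psi> C)
  have "\<forall>\<rho>\<in>C. (\<rho> s - \<psi> s) * v \<rho> = 0" if s: "s \<in> K" for s
  proof (rule insert.IH)
    fix t assume t: "t \<in> K"
    have "(\<Sum>\<rho>\<in>C. \<rho> t * ((\<rho> s - \<psi> s) * v \<rho>))
        = (\<Sum>\<rho>\<in>insert \<psi> C. \<rho> t * ((\<rho> s - \<psi> s) * v \<rho>))"
      using insert.hyps by simp
    also have "\<dots> = (\<Sum>\<rho>\<in>insert \<psi> C. \<rho> (s * t) * v \<rho> - \<psi> s * (\<rho> t * v \<rho>))"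
    proof (intro sum.cong refl)
      fix \<rho> assume "\<rho> \<in> insert \<psi> C"
      from insert.prems(1)[OF this s t]
      show "\<rho> t * ((\<rho> s - \<psi> s) * v \<rho>) = \<rho> (s * t) * v \<rho> - \<psi> s * (\<rho> t * v \<rho>)"
        by (simp add: algebra_simps)
    qed
    also have "\<dots> = (\<Sum>\<rho>\<in>insert \<psi> C. \<rho> (s * t) * v \<rho>)
        - \<psi> s * (\<Sum>\<rho>\<in>insert \<psi> C. \<rho> t * v \<rho>)"
      by (simp only: sum_subtractf sum_distrib_left)
    finally have "(\<Sum>\<rho>\<in>C. \<rho> t * ((\<rho> s - \<psi> s) * v \<rho>))
        = (\<Sum>\<rho>\<in>insert \<psi> C. \<rho> (s * t) * v \<rho>)
        - \<psi> s * (\<Sum>\<rho>\<in>insert \<psi> C. \<rho> t * v \<rho>)" .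
    then show "(\<Sum>\<rho>\<in>C. \<rho> t * ((\<rho> s - \<psi> s) * v \<rho>)) = 0"
      
      unfolding insert.prems(4)[OF mult[OF s t]] insert.prems(4)[OF t] by simp
  qed (use insert.prems(1-3) in \<open>blast+\<close>)
  moreover have "\<exists>s\<in>K. \<rho> s \<noteq> \<psi> s" if "\<rho> \<in> C" for \<rho>
    using insert.prems(3)[of \<rho> \<psi>] insert.hyps that by blast
  ultimately have "\<forall>\<rho>\<in>C. v \<rho> = 0" by fastforce
  moreover from this have "v \<psi> = 0"
    using insert.prems(4)[OF one] insert.prems(2)[of \<psi>] insert.hyps by simp
  ultimately show ?case by simp
qed

text \<open>
  Splitting \<open>u a + v b\<close> into its isotypic parts for the characters of \<open>K\<close> and keeping one part
  on which \<open>b\<close> does not vanish at \<open>y\<close>.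
\<close>

lemma semi_invariant_components:
  fixes a b :: "complex ^ 'n::finite \<Rightarrow> complex"
  assumes "polyfun a" "polyfun b" "b y \<noteq> 0"
    and one: "1 \<in> K" and mult: "\<forall>s\<in>K. \<forall>t\<in>K. s * t \<in> K"
  obtains M :: "('n \<Rightarrow> nat) set" and cb ca where "finite M"
    and "\<forall>m\<in>M. \<forall>m'\<in>M. \<forall>t\<in>K.
           lmon (\<lambda>k. int (m k)) t = lmon (\<lambda>k. int (m' k)) t"
    and "(\<Sum>m\<in>M. cb m * lmon (\<lambda>k. int (m k)) y) \<noteq> 0"
    and "\<forall>z u v. (\<forall>t\<in>K. u * a (t * z) + v * b (t * z) = 0) \<longrightarrow>
           u * (\<Sum>m\<in>M. ca m * lmon (\<lambda>k. int (m k)) z)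
         + v * (\<Sum>m\<in>M. cb m * lmon (\<lambda>k. int (m k)) z) = 0"
proof -
  let ?l = "\<lambda>m :: 'n \<Rightarrow> nat. lmon (\<lambda>k. int (m k))"
  obtain Ma a' where Ma: "finite Ma" "\<And>x. a x = (\<Sum>m\<in>Ma. a' m * ?l m x)"
    using polyfun_monomials[OF assms(1)] by blast
  obtain Mb b' where Mb: "finite Mb" "\<And>x. b x = (\<Sum>m\<in>Mb. b' m * ?l m x)"
    using polyfun_monomials[OF assms(2)] by blast
  define N where "N = Ma \<union> Mb"
  define ca where "ca m = (if m \<in> Ma then a' m else 0)" for m
  define cb where "cb m = (if m \<in> Mb then b' m else 0)" for m
  have N: "finite N" using Ma(1) Mb(1) by (simp add: N_def)
  have a: "a x = (\<Sum>m\<in>N. ca m * ?l m x)" for x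
    unfolding Ma(2) using N by (intro sum.mono_neutral_cong_left) (auto simp: N_def ca_def)
  have b: "b x = (\<Sum>m\<in>N. cb m * ?l m x)" for x
    unfolding Mb(2) using N by (intro sum.mono_neutral_cong_left) (auto simp: N_def cb_def)
  \<comment> \<open>Setting the character to \<open>0\<close> off \<open>K\<close> makes exponents
    with equal restrictions to \<open>K\<close> give equal functions, so that the image of
    \<open>N\<close> under \<open>X\<close> is a set of characters separated by points of
    \<open>K\<close>.\<close>
  define X where "X m = (\<lambda>t. if t \<in> K then ?l m t else 0)" for m
  let ?part = "\<lambda>\<rho>. {m \<in> N. X m = \<rho>}"
  have split: "(\<Sum>m\<in>N. f m) = (\<Sum>\<rho>\<in>X ` N. \<Sum>m\<in>?part \<rho>. f m)"
    for f :: "('n \<Rightarrow> nat) \<Rightarrow> complex"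
    by (rule sum.image_gen[OF N])
  have "\<exists>\<rho>\<in>X ` N. (\<Sum>m\<in>?part \<rho>. cb m * ?l m y) \<noteq> 0"
  proof (rule ccontr)
    assume "\<not> ?thesis"
    then have "(\<Sum>m\<in>N. cb m * ?l m y) = 0" unfolding split by (intro sum.neutral) blast
    with b assms(3) show False by simp
  qed
  then obtain \<rho> where \<rho>: "\<rho> \<in> X ` N" "(\<Sum>m\<in>?part \<rho>. cb m * ?l m y) \<noteq> 0" by blast
  show thesis
  proof (rule that)
    show "finite (?part \<rho>)" using N by simp
    show "(\<Sum>m\<in>?part \<rho>. cb m * ?l m y) \<noteq> 0" by (fact \<rho>(2))
    show "\<forall>m\<in>?part \<rho>. \<forall>m'\<in>?part \<rho>. \<forall>t\<in>K. ?l m t = ?l m' t"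
    proof (intro ballI)
      fix m m' t assume "m \<in> ?part \<rho>" "m' \<in> ?part \<rho>" "t \<in> K"
      then have "X m t = X m' t" by simp
      with \<open>t \<in> K\<close> show "?l m t = ?l m' t" by (simp add: X_def)
    qed
    show "\<forall>z u v. (\<forall>t\<in>K. u * a (t * z) + v * b (t * z) = 0) \<longrightarrow>
        u * (\<Sum>m\<in>?part \<rho>. ca m * ?l m z) + v * (\<Sum>m\<in>?part \<rho>. cb m * ?l m z) = 0"
    proof (intro allI impI)
      fix z u v assume uv: "\<forall>t\<in>K. u * a (t * z) + v * b (t * z) = 0"
      let ?w = "\<lambda>\<rho>. \<Sum>m\<in>?part \<rho>. (u * ca m + v * cb m) * ?l m z"
      \<comment> \<open>Here \<open>z\<close>, \<open>u\<close>, \<open>v\<close> are fixed and only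
        \<open>t\<close> runs through \<open>K\<close>: the components \<open>?w \<rho>\<close> at
        \<open>z\<close> are the coefficients of a linear relation between characters.\<close>
      have "\<forall>\<rho>\<in>X ` N. ?w \<rho> = 0"
      proof (rule characters_independent[OF _ one])
        show "finite (X ` N)" using N by simp
        show "s * t \<in> K" if "s \<in> K" "t \<in> K" for s t using mult that by blast
        show "\<rho> (s * t) = \<rho> s * \<rho> t" if "\<rho> \<in> X ` N" "s \<in> K" "t \<in> K" for \<rho> s t
          using that mult by (auto simp: X_def lmon_mult)
        show "\<rho> 1 = 1" if "\<rho> \<in> X ` N" for \<rho>
          using that one by (auto simp: X_def)
        show "\<exists>t\<in>K. \<rho> t \<noteq> \<psi> t" if "\<rho> \<in> X ` N" "\<psi> \<in> X ` N" "\<rho> \<noteq> \<psi>" for \<rho> \<psi>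
        proof (rule ccontr)
          assume "\<not> ?thesis"
          with that(1,2) have "\<rho> t = \<psi> t" for t by (cases "t \<in> K") (auto simp: X_def)
          with that(3) show False by blast
        qed
        fix t assume t: "t \<in> K"
        have "u * a (t * z) + v * b (t * z) = (\<Sum>m\<in>N. ?l m t * ((u * ca m + v * cb m) * ?l m z))"
          unfolding a b by (simp add: sum_distrib_left sum.distrib lmon_mult algebra_simps)
        also have "\<dots> = (\<Sum>\<rho>\<in>X ` N. \<Sum>m\<in>?part \<rho>. ?l m t * ((u * ca m + v * cb m) * ?l m z))"
          by (rule split)
        also have "\<dots> = (\<Sum>\<rho>\<in>X ` N. \<rho> t * ?w \<rho>)"
        proof (intro sum.cong refl)
          fix \<rho>
          show "(\<Sum>m\<in>?part \<rho>. ?l m t * ((u * ca m + v * cb m) * ?l m z)) = \<rho> t * ?w \<rho>"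
            unfolding sum_distrib_left using t by (intro sum.cong refl) (auto simp: X_def)
        qed
        finally show "(\<Sum>\<rho>\<in>X ` N. \<rho> t * ?w \<rho>) = 0" using uv t by simp
      qed
      then have "?w \<rho> = 0" using \<rho>(1) by blast
      then show "u * (\<Sum>m\<in>?part \<rho>. ca m * ?l m z) + v * (\<Sum>m\<in>?part \<rho>. cb m * ?l m z) = 0"
        by (simp add: sum_distrib_left sum.distrib algebra_simps)
    qed
  qed
qed

section \<open>Descent of fractions along a monomial map\<close>

text \<open>A high power of the product of the coordinates clears the negative exponents. Every
  sufficiently large power is allowed because numerator and denominator of a fraction have to be
  multiplied by the same one.\<close>

lemma laurent_polyfun:
  fixes r :: "'a \<Rightarrow> 'n::finite \<Rightarrow> int"
  assumes "finite M"
  shows "\<exists>N0. \<forall>N\<ge>N0. \<exists>p. polyfun p \<and>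
    (\<forall>x\<in>tor. p x = (\<Prod>k\<in>UNIV. x $ k) ^ N * (\<Sum>m\<in>M. c m * lmon (r m) x))"
proof -
  define N0 where "N0 = (\<Sum>m\<in>M. \<Sum>k\<in>UNIV. nat \<bar>r m k\<bar>)"
  have N0: "nat \<bar>r m k\<bar> \<le> N0" if "m \<in> M" for m k
  proof -
    have "nat \<bar>r m k\<bar> \<le> (\<Sum>k\<in>UNIV. nat \<bar>r m k\<bar>)" by (rule member_le_sum) auto
    also have "\<dots> \<le> N0" unfolding N0_def
      by (rule member_le_sum[where f = "\<lambda>m. \<Sum>k\<in>UNIV. nat \<bar>r m k\<bar>"]) (use that assms in auto)
    finally show ?thesis .
  qed
  have "\<exists>p. polyfun p \<and> (\<forall>x\<in>tor. p x = (\<Prod>k\<in>UNIV. x $ k) ^ N * (\<Sum>m\<in>M. c m * lmon (r m) x))"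
    if "N0 \<le> N" for N
  proof (intro exI conjI ballI)
    show "polyfun (\<lambda>x. \<Sum>m\<in>M. c m * lmon (\<lambda>k. int N + r m k) x)"
    proof (intro polyfun_sum polyfun_mult polyfun_const polyfun_lmon)
      fix m k assume "m \<in> M"
      then show "0 \<le> int N + r m k" using N0[of m k] that by linarith
    qed
    fix x :: "complex ^ 'n" assume x: "x \<in> tor"
    have "lmon (\<lambda>k. int N) x = (\<Prod>k\<in>UNIV. x $ k) ^ N"
      by (simp add: lmon_def prod_power_distrib)
    then show "(\<Sum>m\<in>M. c m * lmon (\<lambda>k. int N + r m k) x)
        = (\<Prod>k\<in>UNIV. x $ k) ^ N * (\<Sum>m\<in>M. c m * lmon (r m) x)"
      by (simp add: lmon_add[OF x] sum_distrib_left mult_ac)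
  qed
  then show ?thesis by blast
qed

text \<open>
  With \<open>u = -1\<close> and \<open>v\<close> the value at \<open>z\<close> of a function that is constant on the fibres, this
  descends the local representation \<open>a / b\<close> of the function; with \<open>u = 0\<close> it descends open sets.
\<close>

lemma monomial_descent:
  fixes E :: "'m::finite \<Rightarrow> 'n::finite \<Rightarrow> int"
  assumes chars: "\<And>m. (\<And>t. t \<in> tor \<Longrightarrow> monmap E t = 1 \<Longrightarrow> lmon m t = 1) \<Longrightarrow>
      \<exists>r. \<forall>k. m k = (\<Sum>j\<in>UNIV. r j * E j k)"
    and "polyfun a" "polyfun b" "b y \<noteq> 0" "y \<in> tor"
  obtains \<alpha> \<beta> where "polyfun \<alpha>" "polyfun \<beta>" "\<beta> (monmap E y) \<noteq> 0"
    and "\<forall>z\<in>tor. \<forall>u v.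
       (\<forall>t\<in>tor. monmap E t = 1 \<longrightarrow> u * a (t * z) + v * b (t * z) = 0) \<longrightarrow>
       u * \<alpha> (monmap E z) + v * \<beta> (monmap E z) = 0"
proof -
  define K where "K = {t :: complex ^ 'n. t \<in> tor \<and> monmap E t = 1}"
  have K: "1 \<in> K" "\<forall>s\<in>K. \<forall>t\<in>K. s * t \<in> K"
    by (simp_all add: K_def mult_in_tor monmap_mult)
  let ?l = "\<lambda>m :: 'n \<Rightarrow> nat. lmon (\<lambda>k. int (m k))"
  obtain M ca cb where M: "finite M"
    "\<forall>m\<in>M. \<forall>m'\<in>M. \<forall>t\<in>K. ?l m t = ?l m' t"
    "(\<Sum>m\<in>M. cb m * ?l m y) \<noteq> 0"
    "\<forall>z u v. (\<forall>t\<in>K. u * a (t * z) + v * b (t * z) = 0) \<longrightarrow>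
       u * (\<Sum>m\<in>M. ca m * ?l m z) + v * (\<Sum>m\<in>M. cb m * ?l m z) = 0"
    by (rule semi_invariant_components[OF assms(2-4) K]) (rule that)
  from M(3) have "M \<noteq> {}" by auto
  then obtain m0 where m0: "m0 \<in> M" by blast
  \<comment> \<open>All exponents in \<open>M\<close> restrict to the same character of the kernel,
    so each difference with \<open>m0\<close> is trivial there and is a combination of the rows of
    \<open>E\<close>.\<close>
  have "\<exists>r. \<forall>k. int (m k) - int (m0 k) = (\<Sum>j\<in>UNIV. r j * E j k)" if m: "m \<in> M" for m
  proof (rule chars[of "\<lambda>k. int (m k) - int (m0 k)"])
    fix t :: "complex ^ 'n" assume t: "t \<in> tor" "monmap E t = 1"
    then have "t \<in> K" by (simp add: K_def)
    then have "?l m t = ?l m0 t" using M(2) m m0 by blast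
    then show "lmon (\<lambda>k. int (m k) - int (m0 k)) t = 1"
      using t(1) by (simp add: lmon_diff lmon_nonzero)
  qed
  then have "\<forall>m\<in>M. \<exists>r. \<forall>k. int (m k) - int (m0 k) = (\<Sum>j\<in>UNIV. r j * E j k)"
    by blast
  then obtain r where r: "\<forall>m\<in>M. \<forall>k. int (m k) - int (m0 k) = (\<Sum>j\<in>UNIV. r m j * E j k)"
    by (rule bchoice[THEN exE])
  have l: "?l m z = ?l m0 z * lmon (r m) (monmap E z)" if "m \<in> M" "z \<in> tor" for m z
  proof -
    have "lmon (r m) (monmap E z) = lmon (\<lambda>k. int (m k) - int (m0 k)) z"
      using r that by (simp add: lmon_monmap)
    then show ?thesis using that by (simp add: lmon_diff lmon_nonzero)
  qed
  \<comment> \<open>\<open>S\<close> lives on the target. Both components of the fraction contain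
    the same factor \<open>?l m0 z\<close>, which is not invariant under the kernel but
    cancels.\<close>
  define S where "S c x = (\<Sum>m\<in>M. c m * lmon (r m) x)" for c x
  have S: "(\<Sum>m\<in>M. c m * ?l m z) = ?l m0 z * S c (monmap E z)" if "z \<in> tor" for c z
    using that by (simp add: S_def sum_distrib_left l mult_ac)
  obtain Na where Na: "\<forall>N\<ge>Na. \<exists>p. polyfun p \<and>
    (\<forall>x\<in>tor. p x = (\<Prod>k\<in>UNIV. x $ k) ^ N * S ca x)"
    unfolding S_def using laurent_polyfun[OF M(1)] by blast
  obtain Nb where Nb: "\<forall>N\<ge>Nb. \<exists>p. polyfun p \<and>
    (\<forall>x\<in>tor. p x = (\<Prod>k\<in>UNIV. x $ k) ^ N * S cb x)"
    unfolding S_def using laurent_polyfun[OF M(1)] by blast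
  define N where "N = max Na Nb"
  have N: "Na \<le> N" "Nb \<le> N" by (simp_all add: N_def)
  obtain \<alpha> where \<alpha>: "polyfun \<alpha>" "\<forall>x\<in>tor. \<alpha> x = (\<Prod>k\<in>UNIV. x $ k) ^ N * S ca x"
    using Na[rule_format, OF N(1)] by blast
  obtain \<beta> where \<beta>: "polyfun \<beta>" "\<forall>x\<in>tor. \<beta> x = (\<Prod>k\<in>UNIV. x $ k) ^ N * S cb x"
    using Nb[rule_format, OF N(2)] by blast
  show thesis
  proof (rule that[OF \<alpha>(1) \<beta>(1)])
    have "(\<Prod>k\<in>UNIV. monmap E y $ k) \<noteq> 0"
      using assms(5) by (simp add: lmon_nonzero)
    then show "\<beta> (monmap E y) \<noteq> 0"
      using \<beta>(2)[rule_format, OF monmap_tor[OF assms(5)]] M(3) S[OF assms(5), of cb] by simp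
    show "\<forall>z\<in>tor. \<forall>u v.
       (\<forall>t\<in>tor. monmap E t = 1 \<longrightarrow> u * a (t * z) + v * b (t * z) = 0) \<longrightarrow>
       u * \<alpha> (monmap E z) + v * \<beta> (monmap E z) = 0"
    proof (intro ballI allI impI)
      fix z u v assume z: "z \<in> tor"
        and "\<forall>t\<in>tor. monmap E t = 1 \<longrightarrow> u * a (t * z) + v * b (t * z) = 0"
      then have "\<forall>t\<in>K. u * a (t * z) + v * b (t * z) = 0" by (simp add: K_def)
      then have "u * (\<Sum>m\<in>M. ca m * ?l m z) + v * (\<Sum>m\<in>M. cb m * ?l m z) = 0"
        using M(4) by blast
      then have "?l m0 z * (u * S ca (monmap E z) + v * S cb (monmap E z)) = 0"
        using z by (simp add: S algebra_simps)
      then have "u * S ca (monmap E z) + v * S cb (monmap E z) = 0"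
        using lmon_nonzero[OF z] by simp
      moreover have "u * \<alpha> (monmap E z) + v * \<beta> (monmap E z)
          = (\<Prod>k\<in>UNIV. monmap E z $ k) ^ N * (u * S ca (monmap E z) + v * S cb (monmap E z))"
        using \<alpha>(2)[rule_format, OF monmap_tor[OF z]] \<beta>(2)[rule_format, OF monmap_tor[OF z]]
        by (simp add: algebra_simps)
      ultimately show "u * \<alpha> (monmap E z) + v * \<beta> (monmap E z) = 0" by simp
    qed
  qed
qed

lemma monmap_pullback:
  fixes E :: "'m::finite \<Rightarrow> 'n::finite \<Rightarrow> int"
  assumes "polyfun p"
  shows "\<exists>N0. \<forall>N\<ge>N0. \<exists>p'. polyfun p' \<and>
    (\<forall>x\<in>tor. p' x = (\<Prod>k\<in>UNIV. x $ k) ^ N * p (monmap E x))"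
proof -
  obtain M c where M: "finite M" "\<And>x. p x = (\<Sum>m\<in>M. c m * lmon (\<lambda>k. int (m k)) x)"
    using polyfun_monomials[OF assms] by blast
  have "p (monmap E x) = (\<Sum>m\<in>M. c m * lmon (\<lambda>k. \<Sum>j\<in>UNIV. int (m j) * E j k) x)"
    if "x \<in> tor" for x
    using that by (simp add: M(2) lmon_monmap)
  then show ?thesis
    using laurent_polyfun[OF M(1), of c "\<lambda>m k. \<Sum>j\<in>UNIV. int (m j) * E j k"] by simp
qed

section \<open>Spaces with functions\<close>

text \<open>Restriction to smaller open sets and gluing in one condition. It also makes membership
  in \<open>regular X W\<close> independent of the values outside \<open>W\<close>, which matters
  since functions are total.\<close>

definition sheaf_like :: "'a fspace \<Rightarrow> bool" where
  "sheaf_like X \<longleftrightarrow> (\<forall>W f. openin (zar X) W \<longrightarrow>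
     (\<forall>x\<in>W. \<exists>U g. openin (zar X) U \<and> x \<in> U \<and> g \<in> regular X U \<and> (\<forall>y\<in>U \<inter> W. f y = g y)) \<longrightarrow>
     f \<in> regular X W)"

lemma sheaf_likeD:
  assumes "sheaf_like X" "openin (zar X) W"
    and "\<And>x. x \<in> W \<Longrightarrow>
      \<exists>U g. openin (zar X) U \<and> x \<in> U \<and> g \<in> regular X U \<and> (\<forall>y\<in>U \<inter> W. f y = g y)"
  shows "f \<in> regular X W"
  using assms unfolding sheaf_like_def by blast

lemma regular_restrict:
  assumes "sheaf_like X" "openin (zar X) W" "openin (zar X) U" "f \<in> regular X U" "W \<subseteq> U"
    and "\<And>x. x \<in> W \<Longrightarrow> f' x = f x"
  shows "f' \<in> regular X W"
  using assms by (intro sheaf_likeD[OF assms(1,2)] exI[of _ U] exI[of _ f]) auto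

lemma zar_sub_fspace: "zar (sub_fspace X Z) = subtopology (zar X) Z"
  by (simp add: sub_fspace_def)

lemma regular_sub_fspace: "f \<in> regular (sub_fspace X Z) W \<longleftrightarrow>
    (\<forall>x\<in>W. \<exists>U g. openin (zar X) U \<and> x \<in> U \<and> g \<in> regular X U \<and> (\<forall>y\<in>U \<inter> W. f y = g y))"
  by (simp add: sub_fspace_def)

lemma regular_quot_fspace: "f \<in> regular (quot_fspace X G) V \<longleftrightarrow>
    f \<circ> orbit_of G \<in> regular X {x \<in> points X. orbit_of G x \<in> V}"
  by (simp add: quot_fspace_def)

lemma regular_sub_open:
  assumes "sheaf_like X" "openin (zar X) W"
  shows "regular (sub_fspace X D) W = regular X W"
proof (rule subset_antisym; rule subsetI)
  fix f assume "f \<in> regular (sub_fspace X D) W"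
  then show "f \<in> regular X W"
    unfolding regular_sub_fspace by (intro sheaf_likeD[OF assms]) blast
next
  fix f assume "f \<in> regular X W"
  then show "f \<in> regular (sub_fspace X D) W"
    unfolding regular_sub_fspace using assms(2) by blast
qed

lemma sheaf_like_sub_fspace:
  assumes "sheaf_like X" shows "sheaf_like (sub_fspace X Z)"
  unfolding sheaf_like_def
proof (intro allI impI)
  fix W f assume W: "openin (zar (sub_fspace X Z)) W"
    and loc: "\<forall>x\<in>W. \<exists>U g. openin (zar (sub_fspace X Z)) U \<and> x \<in> U \<and>
      g \<in> regular (sub_fspace X Z) U \<and> (\<forall>y\<in>U \<inter> W. f y = g y)"
  from W have WZ: "W \<subseteq> Z" by (simp add: zar_sub_fspace openin_subtopology_alt) blast
  show "f \<in> regular (sub_fspace X Z) W"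
    unfolding regular_sub_fspace
  proof
    fix x assume x: "x \<in> W"
    then obtain U g where U: "openin (zar (sub_fspace X Z)) U" "x \<in> U"
      "g \<in> regular (sub_fspace X Z) U" "\<forall>y\<in>U \<inter> W. f y = g y"
      using loc by blast
    obtain U' where U': "openin (zar X) U'" "U = U' \<inter> Z"
      using U(1) by (auto simp: zar_sub_fspace openin_subtopology)
    obtain V h where V: "openin (zar X) V" "x \<in> V" "h \<in> regular X V" "\<forall>y\<in>V \<inter> U. g y = h y"
      using U(2,3) by (auto simp: regular_sub_fspace)
    have "h \<in> regular X (V \<inter> U')"
      using V U' by (intro regular_restrict[OF assms _ V(1,3)]) auto
    moreover have "f y = h y" if "y \<in> V \<inter> U' \<inter> W" for y
      using that U(4) U'(2) V(4) WZ by auto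
    ultimately show "\<exists>U g. openin (zar X) U \<and> x \<in> U \<and> g \<in> regular X U \<and> (\<forall>y\<in>U \<inter> W. f y = g y)"
      using V(1,2) U(2) U' by (intro exI[of _ "V \<inter> U'"] exI[of _ h]) auto
  qed
qed

lemma sheaf_like_quot_fspace:
  assumes "sheaf_like X" shows "sheaf_like (quot_fspace X G)"
  unfolding sheaf_like_def
proof (intro allI impI)
  fix W f assume W: "openin (zar (quot_fspace X G)) W"
    and loc: "\<forall>x\<in>W. \<exists>U g. openin (zar (quot_fspace X G)) U \<and> x \<in> U \<and>
      g \<in> regular (quot_fspace X G) U \<and> (\<forall>y\<in>U \<inter> W. f y = g y)"
  show "f \<in> regular (quot_fspace X G) W"
    unfolding regular_quot_fspace
  proof (rule sheaf_likeD[OF assms])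
    show "openin (zar X) {x \<in> points X. orbit_of G x \<in> W}"
      using W by (simp add: openin_quot_fspace)
    fix x assume "x \<in> {x \<in> points X. orbit_of G x \<in> W}"
    then obtain U g where "openin (zar (quot_fspace X G)) U" "orbit_of G x \<in> U"
      "g \<in> regular (quot_fspace X G) U" "\<forall>y\<in>U \<inter> W. f y = g y" "x \<in> points X"
      using loc by blast
    then show "\<exists>U g. openin (zar X) U \<and> x \<in> U \<and> g \<in> regular X U \<and>
        (\<forall>y\<in>U \<inter> {x \<in> points X. orbit_of G x \<in> W}. (f \<circ> orbit_of G) y = g y)"
      by (intro exI[of _ "{x \<in> points X. orbit_of G x \<in> U}"] exI[of _ "g \<circ> orbit_of G"])
        (auto simp: openin_quot_fspace regular_quot_fspace)
  qed
qed

lemma morphism_open_subI: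
  assumes "sheaf_like X" "openin (zar X) D"
    and "\<And>x. x \<in> D \<Longrightarrow> f x \<in> points Y"
    and "\<And>V. openin (zar Y) V \<Longrightarrow> openin (zar X) {x \<in> D. f x \<in> V}"
    and "\<And>V h. openin (zar Y) V \<Longrightarrow> h \<in> regular Y V \<Longrightarrow> h \<circ> f \<in> regular X {x \<in> D. f x \<in> V}"
  shows "morphism (sub_fspace X D) Y f"
proof -
  have D: "points (sub_fspace X D) = D"
    using openin_subset[OF assms(2)] by (auto simp: zar_sub_fspace)
  have "continuous_map (zar (sub_fspace X D)) (zar Y) f"
    unfolding continuous_map D using assms(3,4)
    by (auto simp: zar_sub_fspace openin_open_subtopology[OF assms(2)])
  then show ?thesis
    unfolding morphism_def D using assms by (auto simp: regular_sub_open)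
qed

lemma morphism_open_subD:
  assumes "sheaf_like X" "openin (zar X) D" "morphism (sub_fspace X D) Y f"
  shows "\<And>x. x \<in> D \<Longrightarrow> f x \<in> points Y"
    and "\<And>V. openin (zar Y) V \<Longrightarrow> openin (zar X) {x \<in> D. f x \<in> V}"
    and "\<And>V h. openin (zar Y) V \<Longrightarrow> h \<in> regular Y V \<Longrightarrow> h \<circ> f \<in> regular X {x \<in> D. f x \<in> V}"
proof -
  have D: "points (sub_fspace X D) = D"
    using openin_subset[OF assms(2)] by (auto simp: zar_sub_fspace)
  have cont: "continuous_map (zar (sub_fspace X D)) (zar Y) f"
    using assms(3) by (simp add: morphism_def)
  show "f x \<in> points Y" if "x \<in> D" for x
    using cont that unfolding continuous_map D by blast
  show op: "openin (zar X) {x \<in> D. f x \<in> V}" if "openin (zar Y) V" for V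
    using cont that unfolding continuous_map D
    by (auto simp: zar_sub_fspace openin_open_subtopology[OF assms(2)])
  show "h \<circ> f \<in> regular X {x \<in> D. f x \<in> V}" if "openin (zar Y) V" "h \<in> regular Y V" for V h
    using assms(3) that unfolding morphism_def D
    by (simp add: regular_sub_open[OF assms(1) op])
qed

lemma morphism_cong:
  assumes "sheaf_like X" "morphism X Y f" "\<And>x. x \<in> points X \<Longrightarrow> f' x = f x"
  shows "morphism X Y f'"
  unfolding morphism_def
proof (intro conjI allI impI ballI)
  have cont: "continuous_map (zar X) (zar Y) f" using assms(2) by (simp add: morphism_def)
  then show "continuous_map (zar X) (zar Y) f'"
    by (rule continuous_map_eq) (simp add: assms(3))
  fix V h assume V: "openin (zar Y) V" and h: "h \<in> regular Y V"
  have eq: "{x \<in> points X. f' x \<in> V} = {x \<in> points X. f x \<in> V}" using assms(3) by auto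
  have op: "openin (zar X) {x \<in> points X. f x \<in> V}"
    using cont V by (rule openin_continuous_map_preimage)
  have "h \<circ> f \<in> regular X {x \<in> points X. f x \<in> V}"
    using assms(2) V h by (simp add: morphism_def)
  then show "h \<circ> f' \<in> regular X {x \<in> points X. f' x \<in> V}"
    unfolding eq by (rule regular_restrict[OF assms(1) op op]) (auto simp: assms(3))
qed

lemma morphism_compose:
  assumes "morphism X Y f" "morphism Y Z g"
  shows "morphism X Z (g \<circ> f)"
  unfolding morphism_def
proof (intro conjI allI impI ballI)
  have cont: "continuous_map (zar X) (zar Y) f" "continuous_map (zar Y) (zar Z) g"
    using assms by (simp_all add: morphism_def)
  then show "continuous_map (zar X) (zar Z) (g \<circ> f)" by (rule continuous_map_compose)
  fix V h assume V: "openin (zar Z) V" and h: "h \<in> regular Z V"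
  have op: "openin (zar Y) {y \<in> points Y. g y \<in> V}"
    using cont(2) V by (rule openin_continuous_map_preimage)
  have "h \<circ> g \<in> regular Y {y \<in> points Y. g y \<in> V}"
    using assms(2) V h by (simp add: morphism_def)
  then have "h \<circ> g \<circ> f \<in> regular X {x \<in> points X. f x \<in> {y \<in> points Y. g y \<in> V}}"
    using assms(1) op unfolding morphism_def by blast
  moreover have "{x \<in> points X. f x \<in> {y \<in> points Y. g y \<in> V}} = {x \<in> points X. (g \<circ> f) x \<in> V}"
    using cont(1) by (auto simp: continuous_map_def Pi_def)
  ultimately show "h \<circ> (g \<circ> f) \<in> regular X {x \<in> points X. (g \<circ> f) x \<in> V}"
    by (simp add: comp_assoc)
qed

lemma morphism_id: "morphism X X (\<lambda>x. x)"
proof -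
  have "{x \<in> points X. x \<in> V} = V" if "openin (zar X) V" for V
    using openin_subset[OF that] by blast
  then show ?thesis by (simp add: morphism_def o_def)
qed

lemma sub_fspace_points_iff: "sheaf_like X \<Longrightarrow> morphism (sub_fspace X (points X)) Y f \<longleftrightarrow> morphism X Y f"
  unfolding morphism_def
  by (auto simp: zar_sub_fspace regular_sub_open openin_continuous_map_preimage
      dest: openin_continuous_map_preimage)

section \<open>Automorphism groups, orbits and quotients\<close>

text \<open>The inverse in \<open>BijGroup\<close> is a restricted \<open>inv_into\<close>, of which
  nothing geometric is known. On points it agrees with the inverse morphism provided by
  \<open>isomorphism\<close>, and \<open>morphism_cong\<close> transfers the property.\<close>

lemma group_aut_group:
  assumes "sheaf_like X" shows "group (aut_group X)"
proof -
  let ?S = "points X"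
  let ?H = "{f \<in> Bij ?S. isomorphism X X f}"
  have inv: "isomorphism X X (restrict (inv_into ?S f) ?S) \<and> (\<lambda>x\<in>?S. inv_into ?S f x) \<in> Bij ?S"
    if f: "f \<in> Bij ?S" and iso: "isomorphism X X f" for f
  proof -
    obtain g where g: "morphism X X g" "\<forall>x\<in>?S. g (f x) = x" "\<forall>y\<in>?S. f (g y) = y"
      using iso unfolding isomorphism_def by blast
    have maps: "g y \<in> ?S" "f y \<in> ?S" if "y \<in> ?S" for y
      using g(1) iso that by (auto simp: isomorphism_def morphism_def continuous_map_def Pi_def)
    moreover have "inj_on f ?S" using f by (simp add: Bij_def bij_betw_def)
    ultimately have eq: "restrict (inv_into ?S f) ?S y = g y" if "y \<in> ?S" for y
      using g(3) that by (metis inv_into_f_f restrict_apply')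
    have "morphism X X (restrict (inv_into ?S f) ?S)"
      by (rule morphism_cong[OF assms g(1) eq])
    moreover have "morphism X X f" using iso by (simp add: isomorphism_def)
    ultimately have "isomorphism X X (restrict (inv_into ?S f) ?S)"
      unfolding isomorphism_def using g maps eq
      by (intro conjI exI[of _ f]) (simp_all del: restrict_apply)
    with restrict_inv_into_Bij[OF f] show ?thesis by blast
  qed
  have "subgroup ?H (BijGroup ?S)"
  proof (rule group.subgroupI[OF group_BijGroup])
    show "?H \<subseteq> carrier (BijGroup ?S)" by (auto simp: BijGroup_def)
    have "isomorphism X X (\<lambda>x\<in>?S. x)"
      unfolding isomorphism_def using morphism_cong[OF assms morphism_id, of "\<lambda>x\<in>?S. x"] by auto
    then show "?H \<noteq> {}" using id_Bij by blast
    fix f assume f: "f \<in> ?H"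
    have "inv\<^bsub>BijGroup ?S\<^esub> f = restrict (inv_into ?S f) ?S"
      using f by (auto intro: inv_BijGroup)
    then show "inv\<^bsub>BijGroup ?S\<^esub> f \<in> ?H" using inv f by simp
    fix g assume g: "g \<in> ?H"
    obtain f' where f': "morphism X X f'" "\<forall>x\<in>?S. f' (f x) = x" "\<forall>y\<in>?S. f (f' y) = y"
      using f unfolding isomorphism_def by blast
    obtain g' where g': "morphism X X g'" "\<forall>x\<in>?S. g' (g x) = x" "\<forall>y\<in>?S. g (g' y) = y"
      using g unfolding isomorphism_def by blast
    have mor: "morphism X X f" "morphism X X g" using f g by (auto simp: isomorphism_def)
    have maps: "f x \<in> ?S" "g x \<in> ?S" "f' x \<in> ?S" "g' x \<in> ?S" if "x \<in> ?S" for x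
      using mor f'(1) g'(1) that by (auto simp: morphism_def continuous_map_def Pi_def)
    have "morphism X X (compose ?S f g)"
      by (rule morphism_cong[OF assms morphism_compose[OF mor(2,1)]]) (simp add: compose_def)
    moreover have "morphism X X (g' \<circ> f')" by (rule morphism_compose[OF f'(1) g'(1)])
    ultimately have "isomorphism X X (compose ?S f g)"
      unfolding isomorphism_def using f' g' maps
      by (intro conjI exI[of _ "g' \<circ> f'"]) (auto simp: compose_def)
    then show "f \<otimes>\<^bsub>BijGroup ?S\<^esub> g \<in> ?H"
      using f g by (simp add: BijGroup_def compose_Bij)
  qed
  then show ?thesis
    unfolding aut_group_def by (rule group.subgroup_imp_group[OF group_BijGroup])
qed

lemma aut_group_carrier: "carrier (aut_group X) = {f \<in> Bij (points X). isomorphism X X f}"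
  by (simp add: aut_group_def)

lemma aut_group_mult:
  "f \<in> carrier (aut_group X) \<Longrightarrow> g \<in> carrier (aut_group X) \<Longrightarrow>
    f \<otimes>\<^bsub>aut_group X\<^esub> g = compose (points X) f g"
  by (simp add: aut_group_def BijGroup_def)

lemma aut_group_one: "\<one>\<^bsub>aut_group X\<^esub> = (\<lambda>x\<in>points X. x)"
  by (simp add: aut_group_def BijGroup_def)

lemma aut_group_inv_apply:
  assumes "sheaf_like X" "f \<in> carrier (aut_group X)" "x \<in> points X"
  shows "(inv\<^bsub>aut_group X\<^esub> f) (f x) = x"
proof -
  interpret group "aut_group X" by (rule group_aut_group[OF assms(1)])
  have "(inv\<^bsub>aut_group X\<^esub> f) \<otimes>\<^bsub>aut_group X\<^esub> f = \<one>\<^bsub>aut_group X\<^esub>" using assms(2) by simp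
  then have "compose (points X) (inv\<^bsub>aut_group X\<^esub> f) f x = x"
    using assms(2,3) by (simp add: aut_group_mult aut_group_one)
  then show ?thesis using assms(3) by (simp add: compose_def)
qed

lemma orbit_of_eq_iff:
  assumes "sheaf_like X" "subgroup G (aut_group X)" "x \<in> points X" "y \<in> points X"
  shows "orbit_of G x = orbit_of G y \<longleftrightarrow> (\<exists>g\<in>G. y = g x)"
proof -
  interpret group "aut_group X" by (rule group_aut_group[OF assms(1)])
  have car: "g \<in> carrier (aut_group X)" if "g \<in> G" for g
    using subgroup.subset[OF assms(2)] that by blast
  have one: "(\<lambda>x\<in>points X. x) \<in> G"
    using subgroup.one_closed[OF assms(2)] by (simp add: aut_group_one)
  have mult: "compose (points X) g h \<in> G" if "g \<in> G" "h \<in> G" for g h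
    using subgroup.m_closed[OF assms(2) that] that by (simp add: aut_group_mult car)
  have sub: "orbit_of G (g x) \<subseteq> orbit_of G x" if "g \<in> G" "x \<in> points X" for g x
  proof
    fix z assume "z \<in> orbit_of G (g x)"
    then obtain h where h: "h \<in> G" "z = h (g x)" by (auto simp: orbit_of_def)
    then have "z = compose (points X) h g x" using that(2) by (simp add: compose_def)
    then show "z \<in> orbit_of G x" using mult[OF h(1) that(1)] by (auto simp: orbit_of_def)
  qed
  show ?thesis
  proof
    assume eq: "orbit_of G x = orbit_of G y"
    have "y \<in> orbit_of G y"
      unfolding orbit_of_def using one assms(4) by (intro image_eqI[of _ _ "\<lambda>x\<in>points X. x"]) auto
    then show "\<exists>g\<in>G. y = g x" unfolding eq[symmetric] by (auto simp: orbit_of_def)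
  next
    assume "\<exists>g\<in>G. y = g x"
    then obtain g where g: "g \<in> G" "y = g x" by blast
    have "x = (inv\<^bsub>aut_group X\<^esub> g) y"
      using aut_group_inv_apply[OF assms(1) car[OF g(1)] assms(3)] g(2) by simp
    then show "orbit_of G x = orbit_of G y"
      using sub[OF g(1) assms(3)] sub[OF subgroup.m_inv_closed[OF assms(2) g(1)] assms(4)] g(2)
      by auto
  qed
qed

text \<open>Both \<open>E\<close> and the orbit space of \<open>D\<close> are quotients of
  \<open>D\<close> by the same equivalence relation: \<open>fibres\<close> compares the relations,
  while \<open>op\<close> and \<open>reg\<close> say that \<open>E\<close> carries the quotient
  topology and the quotient functions. The bijection between them is therefore an isomorphism in
  both directions.\<close>

lemma quotient_birational:
  assumes X: "sheaf_like X" and Y: "sheaf_like Y" and G: "subgroup G (aut_group X)"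
    and rat: "rational_map X Y D\<^sub>0 \<pi>"
    and D: "dense_open X D" "D \<subseteq> D\<^sub>0" and E: "dense_open Y E" "\<pi> ` D = E"
    and stable: "\<And>g x. g \<in> G \<Longrightarrow> x \<in> D \<Longrightarrow> g x \<in> D"
    and fibres: "\<And>x x'. x \<in> D \<Longrightarrow> x' \<in> D \<Longrightarrow> \<pi> x = \<pi> x' \<longleftrightarrow> orbit_of G x = orbit_of G x'"
    and op: "\<And>V. V \<subseteq> E \<Longrightarrow> openin (zar X) {x \<in> D. \<pi> x \<in> V} \<Longrightarrow> openin (zar Y) V"
    and reg: "\<And>V f. V \<subseteq> E \<Longrightarrow> openin (zar Y) V \<Longrightarrow> f \<circ> \<pi> \<in> regular X {x \<in> D. \<pi> x \<in> V} \<Longrightarrow>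
        f \<in> regular Y V"
  shows "birationally_equivalent_maps X Y D\<^sub>0 \<pi> (quot_fspace X G) (points X) (orbit_of G)
    \<and> birational Y (quot_fspace X G)"
proof -
  let ?Q = "quot_fspace X G"
  define E' where "E' = orbit_of G ` D"
  have opD: "openin (zar X) D" and opE: "openin (zar Y) E" using D E by (simp_all add: dense_open_def)
  have opD0: "openin (zar X) D\<^sub>0" and mor: "morphism (sub_fspace X D\<^sub>0) Y \<pi>"
    using rat by (simp_all add: rational_map_def dense_open_def)
  have Q: "sheaf_like ?Q" by (rule sheaf_like_quot_fspace[OF X])
  have DX: "D \<subseteq> points X" using openin_subset[OF opD] .
  have EY: "E \<subseteq> points Y" using openin_subset[OF opE] .
  have orbD: "orbit_of G x \<in> E' \<longleftrightarrow> x \<in> D" if x: "x \<in> points X" for x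
  proof
    assume "orbit_of G x \<in> E'"
    then obtain x' where x': "x' \<in> D" "orbit_of G x' = orbit_of G x" by (auto simp: E'_def)
    then obtain g where "g \<in> G" "x = g x'"
      using orbit_of_eq_iff[OF X G _ x] DX by blast
    then show "x \<in> D" using stable x'(1) by blast
  qed (simp add: E'_def)
  have pre: "{x \<in> points X. orbit_of G x \<in> V} = {x \<in> D. orbit_of G x \<in> V}" if "V \<subseteq> E'" for V
    using orbD that DX by blast
  have opE': "openin (zar ?Q) E'"
  proof -
    have "{x \<in> points X. orbit_of G x \<in> E'} = D" using orbD DX by blast
    then show ?thesis using opD DX by (simp add: openin_quot_fspace E'_def image_mono)
  qed
  have Qmor: "morphism X ?Q (orbit_of G)"
    unfolding morphism_def continuous_map points_quot_fspace
    by (auto simp: openin_quot_fspace regular_quot_fspace)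
  have denseX: "dense_open X (points X)"
    by (simp add: dense_open_def closure_of_topspace)
  have ratQ: "rational_map X ?Q (points X) (orbit_of G)"
    using denseX Qmor by (simp add: rational_map_def sub_fspace_points_iff[OF X])
  have "Abstract_Topology.closure_of (zar ?Q) E' = points ?Q"
  proof (rule antisym[OF closure_of_subset_topspace])
    have cont: "continuous_map (zar X) (zar ?Q) (orbit_of G)" using Qmor by (simp add: morphism_def)
    have "orbit_of G ` (zar X closure_of D) \<subseteq> zar ?Q closure_of E'"
      unfolding E'_def using continuous_map_image_closure_subset[OF cont] .
    then show "points ?Q \<subseteq> zar ?Q closure_of E'"
      using D(1) by (simp add: points_quot_fspace dense_open_def)
  qed
  with opE' have denseE': "dense_open ?Q E'" by (simp add: dense_open_def)
  \<comment> \<open>Any preimage will do; by \<open>fibres\<close> its orbit depends on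
    \<open>y\<close> only. The same holds for \<open>k\<close> below.\<close>
  define h where "h y = orbit_of G (SOME x. x \<in> D \<and> \<pi> x = y)" for y
  have h: "h (\<pi> x) = orbit_of G x" if x: "x \<in> D" for x
  proof -
    have "(SOME x'. x' \<in> D \<and> \<pi> x' = \<pi> x) \<in> D \<and> \<pi> (SOME x'. x' \<in> D \<and> \<pi> x' = \<pi> x) = \<pi> x"
      by (rule someI) (use x in simp)
    then show ?thesis unfolding h_def using fibres x by blast
  qed
  define k where "k p = \<pi> (SOME x. x \<in> D \<and> orbit_of G x = p)" for p
  have k: "k (orbit_of G x) = \<pi> x" if x: "x \<in> D" for x
  proof -
    have "(SOME x'. x' \<in> D \<and> orbit_of G x' = orbit_of G x) \<in> D \<and>
        orbit_of G (SOME x'. x' \<in> D \<and> orbit_of G x' = orbit_of G x) = orbit_of G x"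
      by (rule someI) (use x in simp)
    then show ?thesis unfolding k_def using fibres x by blast
  qed
  have ptsE: "points (sub_fspace Y E) = E" and ptsE': "points (sub_fspace ?Q E') = E'"
    using EY openin_subset[OF opE'] by (auto simp: zar_sub_fspace)
  have hmap: "morphism (sub_fspace Y E) (sub_fspace ?Q E') h"
  proof (rule morphism_open_subI[OF Y opE])
    show "h y \<in> points (sub_fspace ?Q E')" if "y \<in> E" for y
      unfolding ptsE' using that h E(2) by (auto simp: E'_def)
    fix V assume "openin (zar (sub_fspace ?Q E')) V"
    then have V: "openin (zar ?Q) V" "V \<subseteq> E'"
      by (simp_all add: zar_sub_fspace openin_open_subtopology[OF opE'])
    have eq: "{x \<in> D. \<pi> x \<in> {y \<in> E. h y \<in> V}} = {x \<in> points X. orbit_of G x \<in> V}"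
    proof -
      have "\<pi> x \<in> E" if "x \<in> D" for x using that E(2) by blast
      then show ?thesis unfolding pre[OF V(2)] using h by (auto simp del: E(2))
    qed
    show op1: "openin (zar Y) {y \<in> E. h y \<in> V}"
      using V(1) by (intro op) (auto simp: eq[simplified] openin_quot_fspace)
    fix f assume "f \<in> regular (sub_fspace ?Q E') V"
    then have f: "f \<circ> orbit_of G \<in> regular X {x \<in> points X. orbit_of G x \<in> V}"
      by (simp add: regular_sub_open[OF Q V(1)] regular_quot_fspace)
    have opV: "openin (zar X) {x \<in> points X. orbit_of G x \<in> V}"
      using V(1) by (simp add: openin_quot_fspace)
    show "f \<circ> h \<in> regular Y {y \<in> E. h y \<in> V}"
    proof (rule reg[OF _ op1])
      show "f \<circ> h \<circ> \<pi> \<in> regular X {x \<in> D. \<pi> x \<in> {y \<in> E. h y \<in> V}}"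
        unfolding eq
        by (rule regular_restrict[OF X opV opV f order_refl]) (auto simp: pre[OF V(2)] h)
    qed blast
  qed
  have kmap: "morphism (sub_fspace ?Q E') (sub_fspace Y E) k"
  proof (rule morphism_open_subI[OF Q opE'])
    show "k p \<in> points (sub_fspace Y E)" if "p \<in> E'" for p
      using that k E(2) unfolding ptsE E'_def by auto
    fix V assume "openin (zar (sub_fspace Y E)) V"
    then have V: "openin (zar Y) V" "V \<subseteq> E"
      by (simp_all add: zar_sub_fspace openin_open_subtopology[OF opE])
    have eq: "{x \<in> points X. orbit_of G x \<in> {p \<in> E'. k p \<in> V}} = {x \<in> D\<^sub>0. \<pi> x \<in> V} \<inter> D"
      using orbD k DX D(2) by auto
    have opV: "openin (zar X) {x \<in> D\<^sub>0. \<pi> x \<in> V}"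
      by (rule morphism_open_subD(2)[OF X opD0 mor V(1)])
    show op1: "openin (zar ?Q) {p \<in> E'. k p \<in> V}"
      unfolding openin_quot_fspace eq using opV opD DX by (auto simp: E'_def)
    fix f assume "f \<in> regular (sub_fspace Y E) V"
    then have "f \<in> regular Y V" by (simp add: regular_sub_open[OF Y V(1)])
    then have f: "f \<circ> \<pi> \<in> regular X {x \<in> D\<^sub>0. \<pi> x \<in> V}"
      by (rule morphism_open_subD(3)[OF X opD0 mor V(1)])
    show "f \<circ> k \<in> regular ?Q {p \<in> E'. k p \<in> V}"
      unfolding regular_quot_fspace eq
      by (rule regular_restrict[OF X openin_Int[OF opV opD] opV f]) (auto simp: k)
  qed
  have iso: "isomorphism (sub_fspace Y E) (sub_fspace ?Q E') h"
    unfolding isomorphism_def ptsE ptsE'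
  proof (intro conjI exI[of _ k] ballI)
    show "k (h y) = y" if "y \<in> E" for y using that E(2) h k by auto
    show "h (k p) = p" if "p \<in> E'" for p using that h k by (auto simp: E'_def)
  qed (fact hmap kmap)+
  have "birationally_equivalent_maps X Y D\<^sub>0 \<pi> ?Q (points X) (orbit_of G)"
    unfolding birationally_equivalent_maps_def
    using rat ratQ D E denseE' iso h DX
    by (intro conjI exI[of _ D] exI[of _ E] exI[of _ E'] exI[of _ h]) (auto simp: E'_def)
  moreover have "birational Y ?Q"
    unfolding birational_def using E(1) denseE' iso by blast
  ultimately show ?thesis ..
qed

section \<open>Weighted projective varieties in homogeneous coordinates\<close>

lemma zariski_open_iff:
  "zariski_open U \<longleftrightarrow> (\<forall>x\<in>U. \<exists>b. polyfun b \<and> b x \<noteq> 0 \<and> (\<forall>y. b y \<noteq> 0 \<longrightarrow> y \<in> U))"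
proof
  assume "zariski_open U"
  then obtain S where S: "\<forall>p\<in>S. polyfun p" "- U = {x. \<forall>p\<in>S. p x = 0}"
    unfolding zariski_open_def by blast
  have "x \<in> U \<longleftrightarrow> (\<exists>p\<in>S. p x \<noteq> 0)" for x using S(2) by blast
  with S(1) show "\<forall>x\<in>U. \<exists>b. polyfun b \<and> b x \<noteq> 0 \<and> (\<forall>y. b y \<noteq> 0 \<longrightarrow> y \<in> U)"
    by blast
next
  assume *: "\<forall>x\<in>U. \<exists>b. polyfun b \<and> b x \<noteq> 0 \<and> (\<forall>y. b y \<noteq> 0 \<longrightarrow> y \<in> U)"
  show "zariski_open U"
    unfolding zariski_open_def
    by (rule exI[of _ "{b. polyfun b \<and> (\<forall>y. b y \<noteq> 0 \<longrightarrow> y \<in> U)}"]) (use * in blast)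
qed

lemma zariski_open_Int: "zariski_open U \<Longrightarrow> zariski_open V \<Longrightarrow> zariski_open (U \<inter> V)"
  using istopology_zariski by (auto simp: istopology_def)

lemma zariski_open_nonzero: "zariski_open (- {0})"
  unfolding zariski_open_iff
proof
  fix x :: "complex ^ 'n" assume "x \<in> - {0}"
  then obtain i where "x $ i \<noteq> 0" by (auto simp: vec_eq_iff)
  then show "\<exists>b. polyfun b \<and> b x \<noteq> 0 \<and> (\<forall>y. b y \<noteq> 0 \<longrightarrow> y \<in> - {0})"
    by (intro exI[of _ "\<lambda>x. x $ i"]) (auto intro: polyfun_coord)
qed

lemma zariski_open_nonvanishing: "polyfun b \<Longrightarrow> zariski_open {x. b x \<noteq> 0}"
  unfolding zariski_open_iff by blast

lemma openin_punctured:
  "openin (zar (sub_fspace affine_space (- {0 :: complex ^ 'n::finite}))) U \<longleftrightarrow> zariski_open U \<and> 0 \<notin> U"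
proof -
  have "openin (zar affine_space) (- {0 :: complex ^ 'n})"
    by (simp add: openin_affine_space zariski_open_nonzero)
  from openin_open_subtopology[OF this] show ?thesis
    by (auto simp: zar_sub_fspace openin_affine_space)
qed

lemma points_punctured: "points (sub_fspace affine_space (- {0})) = - {0}"
  by (simp add: zar_sub_fspace)

lemma sheaf_like_affine_space: "sheaf_like affine_space"
  unfolding sheaf_like_def
proof (intro allI impI)
  fix W and f :: "complex ^ 'n \<Rightarrow> complex"
  assume W: "openin (zar affine_space) W"
    and loc: "\<forall>x\<in>W. \<exists>U g. openin (zar affine_space) U \<and> x \<in> U \<and> g \<in> regular affine_space U \<and>
      (\<forall>y\<in>U \<inter> W. f y = g y)"
  show "f \<in> regular affine_space W"
    unfolding affine_space_def
  proof (clarsimp)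
    fix x assume x: "x \<in> W"
    then obtain U g where "x \<in> U" "g \<in> regular affine_space U" "\<forall>y\<in>U \<inter> W. f y = g y"
      using loc by blast
    moreover from this obtain V a b where "zariski_open V" "x \<in> V" "V \<subseteq> U" "polyfun a" "polyfun b"
      "\<forall>y\<in>V. b y \<noteq> 0 \<and> g y = a y / b y"
      unfolding affine_space_def by auto
    ultimately show "\<exists>V. zariski_open V \<and> x \<in> V \<and> V \<subseteq> W \<and> (\<exists>g. polyfun g \<and>
        (\<exists>h. polyfun h \<and> (\<forall>y\<in>V. h y \<noteq> 0 \<and> f y = g y / h y)))"
      using W x
      by (intro exI[of _ "V \<inter> W"] conjI exI[of _ a] exI[of _ b])
        (auto simp: openin_affine_space zariski_open_Int)
  qed
qed

text \<open>A local fraction becomes a product identity on all of \<open>W\<close> after multiplying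
  numerator and denominator by a polynomial that vanishes off the small neighbourhood. This removes
  the neighbourhoods from later arguments.\<close>

lemma regular_affine_space_iff:
  assumes "zariski_open W"
  shows "f \<in> regular affine_space W \<longleftrightarrow>
    (\<forall>x\<in>W. \<exists>a b. polyfun a \<and> polyfun b \<and> b x \<noteq> 0 \<and> (\<forall>y\<in>W. f y * b y = a y))"
proof
  assume f: "f \<in> regular affine_space W"
  show "\<forall>x\<in>W. \<exists>a b. polyfun a \<and> polyfun b \<and> b x \<noteq> 0 \<and> (\<forall>y\<in>W. f y * b y = a y)"
  proof
    fix x assume "x \<in> W"
    with f obtain V a b where V: "zariski_open V" "x \<in> V" "V \<subseteq> W" "polyfun a" "polyfun b"
      "\<forall>y\<in>V. b y \<noteq> 0 \<and> f y = a y / b y"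
      unfolding affine_space_def by auto
    obtain u where u: "polyfun u" "u x \<noteq> 0" "\<forall>y. u y \<noteq> 0 \<longrightarrow> y \<in> V"
      using V(1,2) unfolding zariski_open_iff by blast
    have "f y * (b y * u y) = a y * u y" for y
      using u(3) V(6) by (cases "u y = 0") auto
    then show "\<exists>a b. polyfun a \<and> polyfun b \<and> b x \<noteq> 0 \<and> (\<forall>y\<in>W. f y * b y = a y)"
      using V u by (intro exI[of _ "\<lambda>y. a y * u y"] exI[of _ "\<lambda>y. b y * u y"])
        (auto intro: polyfun_mult)
  qed
next
  assume *: "\<forall>x\<in>W. \<exists>a b. polyfun a \<and> polyfun b \<and> b x \<noteq> 0 \<and> (\<forall>y\<in>W. f y * b y = a y)"
  show "f \<in> regular affine_space W"
    unfolding affine_space_def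
  proof (clarsimp)
    fix x assume x: "x \<in> W"
    with * obtain a b where ab: "polyfun a" "polyfun b" "b x \<noteq> 0" "\<forall>y\<in>W. f y * b y = a y"
      by blast
    have "f y = a y / b y" if "y \<in> W" "b y \<noteq> 0" for y
      using ab(4) that by (metis nonzero_mult_div_cancel_right)
    then show "\<exists>V. zariski_open V \<and> x \<in> V \<and> V \<subseteq> W \<and> (\<exists>g. polyfun g \<and>
        (\<exists>h. polyfun h \<and> (\<forall>y\<in>V. h y \<noteq> 0 \<and> f y = g y / h y)))"
      using ab x assms
      by (intro exI[of _ "{y. b y \<noteq> 0} \<inter> W"] conjI exI[of _ a] exI[of _ b])
        (auto simp: zariski_open_Int zariski_open_nonvanishing)
  qed
qed

lemma wscale_1 [simp]: "wscale q 1 x = x"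
  by (simp add: wscale_def)

lemma wscale_eq_0_iff: "c \<noteq> 0 \<Longrightarrow> wscale q c x = 0 \<longleftrightarrow> x = 0"
  by (auto simp: wscale_def vec_eq_iff)

lemma mem_wpt_iff: "y \<in> wpt q x \<longleftrightarrow> (\<exists>c. c \<noteq> 0 \<and> y = wscale q c x)"
  by (auto simp: orbit_of_def scalings_def)

lemma self_in_wpt: "x \<in> wpt q x"
  unfolding mem_wpt_iff by (rule exI[of _ 1]) simp

lemma wpt_eq_iff: "wpt q x = wpt q y \<longleftrightarrow> (\<exists>c. c \<noteq> 0 \<and> y = wscale q c x)"
  using self_in_wpt[of y q] mem_wpt_iff[of y q x] wpt_wscale by metis

lemma ball_wpt_iff:
  assumes "\<And>c. c \<noteq> 0 \<Longrightarrow> P (wscale q c y) \<longleftrightarrow> P y"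
  shows "(\<forall>x\<in>wpt q y. P x) \<longleftrightarrow> P y"
proof
  show "P y" if "\<forall>x\<in>wpt q y. P x" using that self_in_wpt by blast
qed (auto simp: mem_wpt_iff assms)

lemma points_wproj: "points (wproj q) = wpt q ` (- {0})"
  by (simp add: wproj_def points_quot_fspace points_punctured)

lemma wpt_in_points_iff: "wpt q x \<in> points (wproj q) \<longleftrightarrow> x \<noteq> 0"
  by (auto simp: points_wproj wpt_eq_iff wscale_eq_0_iff)

lemma openin_wproj: "openin (zar (wproj q)) U \<longleftrightarrow>
    U \<subseteq> points (wproj q) \<and> zariski_open {x. x \<noteq> 0 \<and> wpt q x \<in> U}"
  unfolding points_wproj
  by (simp add: wproj_def openin_quot_fspace points_punctured openin_punctured)

lemma sheaf_like_wproj: "sheaf_like (wproj q)"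
  unfolding wproj_def
  by (intro sheaf_like_quot_fspace sheaf_like_sub_fspace sheaf_like_affine_space)

lemma regular_wproj_iff:
  assumes "openin (zar (wproj q)) U"
  shows "f \<in> regular (wproj q) U \<longleftrightarrow> (\<forall>x. x \<noteq> 0 \<longrightarrow> wpt q x \<in> U \<longrightarrow>
    (\<exists>a b. polyfun a \<and> polyfun b \<and> b x \<noteq> 0 \<and>
      (\<forall>y. y \<noteq> 0 \<longrightarrow> wpt q y \<in> U \<longrightarrow> f (wpt q y) * b y = a y)))"
proof -
  have op: "zariski_open {x. x \<noteq> 0 \<and> wpt q x \<in> U}" using assms by (simp add: openin_wproj)
  have "f \<in> regular (wproj q) U \<longleftrightarrow>
      f \<circ> orbit_of (scalings q) \<in> regular affine_space {x. x \<noteq> 0 \<and> wpt q x \<in> U}"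
    using regular_sub_open[OF sheaf_like_affine_space, of "{x. x \<noteq> 0 \<and> wpt q x \<in> U}"] op
    by (simp add: wproj_def regular_quot_fspace points_punctured openin_affine_space)
  then show ?thesis
    by (simp add: regular_affine_space_iff[OF op] imp_conjL)
qed

section \<open>Homogeneous fractions on weighted projective space\<close>

text \<open>The scalings of the point with all coordinates \<open>1\<close> form a one-parameter
  subgroup of the torus, whose isotypic components are the weighted homogeneous parts. Both
  polynomials receive the same factor \<open>\<kappa>\<close>, so their quotient is invariant under
  scaling.\<close>

lemma homogenize:
  assumes "polyfun a" "polyfun b" "b x \<noteq> 0"
  obtains \<alpha> \<beta> \<kappa> where "polyfun \<alpha>" "polyfun \<beta>" "\<beta> x \<noteq> 0"
    and "\<forall>c. c \<noteq> 0 \<longrightarrow> \<kappa> c \<noteq> 0"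
    and "\<forall>c y. c \<noteq> 0 \<longrightarrow> \<alpha> (wscale q c y) = \<kappa> c * \<alpha> y \<and> \<beta> (wscale q c y) = \<kappa> c * \<beta> y"
    and "\<forall>z u v. (\<forall>c. c \<noteq> 0 \<longrightarrow> u * a (wscale q c z) + v * b (wscale q c z) = 0) \<longrightarrow>
      u * \<alpha> z + v * \<beta> z = 0"
proof -
  define K where "K = {wscale q c 1 | c. c \<noteq> 0}"
  have "1 \<in> K" unfolding K_def by (auto intro!: exI[of _ 1])
  moreover have "\<forall>s\<in>K. \<forall>t\<in>K. s * t \<in> K"
  proof (intro ballI)
    fix s t assume "s \<in> K" "t \<in> K"
    then obtain c e where "s = wscale q c 1" "t = wscale q e 1" "c \<noteq> 0" "e \<noteq> 0"
      by (auto simp: K_def)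
    then have "s * t = wscale q (c * e) 1" "c * e \<noteq> 0"
      by (simp_all add: wscale_eq_mult[of q c "wscale q e 1", symmetric] wscale_wscale)
    then show "s * t \<in> K" unfolding K_def by blast
  qed
  ultimately obtain M ca cb where M: "finite M"
    "\<forall>m\<in>M. \<forall>m'\<in>M. \<forall>t\<in>K. lmon (\<lambda>k. int (m k)) t = lmon (\<lambda>k. int (m' k)) t"
    "(\<Sum>m\<in>M. cb m * lmon (\<lambda>k. int (m k)) x) \<noteq> 0"
    "\<forall>z u v. (\<forall>t\<in>K. u * a (t * z) + v * b (t * z) = 0) \<longrightarrow>
       u * (\<Sum>m\<in>M. ca m * lmon (\<lambda>k. int (m k)) z)
     + v * (\<Sum>m\<in>M. cb m * lmon (\<lambda>k. int (m k)) z) = 0"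
    by (rule semi_invariant_components[OF assms]) (rule that)
  from M(3) have "M \<noteq> {}" by auto
  then obtain m0 where m0: "m0 \<in> M" by blast
  let ?\<kappa> = "\<lambda>c. lmon (\<lambda>k. int (m0 k)) (wscale q c 1)"
  define S where "S c y = (\<Sum>m\<in>M. c m * lmon (\<lambda>k. int (m k)) y)" for c y
  have hom: "S f (wscale q c y) = ?\<kappa> c * S f y" if c: "c \<noteq> 0" for f c y
  proof -
    have "lmon (\<lambda>k. int (m k)) (wscale q c y) = ?\<kappa> c * lmon (\<lambda>k. int (m k)) y"
      if m: "m \<in> M" for m
    proof -
      have "wscale q c 1 \<in> K" using c by (auto simp: K_def)
      then have "lmon (\<lambda>k. int (m k)) (wscale q c 1) = ?\<kappa> c"
        using M(2) m m0 by blast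
      then show ?thesis by (subst wscale_eq_mult) (simp add: lmon_mult)
    qed
    then show ?thesis unfolding S_def sum_distrib_left by (intro sum.cong) auto
  qed
  show thesis
  proof (rule that[of "S ca" "S cb" ?\<kappa>])
    show "polyfun (S ca)" "polyfun (S cb)"
      unfolding S_def by (intro polyfun_sum polyfun_mult polyfun_const polyfun_lmon; simp)+
    show "S cb x \<noteq> 0" using M(3) by (simp add: S_def)
    show "\<forall>c. c \<noteq> 0 \<longrightarrow> ?\<kappa> c \<noteq> 0" by (simp add: lmon_nonzero wscale_one_in_tor)
    show "\<forall>c y. c \<noteq> 0 \<longrightarrow> S ca (wscale q c y) = ?\<kappa> c * S ca y \<and> S cb (wscale q c y) = ?\<kappa> c * S cb y"
      using hom by blast
    show "\<forall>z u v. (\<forall>c. c \<noteq> 0 \<longrightarrow> u * a (wscale q c z) + v * b (wscale q c z) = 0) \<longrightarrow>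
        u * S ca z + v * S cb z = 0"
    proof (intro allI impI)
      fix z u v assume *: "\<forall>c. c \<noteq> 0 \<longrightarrow> u * a (wscale q c z) + v * b (wscale q c z) = 0"
      have "\<forall>t\<in>K. u * a (t * z) + v * b (t * z) = 0"
      proof
        fix t assume "t \<in> K"
        then obtain c where "c \<noteq> 0" "t * z = wscale q c z"
          by (auto simp: K_def wscale_eq_mult[of q _ z, symmetric])
        then show "u * a (t * z) + v * b (t * z) = 0" using * by simp
      qed
      then show "u * S ca z + v * S cb z = 0" unfolding S_def using M(4) by blast
    qed
  qed
qed

lemma openin_wproj_nonvanishing:
  assumes "polyfun b" "\<And>c y. c \<noteq> 0 \<Longrightarrow> b (wscale q c y) = 0 \<longleftrightarrow> b y = 0"
  defines "U \<equiv> wpt q ` {y. y \<noteq> 0 \<and> b y \<noteq> 0}"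
  shows "openin (zar (wproj q)) U" and "wpt q y \<in> U \<longleftrightarrow> y \<noteq> 0 \<and> b y \<noteq> 0"
proof -
  show mem: "wpt q y \<in> U \<longleftrightarrow> y \<noteq> 0 \<and> b y \<noteq> 0" for y
    unfolding U_def using assms(2) by (auto simp: wpt_eq_iff wscale_eq_0_iff)
  have "{x. x \<noteq> 0 \<and> wpt q x \<in> U} = {x. b x \<noteq> 0} \<inter> - {0}" by (auto simp: mem)
  then have "zariski_open {x. x \<noteq> 0 \<and> wpt q x \<in> U}"
    using assms(1) by (simp add: zariski_open_Int zariski_open_nonvanishing zariski_open_nonzero)
  then show "openin (zar (wproj q)) U"
    by (auto simp: openin_wproj U_def points_wproj)
qed

lemma closedin_wproj_vanishing:
  assumes "polyfun b" "\<And>c y. c \<noteq> 0 \<Longrightarrow> b (wscale q c y) = 0 \<longleftrightarrow> b y = 0"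
  shows "closedin (zar (wproj q)) (wpt q ` {y. y \<noteq> 0 \<and> b y = 0})"
    and "wpt q y \<in> wpt q ` {y. y \<noteq> 0 \<and> b y = 0} \<longleftrightarrow> y \<noteq> 0 \<and> b y = 0"
proof -
  let ?C = "wpt q ` {y. y \<noteq> 0 \<and> b y = 0}" and ?U = "wpt q ` {y. y \<noteq> 0 \<and> b y \<noteq> 0}"
  show mem: "wpt q y \<in> ?C \<longleftrightarrow> y \<noteq> 0 \<and> b y = 0" for y
    using assms(2) by (auto simp: wpt_eq_iff wscale_eq_0_iff)
  have "points (wproj q) - ?C = ?U"
  proof (intro subset_antisym subsetI)
    fix P assume P: "P \<in> points (wproj q) - ?C"
    then obtain y where "P = wpt q y" "y \<noteq> 0" by (auto simp: points_wproj)
    then show "P \<in> ?U" using P mem[of y] by blast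
  next
    fix P assume "P \<in> ?U"
    then obtain y where "P = wpt q y" "y \<noteq> 0" "b y \<noteq> 0" by blast
    then show "P \<in> points (wproj q) - ?C" using mem[of y] by (simp add: wpt_in_points_iff)
  qed
  then show "closedin (zar (wproj q)) ?C"
    using openin_wproj_nonvanishing(1)[OF assms] by (auto simp: closedin_def points_wproj)
qed

text \<open>
  Homogeneity need not be required of the polynomials: it can be arranged by passing to
  semi-invariant components, since the conditions are invariant under the scalings.
\<close>

lemma openin_wproj_sub_iff:
  assumes "Z \<subseteq> points (wproj q)"
  shows "openin (zar (sub_fspace (wproj q) Z)) W \<longleftrightarrow> W \<subseteq> Z \<and>
    (\<forall>x. x \<noteq> 0 \<longrightarrow> wpt q x \<in> W \<longrightarrow>
      (\<exists>b. polyfun b \<and> b x \<noteq> 0 \<and> (\<forall>y. y \<noteq> 0 \<longrightarrow> wpt q y \<in> Z \<longrightarrow> b y \<noteq> 0 \<longrightarrow> wpt q y \<in> W)))"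
    (is "?L \<longleftrightarrow> ?R")
proof
  assume ?L
  then obtain U where U: "openin (zar (wproj q)) U" "W = U \<inter> Z"
    by (auto simp: zar_sub_fspace openin_subtopology)
  show ?R
  proof (intro conjI allI impI)
    fix x assume "x \<noteq> 0" "wpt q x \<in> W"
    then have "x \<in> {x. x \<noteq> 0 \<and> wpt q x \<in> U}" using U(2) by blast
    then obtain b where "polyfun b" "b x \<noteq> 0"
      "\<forall>y. b y \<noteq> 0 \<longrightarrow> y \<in> {x. x \<noteq> 0 \<and> wpt q x \<in> U}"
      using U(1) unfolding openin_wproj zariski_open_iff by blast
    then show "\<exists>b. polyfun b \<and> b x \<noteq> 0 \<and>
        (\<forall>y. y \<noteq> 0 \<longrightarrow> wpt q y \<in> Z \<longrightarrow> b y \<noteq> 0 \<longrightarrow> wpt q y \<in> W)"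
      unfolding U(2) by blast
  qed (use U(2) in blast)
next
  assume R: ?R
  show ?L
  proof (subst openin_subopen, intro ballI)
    fix P assume P: "P \<in> W"
    with R assms obtain x where x: "P = wpt q x" "x \<noteq> 0" by (auto simp: points_wproj)
    with R P obtain b where b: "polyfun b" "b x \<noteq> 0"
      "\<forall>y. y \<noteq> 0 \<longrightarrow> wpt q y \<in> Z \<longrightarrow> b y \<noteq> 0 \<longrightarrow> wpt q y \<in> W"
      by blast
    obtain \<alpha> \<beta> \<kappa> where h: "polyfun \<alpha>" "polyfun \<beta>" "\<beta> x \<noteq> 0"
      "\<forall>c. c \<noteq> 0 \<longrightarrow> \<kappa> c \<noteq> (0::complex)"
      "\<forall>c y. c \<noteq> 0 \<longrightarrow> \<alpha> (wscale q c y) = \<kappa> c * \<alpha> y \<and> \<beta> (wscale q c y) = \<kappa> c * \<beta> y"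
      "\<forall>z u v. (\<forall>c. c \<noteq> 0 \<longrightarrow> u * b (wscale q c z) + v * b (wscale q c z) = 0) \<longrightarrow>
        u * \<alpha> z + v * \<beta> z = 0"
      by (rule homogenize[OF b(1,1,2)]) (rule that)
    define U where "U = wpt q ` {y. y \<noteq> 0 \<and> \<beta> y \<noteq> 0}"
    have U: "openin (zar (wproj q)) U" "\<And>y. wpt q y \<in> U \<longleftrightarrow> y \<noteq> 0 \<and> \<beta> y \<noteq> 0"
      unfolding U_def using h(4,5) by (intro openin_wproj_nonvanishing h(2); simp)+
    have "U \<inter> Z \<subseteq> W"
    proof
      fix Q assume Q: "Q \<in> U \<inter> Z"
      with assms obtain z where z: "Q = wpt q z" "z \<noteq> 0" by (auto simp: points_wproj)
      then have "\<beta> z \<noteq> 0" using Q U(2) by simp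
      \<comment> \<open>Contrapositive of \<open>h(6)\<close> with \<open>u = 0\<close>,
        \<open>v = 1\<close>: if \<open>b\<close> vanished along the whole scaling orbit of
        \<open>z\<close>, then \<open>\<beta> z\<close> would vanish.\<close>
      then obtain c where c: "c \<noteq> 0" "b (wscale q c z) \<noteq> 0"
        using h(6)[rule_format, of 0 z 1] by auto
      then have "wpt q (wscale q c z) \<in> W"
        using b(3)[rule_format, of "wscale q c z"] Q z by (simp add: wpt_wscale wscale_eq_0_iff)
      then show "Q \<in> W" using c(1) z(1) by (simp add: wpt_wscale)
    qed
    moreover have "openin (zar (sub_fspace (wproj q) Z)) (U \<inter> Z)"
      using U(1) by (auto simp: zar_sub_fspace openin_subtopology)
    moreover have "P \<in> U \<inter> Z" using P R U(2) x h(3) by auto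
    ultimately show "\<exists>T. openin (zar (sub_fspace (wproj q) Z)) T \<and> P \<in> T \<and> T \<subseteq> W"
      by blast
  qed
qed

text \<open>Regularity on a subset asks for a local extension to the ambient space. The homogenized
  fraction \<open>\<alpha> / \<beta>\<close> supplies one, although \<open>a\<close> and
  \<open>b\<close> are related to \<open>f\<close> only on \<open>W\<close>.\<close>

lemma regular_wproj_sub_iff:
  fixes q :: "int ^ 'n::finite"
  assumes "W \<subseteq> points (wproj q)"
  shows "f \<in> regular (sub_fspace (wproj q) Z) W \<longleftrightarrow>
    (\<forall>x. x \<noteq> 0 \<longrightarrow> wpt q x \<in> W \<longrightarrow> (\<exists>a b. polyfun a \<and> polyfun b \<and> b x \<noteq> 0 \<and>
      (\<forall>y. y \<noteq> 0 \<longrightarrow> wpt q y \<in> W \<longrightarrow> f (wpt q y) * b y = a y)))" (is "?L \<longleftrightarrow> ?R")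
proof
  assume L: ?L
  show ?R
  proof (intro allI impI)
    fix x :: "complex ^ 'n" assume x: "x \<noteq> 0" "wpt q x \<in> W"
    with L obtain U g where U: "openin (zar (wproj q)) U" "wpt q x \<in> U"
      "g \<in> regular (wproj q) U" "\<forall>y\<in>U \<inter> W. f y = g y"
      unfolding regular_sub_fspace by blast
    obtain a b where ab: "polyfun a" "polyfun b" "b x \<noteq> 0"
      "\<forall>y. y \<noteq> 0 \<longrightarrow> wpt q y \<in> U \<longrightarrow> g (wpt q y) * b y = a y"
      using U(3)[unfolded regular_wproj_iff[OF U(1)], rule_format, OF x(1) U(2)] by blast
    have "zariski_open {x. x \<noteq> 0 \<and> wpt q x \<in> U}" using U(1) by (simp add: openin_wproj)
    from this[unfolded zariski_open_iff, rule_format, of x]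
    obtain u where u: "polyfun u" "u x \<noteq> 0" "\<forall>y. u y \<noteq> 0 \<longrightarrow> y \<noteq> 0 \<and> wpt q y \<in> U"
      using U(2) x(1) by auto
    have "f (wpt q y) * (b y * u y) = a y * u y" if "wpt q y \<in> W" for y
      using u(3) ab(4) U(4) that by (cases "u y = 0") auto
    then show "\<exists>a b. polyfun a \<and> polyfun b \<and> b x \<noteq> 0 \<and>
        (\<forall>y. y \<noteq> 0 \<longrightarrow> wpt q y \<in> W \<longrightarrow> f (wpt q y) * b y = a y)"
      using ab u by (intro exI[of _ "\<lambda>y. a y * u y"] exI[of _ "\<lambda>y. b y * u y"])
        (auto intro: polyfun_mult)
  qed
next
  assume R: ?R
  show ?L
    unfolding regular_sub_fspace
  proof
    fix P assume P: "P \<in> W"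
    with assms obtain x where x: "P = wpt q x" "x \<noteq> 0" by (auto simp: points_wproj)
    with R P obtain a b where ab: "polyfun a" "polyfun b" "b x \<noteq> 0"
      "\<forall>y. y \<noteq> 0 \<longrightarrow> wpt q y \<in> W \<longrightarrow> f (wpt q y) * b y = a y"
      by blast
    obtain \<alpha> \<beta> \<kappa> where h: "polyfun \<alpha>" "polyfun \<beta>" "\<beta> x \<noteq> 0"
      "\<forall>c. c \<noteq> 0 \<longrightarrow> \<kappa> c \<noteq> (0::complex)"
      "\<forall>c y. c \<noteq> 0 \<longrightarrow> \<alpha> (wscale q c y) = \<kappa> c * \<alpha> y \<and> \<beta> (wscale q c y) = \<kappa> c * \<beta> y"
      "\<forall>z u v. (\<forall>c. c \<noteq> 0 \<longrightarrow> u * a (wscale q c z) + v * b (wscale q c z) = 0) \<longrightarrow>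
        u * \<alpha> z + v * \<beta> z = 0"
      by (rule homogenize[OF ab(1-3)]) (rule that)
    define U where "U = wpt q ` {y. y \<noteq> 0 \<and> \<beta> y \<noteq> 0}"
    have U: "openin (zar (wproj q)) U" "\<And>y. wpt q y \<in> U \<longleftrightarrow> y \<noteq> 0 \<and> \<beta> y \<noteq> 0"
      unfolding U_def using h(4,5) by (intro openin_wproj_nonvanishing h(2); simp)+
    define g where "g = descend (\<lambda>y. \<alpha> y / \<beta> y)"
    have g: "g (wpt q y) = \<alpha> y / \<beta> y" for y
      unfolding g_def by (intro descend_wpt) (use h(4,5) in simp)
    have "g \<in> regular (wproj q) U"
      unfolding regular_wproj_iff[OF U(1)] U(2) g
      using h(1,2) by (intro allI impI exI[of _ \<alpha>] exI[of _ \<beta>]) auto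
    moreover have "f Q = g Q" if Q: "Q \<in> U \<inter> W" for Q
    proof -
      from Q assms obtain z where z: "Q = wpt q z" "z \<noteq> 0" by (auto simp: points_wproj)
      then have \<beta>: "\<beta> z \<noteq> 0" using Q U(2) by simp
      have "f (wpt q z) * b (wscale q c z) = a (wscale q c z)" if "c \<noteq> 0" for c
        using ab(4)[rule_format, of "wscale q c z"] Q z that by (simp add: wpt_wscale wscale_eq_0_iff)
      \<comment> \<open>The value of \<open>f\<close> is the same at all representatives of the
        point, so it can play the role of the constant \<open>v\<close>.\<close>
      then have "- 1 * \<alpha> z + f (wpt q z) * \<beta> z = 0"
        by (intro h(6)[rule_format]) simp
      then show ?thesis using \<beta> z(1) by (simp add: g field_simps)
    qed
    ultimately show "\<exists>U g. openin (zar (wproj q)) U \<and> P \<in> U \<and> g \<in> regular (wproj q) U \<and>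
        (\<forall>y\<in>U \<inter> W. f y = g y)"
      using U x h(3) by (intro exI[of _ U] exI[of _ g]) auto
  qed
qed

text \<open>The unit \<open>s\<close>, which may vary with the point, allows \<open>\<Phi>\<close>
  to have poles along the coordinate hyperplanes: only the quotient of the two pull-backs and their
  zeros on \<open>D\<close> matter.\<close>

lemma morphism_wprojI:
  assumes Z: "Z \<subseteq> points (wproj q)" and Z': "Z' \<subseteq> points (wproj w)"
    and D: "openin (zar (sub_fspace (wproj q) Z)) D"
    and maps: "\<And>y. y \<noteq> 0 \<Longrightarrow> wpt q y \<in> D \<Longrightarrow> \<pi> (wpt q y) = wpt w (\<Phi> y) \<and> wpt w (\<Phi> y) \<in> Z'"
    and pull: "\<And>a b. polyfun a \<Longrightarrow> polyfun b \<Longrightarrow> \<exists>a' b'. polyfun a' \<and> polyfun b' \<and>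
      (\<forall>y. y \<noteq> 0 \<longrightarrow> wpt q y \<in> D \<longrightarrow> (\<exists>s. s \<noteq> 0 \<and> a' y = s * a (\<Phi> y) \<and> b' y = s * b (\<Phi> y)))"
  shows "morphism (sub_fspace (sub_fspace (wproj q) Z) D) (sub_fspace (wproj w) Z') \<pi>"
proof (rule morphism_open_subI[OF sheaf_like_sub_fspace[OF sheaf_like_wproj] D])
  have DZ: "D \<subseteq> Z" using D by (simp add: openin_wproj_sub_iff[OF Z])
  have cone: "\<exists>y. y \<noteq> 0 \<and> P = wpt q y" if "P \<in> D" for P
    using that DZ Z by (auto simp: points_wproj)
  have nz: "\<Phi> y \<noteq> 0" if "y \<noteq> 0" "wpt q y \<in> D" for y
    using maps[OF that] Z' wpt_in_points_iff by blast
  show "\<pi> P \<in> points (sub_fspace (wproj w) Z')" if "P \<in> D" for P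
    using that cone[OF that] maps Z' by (auto simp: zar_sub_fspace)
  fix V assume "openin (zar (sub_fspace (wproj w) Z')) V"
  then have VZ: "V \<subseteq> Z'" and V: "\<forall>x. x \<noteq> 0 \<longrightarrow> wpt w x \<in> V \<longrightarrow>
      (\<exists>b. polyfun b \<and> b x \<noteq> 0 \<and> (\<forall>y. y \<noteq> 0 \<longrightarrow> wpt w y \<in> Z' \<longrightarrow> b y \<noteq> 0 \<longrightarrow> wpt w y \<in> V))"
    by (simp_all add: openin_wproj_sub_iff[OF Z'])
  show "openin (zar (sub_fspace (wproj q) Z)) {P \<in> D. \<pi> P \<in> V}"
    unfolding openin_wproj_sub_iff[OF Z]
  proof (intro conjI allI impI)
    fix x assume x: "x \<noteq> 0" "wpt q x \<in> {P \<in> D. \<pi> P \<in> V}"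
    then have Vx: "wpt w (\<Phi> x) \<in> V" using maps by auto
    then obtain b where b: "polyfun b" "b (\<Phi> x) \<noteq> 0"
      "\<forall>y. y \<noteq> 0 \<longrightarrow> wpt w y \<in> Z' \<longrightarrow> b y \<noteq> 0 \<longrightarrow> wpt w y \<in> V"
      using V nz x by blast
    obtain b' where b': "polyfun b'"
      "\<forall>y. y \<noteq> 0 \<longrightarrow> wpt q y \<in> D \<longrightarrow> (\<exists>s. s \<noteq> 0 \<and> b' y = s * b (\<Phi> y))"
      using pull[OF b(1,1)] by blast
    obtain e where e: "polyfun e" "e x \<noteq> 0"
      "\<forall>y. y \<noteq> 0 \<longrightarrow> wpt q y \<in> Z \<longrightarrow> e y \<noteq> 0 \<longrightarrow> wpt q y \<in> D"
      using D x unfolding openin_wproj_sub_iff[OF Z] by blast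
    show "\<exists>b. polyfun b \<and> b x \<noteq> 0 \<and>
        (\<forall>y. y \<noteq> 0 \<longrightarrow> wpt q y \<in> Z \<longrightarrow> b y \<noteq> 0 \<longrightarrow> wpt q y \<in> {P \<in> D. \<pi> P \<in> V})"
    \<comment> \<open>The pull-back \<open>b'\<close> is controlled only over \<open>D\<close>; the
      factor \<open>e\<close> vanishes at the remaining points of the cone over
      \<open>Z\<close>.\<close>
    proof (intro exI[of _ "\<lambda>y. b' y * e y"] conjI allI impI)
      show "polyfun (\<lambda>y. b' y * e y)" by (intro polyfun_mult b' e)
      show "b' x * e x \<noteq> 0" using b'(2) b(2) e(2) x by fastforce
      fix y assume y: "y \<noteq> 0" "wpt q y \<in> Z" "b' y * e y \<noteq> 0"
      then have yD: "wpt q y \<in> D" using e(3) by simp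
      then have "b (\<Phi> y) \<noteq> 0" using b'(2) y by fastforce
      then have "wpt w (\<Phi> y) \<in> V" using b(3) maps nz y yD by blast
      then show "wpt q y \<in> {P \<in> D. \<pi> P \<in> V}" using maps[OF y(1) yD] yD by simp
    qed
  qed (use DZ in blast)
  fix h assume h: "h \<in> regular (sub_fspace (wproj w) Z') V"
  have Vp: "V \<subseteq> points (wproj w)" using VZ Z' by blast
  have Dp: "{P \<in> D. \<pi> P \<in> V} \<subseteq> points (wproj q)" using DZ Z by blast
  show "h \<circ> \<pi> \<in> regular (sub_fspace (wproj q) Z) {P \<in> D. \<pi> P \<in> V}"
    unfolding regular_wproj_sub_iff[OF Dp]
  proof (intro allI impI)
    fix x assume x: "x \<noteq> 0" "wpt q x \<in> {P \<in> D. \<pi> P \<in> V}"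
    then have "wpt w (\<Phi> x) \<in> V" using maps by auto
    then obtain a b where ab: "polyfun a" "polyfun b" "b (\<Phi> x) \<noteq> 0"
      "\<forall>y. y \<noteq> 0 \<longrightarrow> wpt w y \<in> V \<longrightarrow> h (wpt w y) * b y = a y"
      using h nz x unfolding regular_wproj_sub_iff[OF Vp] by blast
    obtain a' b' where ab': "polyfun a'" "polyfun b'"
      "\<forall>y. y \<noteq> 0 \<longrightarrow> wpt q y \<in> D \<longrightarrow> (\<exists>s. s \<noteq> 0 \<and> a' y = s * a (\<Phi> y) \<and> b' y = s * b (\<Phi> y))"
      using pull[OF ab(1,2)] by blast
    have "(h \<circ> \<pi>) (wpt q y) * b' y = a' y" if y: "y \<noteq> 0" "wpt q y \<in> {P \<in> D. \<pi> P \<in> V}" for y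
    proof -
      have yD: "wpt q y \<in> D" and yV: "wpt w (\<Phi> y) \<in> V" using y maps by auto
      obtain s where s: "a' y = s * a (\<Phi> y)" "b' y = s * b (\<Phi> y)" using ab'(3) y(1) yD by blast
      show ?thesis
        using ab(4)[rule_format, OF nz[OF y(1) yD] yV] maps[OF y(1) yD] by (simp add: s)
    qed
    moreover have "b' x \<noteq> 0" using ab'(3) ab(3) x by fastforce
    ultimately show "\<exists>a b. polyfun a \<and> polyfun b \<and> b x \<noteq> 0 \<and> (\<forall>y. y \<noteq> 0 \<longrightarrow>
        wpt q y \<in> {P \<in> D. \<pi> P \<in> V} \<longrightarrow> (h \<circ> \<pi>) (wpt q y) * b y = a y)"
      using ab'(1,2) by blast
  qed
qed

section \<open>Monomial maps as quotient maps\<close>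

definition torus_part :: "int ^ 'n::finite \<Rightarrow> (complex ^ 'n) set set \<Rightarrow> (complex ^ 'n) set set" where
  "torus_part q Z = wpt q ` {y \<in> tor. wpt q y \<in> Z}"

lemma wpt_in_torus_part: "wpt q y \<in> torus_part q Z \<longleftrightarrow> y \<in> tor \<and> wpt q y \<in> Z"
  by (auto simp: torus_part_def wpt_eq_iff wscale_in_tor_iff wpt_wscale)

lemma torus_part_subset: "torus_part q Z \<subseteq> Z"
  by (auto simp: torus_part_def)

lemma torus_part_cases:
  assumes "P \<in> torus_part q Z"
  obtains y where "P = wpt q y" "y \<in> tor" "wpt q y \<in> Z"
  using assms by (auto simp: torus_part_def)

lemma tor_iff_prod: "x \<in> tor \<longleftrightarrow> (\<Prod>k\<in>UNIV. x $ k) \<noteq> 0"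
  by (auto simp: tor_def)

lemma openin_torus_part:
  assumes "Z \<subseteq> points (wproj q)"
  shows "openin (zar (sub_fspace (wproj q) Z)) (torus_part q Z)"
  unfolding openin_wproj_sub_iff[OF assms] wpt_in_torus_part
proof (intro conjI allI impI)
  fix x :: "complex ^ 'a" assume "x \<in> tor \<and> wpt q x \<in> Z"
  then show "\<exists>b. polyfun b \<and> b x \<noteq> 0 \<and>
      (\<forall>y. y \<noteq> 0 \<longrightarrow> wpt q y \<in> Z \<longrightarrow> b y \<noteq> 0 \<longrightarrow> y \<in> tor \<and> wpt q y \<in> Z)"
    by (intro exI[of _ "\<lambda>x. \<Prod>k\<in>UNIV. x $ k"])
      (auto simp: tor_iff_prod intro: polyfun_prod polyfun_coord)
qed (rule torus_part_subset)

text \<open>One common power clears the denominators of both pull-backs, so that their quotient is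
  preserved.\<close>

lemma monmap_pullback_pair:
  fixes E :: "'m::finite \<Rightarrow> 'n::finite \<Rightarrow> int"
  assumes "polyfun a" "polyfun b"
  obtains a' b' where "polyfun a'" "polyfun b'"
    "\<forall>y\<in>tor. \<exists>s. s \<noteq> 0 \<and> a' y = s * a (monmap E y) \<and> b' y = s * b (monmap E y)"
proof -
  obtain Na where Na: "\<forall>N\<ge>Na. \<exists>p. polyfun p \<and>
      (\<forall>x\<in>tor. p x = (\<Prod>k\<in>UNIV. x $ k) ^ N * a (monmap E x))"
    using monmap_pullback[OF assms(1)] by blast
  obtain Nb where Nb: "\<forall>N\<ge>Nb. \<exists>p. polyfun p \<and>
      (\<forall>x\<in>tor. p x = (\<Prod>k\<in>UNIV. x $ k) ^ N * b (monmap E x))"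
    using monmap_pullback[OF assms(2)] by blast
  obtain a' where a': "polyfun a'"
    "\<forall>x\<in>tor. a' x = (\<Prod>k\<in>UNIV. x $ k) ^ (Na + Nb) * a (monmap E x)"
    using Na[rule_format, OF le_add1] by blast
  obtain b' where b': "polyfun b'"
    "\<forall>x\<in>tor. b' x = (\<Prod>k\<in>UNIV. x $ k) ^ (Na + Nb) * b (monmap E x)"
    using Nb[rule_format, OF le_add2] by blast
  show thesis
  proof (rule that[OF a'(1) b'(1)], intro ballI)
    fix y :: "complex ^ 'n" assume y: "y \<in> tor"
    then show "\<exists>s. s \<noteq> 0 \<and> a' y = s * a (monmap E y) \<and> b' y = s * b (monmap E y)"
      using a'(2) b'(2) by (intro exI[of _ "(\<Prod>k\<in>UNIV. y $ k) ^ (Na + Nb)"]) (simp add: tor_def)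
  qed
qed

lemma dense_open_irreducible:
  assumes "irreducible_fspace X" "openin (zar X) D" "D \<noteq> {}"
  shows "dense_open X D"
proof -
  let ?C = "Abstract_Topology.closure_of (zar X) D"
  have "closedin (zar X) ?C" "closedin (zar X) (points X - D)"
    using assms(2) by auto
  moreover have "points X = ?C \<union> (points X - D)"
    using closure_of_subset[OF openin_subset[OF assms(2)]] closure_of_subset_topspace[of "zar X" D]
      openin_subset[OF assms(2)] by blast
  moreover have "points X - D \<noteq> points X" using assms(3) openin_subset[OF assms(2)] by blast
  ultimately have "?C = points X" using assms(1) unfolding irreducible_fspace_def by metis
  with assms(2) show ?thesis by (simp add: dense_open_def)
qed

text \<open>The descent divides by the kernel of \<open>monmap E\<close> in the torus; scalings are
  absorbed by the homogenization behind \<open>openin_wproj_sub_iff\<close> and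
  \<open>regular_wproj_sub_iff\<close>, and \<open>fibres\<close> ties the result to
  \<open>G\<close>. The condition \<open>cone\<close> makes the torus part of \<open>Z\<close> a
  full preimage, hence stable under the kernel.\<close>

lemma monomial_quotient:
  fixes q :: "int ^ 'n::finite" and w :: "int ^ 'm::finite" and E :: "'m \<Rightarrow> 'n \<Rightarrow> int"
    and Z Z'
  defines "D \<equiv> torus_part q Z" and "D' \<equiv> torus_part w Z'"
    and "X \<equiv> sub_fspace (wproj q) Z" and "Y \<equiv> sub_fspace (wproj w) Z'"
  assumes Z: "Z \<subseteq> points (wproj q)" and Z': "Z' \<subseteq> points (wproj w)"
    and chars: "\<And>m. (\<And>t. t \<in> tor \<Longrightarrow> monmap E t = 1 \<Longrightarrow> lmon m t = 1) \<Longrightarrow>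
      \<exists>r. \<forall>k. m k = (\<Sum>j\<in>UNIV. r j * E j k)"
    and cone: "\<And>y. y \<in> tor \<Longrightarrow> wpt q y \<in> Z \<longleftrightarrow> wpt w (monmap E y) \<in> Z'"
    and surj: "\<And>x. x \<in> tor \<Longrightarrow> wpt w x \<in> Z' \<Longrightarrow> \<exists>y\<in>tor. x = monmap E y"
    and \<pi>: "\<And>y. y \<in> tor \<Longrightarrow> wpt q y \<in> Z \<Longrightarrow> \<pi> (wpt q y) = wpt w (monmap E y)"
    and G: "subgroup G (aut_group X)"
    and stable: "\<And>g P. g \<in> G \<Longrightarrow> P \<in> D \<Longrightarrow> g P \<in> D"
    and fibres: "\<And>y z. y \<in> tor \<Longrightarrow> z \<in> tor \<Longrightarrow> wpt q y \<in> Z \<Longrightarrow> wpt q z \<in> Z \<Longrightarrow>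
      wpt w (monmap E y) = wpt w (monmap E z) \<longleftrightarrow> (\<exists>g\<in>G. wpt q z = g (wpt q y))"
    and rat: "rational_map X Y D\<^sub>0 \<pi>" and D0: "D \<subseteq> D\<^sub>0"
    and dense: "dense_open X D" "dense_open Y D'"
  shows "birationally_equivalent_maps X Y D\<^sub>0 \<pi> (quot_fspace X G) (points X) (orbit_of G)
    \<and> birational Y (quot_fspace X G)"
proof -
  have shX: "sheaf_like X" and shY: "sheaf_like Y"
    by (simp_all add: X_def Y_def sheaf_like_sub_fspace sheaf_like_wproj)
  have ptsX: "points X = Z" using Z by (auto simp: X_def zar_sub_fspace)
  have memD: "wpt q y \<in> D \<longleftrightarrow> y \<in> tor \<and> wpt q y \<in> Z" for y by (simp add: D_def wpt_in_torus_part)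
  have memD': "wpt w y \<in> D' \<longleftrightarrow> y \<in> tor \<and> wpt w y \<in> Z'" for y by (simp add: D'_def wpt_in_torus_part)
  have DZ: "D \<subseteq> Z" "D' \<subseteq> Z'" by (simp_all add: D_def D'_def torus_part_subset)
  have twist: "monmap E (t * z) = monmap E z" if "monmap E t = 1" for t z
    using that by (simp add: monmap_mult)
  have lift: "\<exists>y. y \<in> tor \<and> x = monmap E y \<and> wpt q y \<in> D \<and> \<pi> (wpt q y) = wpt w x"
    if "wpt w x \<in> D'" for x
    using that surj cone \<pi> unfolding memD memD' by blast
  show ?thesis
  proof (rule quotient_birational[OF shX shY G rat dense(1) D0 dense(2)])
    show "\<pi> ` D = D'"
    proof
      show "\<pi> ` D \<subseteq> D'"
        unfolding D_def by (auto elim!: torus_part_cases simp: \<pi> memD' cone monmap_tor)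
      show "D' \<subseteq> \<pi> ` D"
      proof
        fix P assume P: "P \<in> D'"
        then obtain x where "P = wpt w x" unfolding D'_def by (rule torus_part_cases)
        then show "P \<in> \<pi> ` D" using lift[of x] P by force
      qed
    qed
    show "g P \<in> D" if "g \<in> G" "P \<in> D" for g P by (rule stable[OF that])
    show "\<pi> P = \<pi> Q \<longleftrightarrow> orbit_of G P = orbit_of G Q" if "P \<in> D" "Q \<in> D" for P Q
    proof -
      obtain y where y: "P = wpt q y" "y \<in> tor" "wpt q y \<in> Z"
        using \<open>P \<in> D\<close> unfolding D_def by (rule torus_part_cases)
      obtain z where z: "Q = wpt q z" "z \<in> tor" "wpt q z \<in> Z"
        using \<open>Q \<in> D\<close> unfolding D_def by (rule torus_part_cases)
      show ?thesis
        using orbit_of_eq_iff[OF shX G, of P Q] fibres[OF y(2) z(2) y(3) z(3)] y z \<pi> ptsX by simp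
    qed
    show "openin (zar Y) V" if V: "V \<subseteq> D'" and op: "openin (zar X) {P \<in> D. \<pi> P \<in> V}" for V
      unfolding Y_def openin_wproj_sub_iff[OF Z']
    proof (intro conjI allI impI)
      show "V \<subseteq> Z'" using V DZ by blast
      fix x assume x: "x \<noteq> 0" "wpt w x \<in> V"
      then obtain y where y: "y \<in> tor" "x = monmap E y" "wpt q y \<in> D" "\<pi> (wpt q y) = wpt w x"
        using lift V by blast
      have yV: "wpt q y \<in> {P \<in> D. \<pi> P \<in> V}" using x y by simp
      obtain b where b: "polyfun b" "b y \<noteq> 0"
        "\<forall>z. z \<noteq> 0 \<longrightarrow> wpt q z \<in> Z \<longrightarrow> b z \<noteq> 0 \<longrightarrow> wpt q z \<in> {P \<in> D. \<pi> P \<in> V}"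
        using op[unfolded X_def openin_wproj_sub_iff[OF Z], THEN conjunct2, rule_format,
            OF tor_nonzero[OF y(1)] yV] by blast
      obtain \<alpha> \<beta> where \<beta>: "polyfun \<alpha>" "polyfun \<beta>" "\<beta> (monmap E y) \<noteq> 0"
        "\<forall>z\<in>tor. \<forall>u v. (\<forall>t\<in>tor. monmap E t = 1 \<longrightarrow> u * b (t * z) + v * b (t * z) = 0) \<longrightarrow>
           u * \<alpha> (monmap E z) + v * \<beta> (monmap E z) = 0"
        by (rule monomial_descent[OF chars b(1,1,2) y(1)]) (assumption, rule that)
      show "\<exists>b. polyfun b \<and> b x \<noteq> 0 \<and>
          (\<forall>y. y \<noteq> 0 \<longrightarrow> wpt w y \<in> Z' \<longrightarrow> b y \<noteq> 0 \<longrightarrow> wpt w y \<in> V)"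
      \<comment> \<open>The product of the coordinates confines the neighbourhood to the torus,
        where points of \<open>Z'\<close> can be lifted.\<close>
      proof (intro exI[of _ "\<lambda>x. \<beta> x * (\<Prod>k\<in>UNIV. x $ k)"] conjI allI impI)
        show "polyfun (\<lambda>x. \<beta> x * (\<Prod>k\<in>UNIV. x $ k))"
          by (intro polyfun_mult polyfun_prod polyfun_coord \<beta>)
        show "\<beta> x * (\<Prod>k\<in>UNIV. x $ k) \<noteq> 0"
          using \<beta>(3) y(1,2) monmap_tor[of y E] by (simp add: tor_iff_prod)
        fix x' assume x': "wpt w x' \<in> Z'" "\<beta> x' * (\<Prod>k\<in>UNIV. x' $ k) \<noteq> 0"
        then have "wpt w x' \<in> D'" by (simp add: memD' tor_iff_prod)
        then obtain z where z: "z \<in> tor" "x' = monmap E z" "wpt q z \<in> D" "\<pi> (wpt q z) = wpt w x'"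
          using lift by blast
        \<comment> \<open>With \<open>u = 0\<close>, \<open>v = 1\<close>: since
          \<open>\<beta>\<close> does not vanish at \<open>monmap E z\<close>, \<open>b\<close>
          cannot vanish on the whole kernel orbit of \<open>z\<close>.\<close>
        obtain t where t: "t \<in> tor" "monmap E t = 1" "b (t * z) \<noteq> 0"
          using \<beta>(4)[rule_format, OF z(1), of 0 1] x'(2) z(2) by auto
        have tz: "t * z \<in> tor" "wpt q (t * z) \<in> Z"
          using cone[of "t * z"] z t x'(1) by (simp_all add: mult_in_tor twist)
        then have "\<pi> (wpt q (t * z)) \<in> V" using b(3) t(3) tor_nonzero by blast
        then show "wpt w x' \<in> V" using \<pi>[OF tz] z(2) t(2) by (simp add: twist)
      qed
    qed
    show "f \<in> regular Y V"
      if V: "V \<subseteq> D'" and reg: "f \<circ> \<pi> \<in> regular X {P \<in> D. \<pi> P \<in> V}" for V f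
    proof -
      have Vp: "V \<subseteq> points (wproj w)" using V DZ Z' by blast
      have Dp: "{P \<in> D. \<pi> P \<in> V} \<subseteq> points (wproj q)" using DZ Z by blast
      show ?thesis
        unfolding Y_def regular_wproj_sub_iff[OF Vp]
      proof (intro allI impI)
        fix x assume x: "x \<noteq> 0" "wpt w x \<in> V"
        then obtain y where y: "y \<in> tor" "x = monmap E y" "wpt q y \<in> D" "\<pi> (wpt q y) = wpt w x"
          using lift V by blast
        have yV: "wpt q y \<in> {P \<in> D. \<pi> P \<in> V}" using x y by simp
        obtain a b where ab: "polyfun a" "polyfun b" "b y \<noteq> 0"
          "\<forall>z. z \<noteq> 0 \<longrightarrow> wpt q z \<in> {P \<in> D. \<pi> P \<in> V} \<longrightarrow> (f \<circ> \<pi>) (wpt q z) * b z = a z"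
          using reg[unfolded X_def regular_wproj_sub_iff[OF Dp], rule_format,
              OF tor_nonzero[OF y(1)] yV] by blast
        obtain \<alpha> \<beta> where \<beta>: "polyfun \<alpha>" "polyfun \<beta>" "\<beta> (monmap E y) \<noteq> 0"
          "\<forall>z\<in>tor. \<forall>u v. (\<forall>t\<in>tor. monmap E t = 1 \<longrightarrow> u * a (t * z) + v * b (t * z) = 0) \<longrightarrow>
             u * \<alpha> (monmap E z) + v * \<beta> (monmap E z) = 0"
          by (rule monomial_descent[OF chars ab(1-3) y(1)]) (assumption, rule that)
        have "f (wpt w x') * \<beta> x' = \<alpha> x'" if x': "wpt w x' \<in> V" for x'
        proof -
          obtain z where z: "z \<in> tor" "x' = monmap E z" "wpt q z \<in> D" "\<pi> (wpt q z) = wpt w x'"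
            using lift[of x'] V x' by blast
          \<comment> \<open>All \<open>t * z\<close> lie over the same point of the target, so
            \<open>f\<close> takes one value there, which serves as \<open>v\<close>.\<close>
          have "- 1 * a (t * z) + f (wpt w x') * b (t * z) = 0"
            if t: "t \<in> tor" "monmap E t = 1" for t
          proof -
            have tz: "t * z \<in> tor" "wpt q (t * z) \<in> Z"
              using cone[of "t * z"] cone[of z] z t memD by (simp_all add: mult_in_tor twist)
            have \<pi>tz: "\<pi> (wpt q (t * z)) = wpt w x'" using \<pi>[OF tz] z(2) t(2) by (simp add: twist)
            then have "wpt q (t * z) \<in> {P \<in> D. \<pi> P \<in> V}" using tz x' memD by simp
            from ab(4)[rule_format, OF tor_nonzero[OF tz(1)] this] \<pi>tz show ?thesis by simp
          qed
          then have "- 1 * \<alpha> (monmap E z) + f (wpt w x') * \<beta> (monmap E z) = 0"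
            by (intro \<beta>(4)[rule_format, OF z(1)]) blast
          then show ?thesis by (simp add: z(2))
        qed
        then show "\<exists>a b. polyfun a \<and> polyfun b \<and> b x \<noteq> 0 \<and>
            (\<forall>y. y \<noteq> 0 \<longrightarrow> wpt w y \<in> V \<longrightarrow> f (wpt w y) * b y = a y)"
          using \<beta>(1-3) y(2) by blast
      qed
    qed
  qed
qed

section \<open>Diagonal automorphisms\<close>

text \<open>The diagonal map as a point of the torus: acting becomes coordinatewise multiplication,
  with which \<open>lmon\<close> and \<open>monmap\<close> commute.\<close>

definition dvec :: "complex \<Rightarrow> ('n::finite \<Rightarrow> int) \<Rightarrow> complex ^ 'n" where
  "dvec \<zeta> k = (\<chi> i. \<zeta> powi k i)"

lemma dvec_nth: "dvec \<zeta> k $ i = \<zeta> powi k i"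
  by (simp add: dvec_def)

lemma gmap_wpt_dvec: "gmap q \<zeta> k (wpt q x) = wpt q (dvec \<zeta> k * x)"
proof -
  have "(\<chi> i. \<zeta> powi k i * x $ i) = dvec \<zeta> k * x" by (simp add: vec_eq_iff dvec_def)
  then show ?thesis by (simp add: gmap_wpt)
qed

lemma dvec_in_tor: "\<zeta> \<noteq> 0 \<Longrightarrow> dvec \<zeta> k \<in> tor"
  by (simp add: dvec_def tor_def)

lemma lmon_dvec: "\<zeta> \<noteq> 0 \<Longrightarrow> lmon m (dvec \<zeta> k) = \<zeta> powi (\<Sum>i\<in>UNIV. m i * k i)"
  by (simp add: lmon_def dvec_def power_int_mult [symmetric] power_int_sum mult.commute)

lemma tor_mult_nonzero: "t \<in> tor \<Longrightarrow> t * y = 0 \<longleftrightarrow> y = 0"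
  by (simp add: tor_def vec_eq_iff)

lemma morphism_gmap:
  assumes "\<zeta> \<noteq> 0" "Z \<subseteq> points (wproj q)"
    and "\<And>y. y \<noteq> 0 \<Longrightarrow> wpt q y \<in> Z \<Longrightarrow> wpt q (dvec \<zeta> k * y) \<in> Z"
  shows "morphism (sub_fspace (wproj q) Z) (sub_fspace (wproj q) Z) (gmap q \<zeta> k)"
proof -
  let ?X = "sub_fspace (wproj q) Z"
  have pts: "points ?X = Z" using assms(2) by (auto simp: zar_sub_fspace)
  have "openin (zar ?X) Z" using openin_topspace[of "zar ?X"] unfolding pts .
  moreover have "\<exists>a' b'. polyfun a' \<and> polyfun b' \<and> (\<forall>y. y \<noteq> 0 \<longrightarrow> wpt q y \<in> Z \<longrightarrow>
      (\<exists>s. s \<noteq> 0 \<and> a' y = s * a (dvec \<zeta> k * y) \<and> b' y = s * b (dvec \<zeta> k * y)))"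
    if "polyfun a" "polyfun b" for a b
  proof -
    have "polyfun (\<lambda>x. (dvec \<zeta> k * x) $ j)" for j
      unfolding vector_mult_component by (intro polyfun_mult polyfun_const polyfun_coord)
    then have "polyfun (\<lambda>y. a (dvec \<zeta> k * y))" "polyfun (\<lambda>y. b (dvec \<zeta> k * y))"
      using polyfun_comp that by blast+
    then show ?thesis
      by (intro exI[of _ "\<lambda>y. a (dvec \<zeta> k * y)"] exI[of _ "\<lambda>y. b (dvec \<zeta> k * y)"] conjI allI impI
          exI[of _ 1]) simp_all
  qed
  ultimately have "morphism (sub_fspace ?X Z) ?X (gmap q \<zeta> k)"
    by (intro morphism_wprojI[OF assms(2,2)]) (use assms(3) gmap_wpt_dvec in blast)+
  then show ?thesis
    by (rule sub_fspace_points_iff[OF sheaf_like_sub_fspace[OF sheaf_like_wproj, of q Z],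
        unfolded pts, THEN iffD1])
qed

lemma action_hom:
  assumes "group G" "sheaf_like X"
    and "\<And>k. k \<in> carrier G \<Longrightarrow> morphism X X (T k)"
    and mult: "\<And>k l x. k \<in> carrier G \<Longrightarrow> l \<in> carrier G \<Longrightarrow> x \<in> points X \<Longrightarrow>
      T (k \<otimes>\<^bsub>G\<^esub> l) x = T k (T l x)"
    and one: "\<And>x. x \<in> points X \<Longrightarrow> T \<one>\<^bsub>G\<^esub> x = x"
  shows "(\<lambda>k. restrict (T k) (points X)) \<in> hom G (aut_group X)"
proof -
  interpret group G by fact
  have maps: "T k x \<in> points X" if "k \<in> carrier G" "x \<in> points X" for k x
    using assms(3)[OF that(1)] that(2) by (auto simp: morphism_def continuous_map_def Pi_def)
  have inv: "T (inv\<^bsub>G\<^esub> k) (T k x) = x" "T k (T (inv\<^bsub>G\<^esub> k) x) = x"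
    if "k \<in> carrier G" "x \<in> points X" for k x
    using that mult[of "inv\<^bsub>G\<^esub> k" k x] mult[of k "inv\<^bsub>G\<^esub> k" x] one by simp_all
  have car: "restrict (T k) (points X) \<in> carrier (aut_group X)" if k: "k \<in> carrier G" for k
  proof -
    have "bij_betw (T k) (points X) (points X)"
      by (rule bij_betwI[where g = "T (inv\<^bsub>G\<^esub> k)"]) (use k maps inv in auto)
    then have "restrict (T k) (points X) \<in> Bij (points X)" by (simp add: Bij_def)
    moreover have "isomorphism X X (restrict (T k) (points X))"
      unfolding isomorphism_def
    proof (intro conjI exI[of _ "T (inv\<^bsub>G\<^esub> k)"] ballI)
      show "morphism X X (restrict (T k) (points X))"
        by (rule morphism_cong[OF assms(2) assms(3)[OF k]]) simp
      show "morphism X X (T (inv\<^bsub>G\<^esub> k))" using assms(3) k by simp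
    qed (use k maps inv in auto)
    ultimately show ?thesis by (simp add: aut_group_carrier)
  qed
  show ?thesis
    by (rule homI) (use car in \<open>auto simp: aut_group_mult mult maps compose_def fun_eq_iff\<close>)
qed

text \<open>Elements of the factor group are cosets as sets, and \<open>h\<close> is constant on a
  coset because \<open>N\<close> lies in its kernel; \<open>descend h\<close> is thus the map given
  by the universal property.\<close>

lemma descend_FactGroup:
  assumes "group_hom G H h" "N \<lhd> G" "N \<subseteq> kernel G H h"
  shows "x \<in> carrier G \<Longrightarrow> descend h (N #>\<^bsub>G\<^esub> x) = h x"
    and "descend h \<in> hom (G Mod N) H"
proof -
  interpret group_hom G H h by fact
  interpret normal N G by fact
  show eq: "descend h (N #>\<^bsub>G\<^esub> x) = h x" if x: "x \<in> carrier G" for x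
  proof (rule descend_eq)
    show "x \<in> N #>\<^bsub>G\<^esub> x" by (rule G.rcos_self[OF x subgroup_axioms])
    fix y assume "y \<in> N #>\<^bsub>G\<^esub> x"
    then obtain n where n: "n \<in> N" "y = n \<otimes>\<^bsub>G\<^esub> x" by (auto simp: r_coset_def)
    then have "n \<in> carrier G" "h n = \<one>\<^bsub>H\<^esub>" using assms(3) by (auto simp: kernel_def)
    then show "h y = h x" using n x by simp
  qed
  obtain g where g: "g \<in> hom (G Mod N) H" "\<And>x. x \<in> carrier G \<Longrightarrow> g (N #>\<^bsub>G\<^esub> x) = h x"
    using FactGroup_universal_kernel[OF assms(2,3)] by blast
  interpret F: group "G Mod N" by (rule factorgroup_is_group)
  have "descend h C = g C" if "C \<in> carrier (G Mod N)" for C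
    using that eq g(2) by (auto simp: FactGroup_def RCOSETS_def)
  then show "descend h \<in> hom (G Mod N) H"
    using g(1) F.m_closed by (auto simp: hom_def Pi_def)
qed

section \<open>The exponent matrix\<close>

lemma sum_UNIV_option:
  fixes f :: "'a::finite option \<Rightarrow> 'b::comm_monoid_add"
  shows "(\<Sum>r\<in>UNIV. f r) = f None + (\<Sum>i\<in>UNIV. f (Some i))"
  by (simp add: UNIV_option_conv sum.reindex)

lemma lmon_single: "lmon (\<lambda>k. if k = i then e else 0) x = x $ i powi e"
proof -
  have "lmon (\<lambda>k. if k = i then e else 0) x = (\<Prod>k\<in>UNIV. if k = i then x $ k powi e else 1)"
    unfolding lmon_def by (intro prod.cong) auto
  then show ?thesis by simp
qed

section \<open>Denominators and duality modulo d\<close>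

lemma common_denominator:
  fixes f :: "'a::finite \<Rightarrow> rat"
  shows "\<exists>D::nat. 0 < D \<and> (\<forall>i. of_nat D * f i \<in> \<int>)"
proof -
  have "\<exists>n::nat. 0 < n \<and> of_nat n * r \<in> \<int>" for r :: rat
  proof -
    obtain p s where ps: "quotient_of r = (p, s)" by force
    then have "s > 0" by (rule quotient_of_denom_pos)
    moreover have "r = of_int p / of_int s" by (rule quotient_of_div[OF ps])
    ultimately have "of_nat (nat s) * r = of_int p" "0 < nat s" by simp_all
    then show ?thesis by (metis Ints_of_int)
  qed
  then have "\<forall>i. \<exists>n::nat. 0 < n \<and> of_nat n * f i \<in> \<int>" by blast
  then obtain n :: "'a \<Rightarrow> nat" where n: "\<And>i. 0 < n i" "\<And>i. of_nat (n i) * f i \<in> \<int>" by metis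
  have "of_nat (\<Prod>i\<in>UNIV. n i) * f i \<in> \<int>" for i
  proof -
    have "n i dvd (\<Prod>i\<in>UNIV. n i)" by (rule dvd_prodI) auto
    then obtain m where "(\<Prod>i\<in>UNIV. n i) = m * n i" by (metis dvd_def mult.commute)
    then have "of_nat (\<Prod>i\<in>UNIV. n i) * f i = of_nat m * (of_nat (n i) * f i)" by simp
    then show ?thesis using n(2)[of i] by (metis Ints_mult Ints_of_nat)
  qed
  then show ?thesis using n(1) by (intro exI[of _ "\<Prod>i\<in>UNIV. n i"]) (simp add: prod_pos)
qed

text \<open>This is the gcd of \<open>d\<close> and all \<open>f j\<close> together with Bezout
  coefficients. The coefficients are needed explicitly: they prove duality modulo \<open>d\<close>,
  and later they realize a prescribed root of unity as a value of a monomial.\<close>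

lemma bezout_family:
  fixes f :: "'a \<Rightarrow> int"
  assumes "finite S"
  shows "\<exists>g k l. 0 \<le> g \<and> g dvd d \<and> (\<forall>j\<in>S. g dvd f j) \<and> g = (\<Sum>j\<in>S. k j * f j) + d * l"
  using assms
proof (induction S rule: finite_induct)
  case empty
  have "d * sgn d = \<bar>d\<bar>" by (simp add: abs_sgn)
  then show ?case by (intro exI[of _ "\<bar>d\<bar>"] exI[of _ "\<lambda>_. 0"] exI[of _ "sgn d"]) auto
next
  case (insert a S)
  then obtain g k l where g: "0 \<le> g" "g dvd d" "\<forall>j\<in>S. g dvd f j" "g = (\<Sum>j\<in>S. k j * f j) + d * l"
    by blast
  obtain u v where uv: "u * f a + v * g = gcd (f a) g" using bezout_int by blast
  have "(\<Sum>j\<in>insert a S. (if j = a then u else v * k j) * f j) = u * f a + v * (\<Sum>j\<in>S. k j * f j)"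
  proof -
    have "(\<Sum>j\<in>S. (if j = a then u else v * k j) * f j) = (\<Sum>j\<in>S. v * (k j * f j))"
      using insert.hyps by (intro sum.cong) auto
    then show ?thesis using insert.hyps by (simp add: sum_distrib_left)
  qed
  then have h1: "gcd (f a) g = (\<Sum>j\<in>insert a S. (if j = a then u else v * k j) * f j) + d * (v * l)"
    using uv g(4) by (simp add: algebra_simps)
  have h2: "gcd (f a) g dvd d" using g(2) by (metis dvd_trans gcd_dvd2)
  have h3: "\<forall>j\<in>insert a S. gcd (f a) g dvd f j" using g(3) by (metis dvd_trans gcd_dvd1 gcd_dvd2 insert_iff)
  show ?case
    by (intro exI[of _ "gcd (f a) g"] exI[of _ "\<lambda>j. if j = a then u else v * k j"] exI[of _ "v * l"]
        conjI gcd_ge_0_int h1 h2 h3)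
qed

text \<open>Duality over Z/d: the annihilator of the annihilator of a vector \<open>f\<close>
  consists of the multiples of \<open>f\<close>.\<close>

lemma double_annihilator:
  fixes f m :: "'a::finite \<Rightarrow> int"
  assumes "d \<noteq> 0" and "\<And>k. d dvd (\<Sum>j\<in>UNIV. k j * f j) \<Longrightarrow> d dvd (\<Sum>j\<in>UNIV. k j * m j)"
  shows "\<exists>r. \<forall>j. d dvd m j - r * f j"
proof -
  obtain g k l where g: "0 \<le> g" "g dvd d" "\<forall>j. g dvd f j" "g = (\<Sum>j\<in>UNIV. k j * f j) + d * l"
    using bezout_family[of UNIV d f] by auto
  obtain e where e: "d = g * e" using g(2) by (elim dvdE)
  define p where "p j = f j div g" for j
  have p: "f j = g * p j" for j using g(3) by (simp add: p_def)
  define s where "s = (\<Sum>j\<in>UNIV. k j * m j)"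
  have kf: "(\<Sum>j\<in>UNIV. k j * f j) = g - d * l" using g(4) by simp
  \<comment> \<open>First test vector: \<open>e\<close> times the Bezout vector pairs with
    \<open>f\<close> to \<open>e * g = d\<close> up to a multiple of \<open>d\<close>. It yields
    \<open>g dvd s\<close>, hence the multiplier \<open>r = s / g\<close>.\<close>
  have "(\<Sum>j\<in>UNIV. (e * k j) * f j) = d * (1 - e * l)"
    unfolding mult.assoc sum_distrib_left[symmetric] kf using e by (simp add: algebra_simps)
  then have "d dvd (\<Sum>j\<in>UNIV. (e * k j) * m j)" by (intro assms(2)) simp
  then have "g * e dvd e * s" by (simp add: s_def sum_distrib_left mult.assoc e)
  then have "g dvd s" using assms(1) e by (simp add: mult.commute[of e])
  then obtain r where r: "s = g * r" by (elim dvdE)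
  have "d dvd m j - r * f j" for j
  proof -
    \<comment> \<open>Second test vector: the unit vector at \<open>j\<close>, corrected by the
      multiple of the Bezout vector that makes its pairing with \<open>f\<close> divisible by
      \<open>d\<close>. Its pairing with \<open>m\<close> is exactly
      \<open>m j - r * f j\<close>.\<close>
    let ?k = "\<lambda>i. (if i = j then 1 else 0) - p j * k i"
    have expand: "(\<Sum>i\<in>UNIV. ?k i * h i) = h j - p j * (\<Sum>i\<in>UNIV. k i * h i)" for h :: "'a \<Rightarrow> int"
      by (simp add: left_diff_distrib sum_subtractf sum_distrib_left mult.assoc if_distrib[of "\<lambda>x. x * _"] cong: if_cong)
    have "(\<Sum>i\<in>UNIV. ?k i * f i) = d * (p j * l)"
      unfolding expand kf p[of j] by (simp add: algebra_simps)
    then have "d dvd (\<Sum>i\<in>UNIV. ?k i * m i)" by (intro assms(2)) simp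
    then show ?thesis unfolding expand s_def[symmetric] r p by (simp add: algebra_simps)
  qed
  then show ?thesis by blast
qed

section \<open>Identities between the exponent matrix, its inverse and the weights\<close>

locale exponent_matrix =
  fixes A :: "nat ^ 'n ^ 'n::finite"
  assumes det: "det (map_matrix of_nat A :: rat ^ 'n ^ 'n) \<noteq> 0"
    and sum_Ainv: "(\<Sum>i\<in>UNIV. (Ainv A *v vec 1) $ i) = 1"
begin

abbreviation "d \<equiv> dnum A"
abbreviation "B \<equiv> \<lambda>j k. Bmat A $ j $ k"
abbreviation "a \<equiv> \<lambda>i j. int (A $ i $ j)"
abbreviation "q \<equiv> qwt A"
abbreviation "q' \<equiv> \<lambda>k. qwt' A $ k"

lemma Ainv_inverse:
  "map_matrix of_nat A ** Ainv A = mat 1" "Ainv A ** map_matrix of_nat A = mat 1"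
proof -
  have "\<exists>X. map_matrix of_nat A ** X = mat 1 \<and> X ** map_matrix of_nat A = (mat 1 :: rat ^ 'n ^ 'n)"
    using det by (simp add: invertible_det_nz[symmetric] invertible_def)
  from someI_ex[OF this]
  show "map_matrix of_nat A ** Ainv A = mat 1" "Ainv A ** map_matrix of_nat A = mat 1"
    by (simp_all add: Ainv_def matrix_inv_def)
qed

lemma dnum: "0 < d" "of_nat d * Ainv A $ i $ j \<in> \<int>"
proof -
  obtain D :: nat where D: "0 < D" "\<forall>p. of_nat D * (Ainv A $ fst p $ snd p) \<in> \<int>"
    using common_denominator[of "\<lambda>p. Ainv A $ fst p $ snd p"] by blast
  then have "\<exists>d::nat. 0 < d \<and> (\<forall>i j. of_nat d * Ainv A $ i $ j \<in> \<int>)" by auto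
  from LeastI_ex[OF this] show "0 < d" "of_nat d * Ainv A $ i $ j \<in> \<int>"
    by (simp_all add: dnum_def)
qed

lemma of_int_B: "of_int (B i j) = of_nat d * Ainv A $ i $ j"
  using dnum(2)[of i j] by (simp add: Bmat_def)

lemma AB: "(\<Sum>k\<in>UNIV. a i k * B k j) = (if i = j then int d else 0)"
proof -
  have "(\<Sum>k\<in>UNIV. of_nat (A $ i $ k) * Ainv A $ k $ j) = (if i = j then 1 else 0)"
    using arg_cong[OF Ainv_inverse(1), of "\<lambda>X. X $ i $ j"]
    by (simp add: matrix_matrix_mult_def mat_def)
  then have "of_nat d * (\<Sum>k\<in>UNIV. of_nat (A $ i $ k) * Ainv A $ k $ j) = (if i = j then of_nat d else 0)"
    by simp
  then have "of_int (\<Sum>k\<in>UNIV. a i k * B k j) = (of_int (if i = j then int d else 0) :: rat)"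
    by (simp add: of_int_B sum_distrib_left mult_ac)
  then show ?thesis by (simp only: of_int_eq_iff)
qed

lemma BA: "(\<Sum>k\<in>UNIV. B i k * a k j) = (if i = j then int d else 0)"
proof -
  have "(\<Sum>k\<in>UNIV. Ainv A $ i $ k * of_nat (A $ k $ j)) = (if i = j then 1 else 0)"
    using arg_cong[OF Ainv_inverse(2), of "\<lambda>X. X $ i $ j"]
    by (simp add: matrix_matrix_mult_def mat_def)
  then have "of_nat d * (\<Sum>k\<in>UNIV. Ainv A $ i $ k * of_nat (A $ k $ j)) = (if i = j then of_nat d else 0)"
    by simp
  then have "of_int (\<Sum>k\<in>UNIV. B i k * a k j) = (of_int (if i = j then int d else 0) :: rat)"
    by (simp add: of_int_B sum_distrib_left mult_ac)
  then show ?thesis by (simp only: of_int_eq_iff)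
qed

lemma qwt_eq: "q $ j = (\<Sum>k\<in>UNIV. B j k)"
  by (simp add: qwt_def matrix_vector_mult_def)

lemma qwt'_eq: "q' k = (\<Sum>j\<in>UNIV. B j k)"
  by (simp add: qwt'_def matrix_vector_mult_def transpose_def)

lemma sum_qwt: "(\<Sum>j\<in>UNIV. q $ j) = int d"
proof -
  have "of_int (\<Sum>j\<in>UNIV. q $ j) = (of_nat d * (\<Sum>i\<in>UNIV. (Ainv A *v vec 1) $ i) :: rat)"
    by (simp add: qwt_eq of_int_B matrix_vector_mult_def sum_distrib_left)
  then have "of_int (\<Sum>j\<in>UNIV. q $ j) = (of_int (int d) :: rat)" unfolding sum_Ainv by simp
  then show ?thesis by (simp only: of_int_eq_iff)
qed

lemma sum_qwt': "(\<Sum>k\<in>UNIV. q' k) = int d"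
  unfolding sum_qwt[symmetric] qwt'_eq qwt_eq by (rule sum.swap)

text \<open>From \<open>A B e = d e\<close>, with \<open>e\<close> the all-ones vector: every
  monomial of F_A has the same weighted degree \<open>d\<close>.\<close>

lemma A_qwt: "(\<Sum>j\<in>UNIV. a i j * q $ j) = int d"
proof -
  have "(\<Sum>j\<in>UNIV. a i j * q $ j) = (\<Sum>k\<in>UNIV. \<Sum>j\<in>UNIV. a i j * B j k)"
    unfolding qwt_eq sum_distrib_left by (rule sum.swap)
  then show ?thesis by (simp add: AB)
qed

lemma qwt'_A: "(\<Sum>k\<in>UNIV. q' k * a k j) = int d"
proof -
  have "(\<Sum>k\<in>UNIV. q' k * a k j) = (\<Sum>i\<in>UNIV. \<Sum>k\<in>UNIV. B i k * a k j)"
    unfolding qwt'_eq sum_distrib_right by (rule sum.swap)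
  then show ?thesis by (simp add: BA)
qed

definition E :: "'n option \<Rightarrow> 'n \<Rightarrow> int" where
  "E r j = (case r of None \<Rightarrow> 1 | Some i \<Rightarrow> a i j)"

lemma E_simps [simp]: "E None = (\<lambda>_. 1)" "E (Some i) = a i"
  by (simp_all add: E_def fun_eq_iff)

lemma phi_coords_eq: "phi_coords A = monmap B"
  by (simp add: fun_eq_iff phi_coords_def vec_eq_iff lmon_def)

lemma q_coords_eq: "q_coords A = monmap E"
proof
  fix x
  have "q_coords A x $ r = monmap E x $ r" for r
    by (cases r) (simp_all add: q_coords_def lmon_def)
  then show "q_coords A x = monmap E x" by (simp add: vec_eq_iff)
qed

lemma Fpoly_eq: "Fpoly A x = (\<Sum>i\<in>UNIV. lmon (a i) x)"
  by (simp add: Fpoly_def lmon_def)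

lemma lmon_A_phi: "y \<in> tor \<Longrightarrow> lmon (a i) (monmap B y) = (y $ i) ^ d"
  unfolding lmon_monmap AB using lmon_single[of i "int d" y] by (simp add: eq_commute[of i])

lemma lmon_1_phi: "y \<in> tor \<Longrightarrow> lmon (\<lambda>_. 1) (monmap B y) = lmon q' y"
  unfolding lmon_monmap qwt'_eq by simp

lemma Fpoly_phi: "y \<in> tor \<Longrightarrow> Fpoly A (monmap B y) = (\<Sum>i\<in>UNIV. (y $ i) ^ d)"
  by (simp add: Fpoly_eq lmon_A_phi)

lemma phi_surj:
  assumes "x \<in> tor" shows "\<exists>y\<in>tor. x = monmap B y"
proof -
  \<comment> \<open>In logarithms the equation reads \<open>B log y = log x\<close>; since
    \<open>B A = d\<close>, it is solved by \<open>log y = A log x / d\<close>. The choice of branch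
    does not matter.\<close>
  define y :: "complex ^ 'n" where
    "y = (\<chi> k. exp ((\<Sum>i\<in>UNIV. of_int (a k i) * Ln (x $ i)) / of_nat d))"
  have "lmon (B j) y = x $ j" for j
  proof -
    have "lmon (B j) y
        = (\<Prod>k\<in>UNIV. exp (of_int (B j k) * ((\<Sum>i\<in>UNIV. of_int (a k i) * Ln (x $ i)) / of_nat d)))"
      unfolding lmon_def y_def by (simp add: exp_power_int)
    also have "\<dots> = exp (\<Sum>k\<in>UNIV. of_int (B j k) * ((\<Sum>i\<in>UNIV. of_int (a k i) * Ln (x $ i)) / of_nat d))"
      by (rule exp_sum[symmetric]) simp
    also have "(\<Sum>k\<in>UNIV. of_int (B j k) * ((\<Sum>i\<in>UNIV. of_int (a k i) * Ln (x $ i)) / of_nat d))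
        = (\<Sum>k\<in>UNIV. \<Sum>i\<in>UNIV. of_int (B j k * a k i) * (Ln (x $ i) / of_nat d))"
      by (simp add: sum_distrib_left sum_divide_distrib mult_ac)
    also have "\<dots> = (\<Sum>i\<in>UNIV. \<Sum>k\<in>UNIV. of_int (B j k * a k i) * (Ln (x $ i) / of_nat d))"
      by (rule sum.swap)
    also have "\<dots> = (\<Sum>i\<in>UNIV. of_int (if j = i then int d else 0) * (Ln (x $ i) / of_nat d))"
      unfolding BA[symmetric] of_int_sum sum_distrib_right ..
    also have "\<dots> = (\<Sum>i\<in>UNIV. if j = i then Ln (x $ i) else 0)"
      using dnum(1) by (intro sum.cong) auto
    also have "\<dots> = Ln (x $ j)" by simp
    finally show ?thesis using assms by (simp add: tor_def)
  qed
  then have "x = monmap B y" by (simp add: vec_eq_iff)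
  moreover have "y \<in> tor" by (simp add: y_def tor_def)
  ultimately show ?thesis by blast
qed

lemma phi_wscale: "c \<noteq> 0 \<Longrightarrow> monmap B (wscale (vec 1) c y) = wscale q c (monmap B y)"
  using phi_coords_wscale[of c A y] by (simp add: phi_coords_eq)

lemma E_wscale: "c \<noteq> 0 \<Longrightarrow> monmap E (wscale q c x) = wscale (vec 1) (c ^ d) (monmap E x)"
proof -
  assume c: "c \<noteq> 0"
  have "monmap E (wscale q c x) $ r = wscale (vec 1) (c ^ d) (monmap E x) $ r" for r
    by (cases r) (simp_all add: lmon_wscale[OF c] sum_qwt A_qwt wscale_nth)
  then show ?thesis by (simp add: vec_eq_iff)
qed

lemma Fpoly_wscale: "c \<noteq> 0 \<Longrightarrow> Fpoly A (wscale q c x) = c ^ d * Fpoly A x"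
  by (simp add: Fpoly_eq lmon_wscale A_qwt sum_distrib_left)

lemma qA_wpt: "qA A (wpt q x) = wpt (vec 1) (monmap E x)"
  unfolding qA_def q_coords_eq by (intro descend_wpt) (simp add: E_wscale wpt_wscale)

end

section \<open>Roots of unity and the characters trivial on the kernels\<close>

locale exponent_matrix_root = exponent_matrix A for A :: "nat ^ 'n ^ 'n::finite" +
  fixes \<zeta> :: complex
  assumes prim: "primitive_root_of_unity (dnum A) \<zeta>"
begin

lemma root: "\<zeta> \<noteq> 0" "\<zeta> ^ d = 1"
  using prim by (auto simp: primitive_root_of_unity_def power_0_left)

lemma root_powi_eq_1: "\<zeta> powi e = 1 \<longleftrightarrow> int d dvd e"
proof -
  have "\<zeta> powi e = \<zeta> powi (int d * (e div int d) + e mod int d)" by simp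
  also have "\<dots> = \<zeta> powi (int d * (e div int d)) * \<zeta> powi (e mod int d)"
    by (rule power_int_add) (simp add: root)
  also have "\<dots> = (\<zeta> powi int d) powi (e div int d) * \<zeta> powi (e mod int d)"
    by (simp only: power_int_mult)
  also have "\<dots> = \<zeta> ^ nat (e mod int d)"
    using dnum(1) root(2) by (simp add: power_int_def)
  finally have eq: "\<zeta> powi e = \<zeta> ^ nat (e mod int d)" .
  have "nat (e mod int d) < d" using dnum(1) by (simp add: nat_less_iff)
  then have "\<zeta> ^ nat (e mod int d) = 1 \<longleftrightarrow> nat (e mod int d) = 0"
    using prim unfolding primitive_root_of_unity_def by (metis neq0_conv power_0)
  then show ?thesis
    using eq dnum(1) by (auto simp: dvd_eq_mod_eq_0 pos_mod_sign intro: antisym)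
qed

lemma root_powi_cong: "int d dvd e - e' \<Longrightarrow> \<zeta> powi e = \<zeta> powi e'"
  using root_powi_eq_1[of "e - e'"] root(1) by (simp add: power_int_diff)

text \<open>By counting: primitivity makes the \<open>d\<close> powers of \<open>\<zeta>\<close>
  distinct, and \<open>z ^ d = 1\<close> has exactly \<open>d\<close> complex solutions.\<close>

lemma root_of_unity_powi:
  assumes "t ^ d = 1" shows "\<exists>e. 0 \<le> e \<and> e < int d \<and> t = \<zeta> powi e"
proof -
  have inj: "inj_on (\<lambda>e. \<zeta> ^ e) {..<d}"
  proof (rule inj_onI)
    fix i j assume ij: "i \<in> {..<d}" "j \<in> {..<d}" "\<zeta> ^ i = \<zeta> ^ j"
    then have "\<zeta> powi (int i - int j) = 1" using root(1) by (simp add: power_int_diff)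
    then have "int d dvd int i - int j" by (simp add: root_powi_eq_1)
    then show "i = j" using dvd_imp_le_int[of "int i - int j" "int d"] ij by force
  qed
  have "(\<lambda>e. \<zeta> ^ e) ` {..<d} = {z. z ^ d = 1}"
  proof (rule card_subset_eq)
    show "finite {z::complex. z ^ d = 1}" using dnum(1) by (intro finite_roots_unity) simp
    have "(\<zeta> ^ e) ^ d = 1" for e by (metis power_mult mult.commute power_one root(2))
    then show "(\<lambda>e. \<zeta> ^ e) ` {..<d} \<subseteq> {z. z ^ d = 1}" by auto
    show "card ((\<lambda>e. \<zeta> ^ e) ` {..<d}) = card {z::complex. z ^ d = 1}"
      using card_image[OF inj] card_roots_unity_eq[OF dnum(1)] by simp
  qed
  with assms obtain e where "e < d" "t = \<zeta> ^ e" by blast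
  then show ?thesis by (intro exI[of _ "int e"]) simp
qed

lemma roots_of_unity_dvec:
  assumes "\<And>i. (t $ i) ^ d = 1"
  obtains k where "\<And>i. 0 \<le> k i" "\<And>i. k i < int d" "t = dvec \<zeta> k"
proof -
  obtain k where "\<And>i. 0 \<le> k i \<and> k i < int d \<and> t $ i = \<zeta> powi k i"
    using root_of_unity_powi[OF assms] by metis
  then show thesis by (intro that[of k]) (auto simp: vec_eq_iff dvec_def)
qed

lemma dvec_cong: "(\<And>i. int d dvd k i - k' i) \<Longrightarrow> dvec \<zeta> k = dvec \<zeta> k'"
  by (auto simp: dvec_def vec_eq_iff intro: root_powi_cong)

lemma phi_dvec: "monmap B (dvec \<zeta> k) = dvec \<zeta> (Bvec A k)"
  by (simp add: vec_eq_iff lmon_dvec root(1) Bvec_def dvec_nth)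

lemma sum_Bvec: "(\<Sum>j\<in>UNIV. Bvec A k j) = (\<Sum>i\<in>UNIV. k i * q' i)"
  unfolding Bvec_def qwt'_eq by (subst sum.swap) (simp add: sum_distrib_left mult.commute)

lemma A_Bvec: "(\<Sum>j\<in>UNIV. a i j * Bvec A k j) = int d * k i"
proof -
  have "(\<Sum>j\<in>UNIV. a i j * Bvec A k j) = (\<Sum>l\<in>UNIV. (\<Sum>j\<in>UNIV. a i j * B j l) * k l)"
    unfolding Bvec_def sum_distrib_left sum_distrib_right mult.assoc by (rule sum.swap)
  then show ?thesis by (simp add: AB if_distrib[of "\<lambda>x. x * _"] cong: if_cong)
qed

lemma E_dvec_Bvec:
  assumes "int d dvd (\<Sum>i\<in>UNIV. k i * q' i)"
  shows "monmap E (dvec \<zeta> (Bvec A k)) = 1"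
proof -
  have "monmap E (dvec \<zeta> (Bvec A k)) $ r = 1" for r
    using assms by (cases r) (simp_all add: lmon_dvec root(1) sum_Bvec A_Bvec root_powi_eq_1)
  then show ?thesis by (simp add: vec_eq_iff)
qed

lemma lmon_A_dvec_Bvec: "lmon (a i) (dvec \<zeta> (Bvec A k)) = 1"
  by (simp add: lmon_dvec root(1) A_Bvec root_powi_eq_1)

text \<open>By \<open>B A = d\<close> the columns of \<open>A\<close>, as exponents of
  \<open>\<zeta>\<close>, give points of the kernel. A character trivial on them satisfies
  \<open>m A = d r\<close> for an integral \<open>r\<close>, and multiplying by \<open>B\<close> on
  the right gives \<open>m = r B\<close> because \<open>A B = d\<close>.\<close>

lemma phi_chars:
  assumes "\<And>t. t \<in> tor \<Longrightarrow> monmap B t = 1 \<Longrightarrow> lmon m t = 1"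
  shows "\<exists>r. \<forall>k. m k = (\<Sum>j\<in>UNIV. r j * B j k)"
proof -
  have "int d dvd (\<Sum>k\<in>UNIV. m k * a k j)" for j
  proof -
    let ?t = "dvec \<zeta> (\<lambda>k. a k j)"
    have "monmap B ?t = 1"
      by (simp add: vec_eq_iff lmon_dvec root(1) BA root_powi_eq_1)
    then have "lmon m ?t = 1" by (rule assms[OF dvec_in_tor[OF root(1)]])
    then show ?thesis by (simp add: lmon_dvec root(1) root_powi_eq_1)
  qed
  then have "\<forall>j. \<exists>r. (\<Sum>k\<in>UNIV. m k * a k j) = int d * r" by (simp add: dvd_def)
  then obtain r where r: "\<And>j. (\<Sum>k\<in>UNIV. m k * a k j) = int d * r j" by metis
  have "m k = (\<Sum>j\<in>UNIV. r j * B j k)" for k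
  proof -
    have "int d * (\<Sum>j\<in>UNIV. r j * B j k) = (\<Sum>j\<in>UNIV. \<Sum>i\<in>UNIV. m i * a i j * B j k)"
      by (simp add: sum_distrib_left mult.assoc[symmetric] r[symmetric] sum_distrib_right)
    also have "\<dots> = (\<Sum>i\<in>UNIV. m i * (\<Sum>j\<in>UNIV. a i j * B j k))"
      by (subst sum.swap) (simp add: sum_distrib_left mult.assoc)
    also have "\<dots> = int d * m k" 
      unfolding AB by (simp add: if_distrib[of "\<lambda>x. _ * x"] mult.commute[of "m k"] cong: if_cong)
    finally show ?thesis using dnum(1) by simp
  qed
  then show ?thesis by blast
qed

text \<open>The points \<open>dvec \<zeta> (Bvec A k)\<close> with \<open>k . q' = 0\<close> mod
  \<open>d\<close> lie in the kernel, so \<open>m B\<close> annihilates the annihilator of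
  \<open>q'\<close>, and duality gives \<open>m B = r0 q' + d r\<close>. Multiplying by
  \<open>A\<close>, with \<open>B A = d\<close> and \<open>q' A = d e\<close>, yields
  \<open>m = r0 e + r A\<close>: the exponent of u_0 is \<open>r0\<close>.\<close>

lemma E_chars:
  assumes "\<And>t. t \<in> tor \<Longrightarrow> monmap E t = 1 \<Longrightarrow> lmon m t = 1"
  shows "\<exists>r. \<forall>k. m k = (\<Sum>j\<in>UNIV. r j * E j k)"
proof -
  let ?m = "\<lambda>l. \<Sum>j\<in>UNIV. m j * B j l"
  have "\<exists>r. \<forall>l. int d dvd ?m l - r * q' l"
  proof (rule double_annihilator)
    show "int d \<noteq> 0" using dnum(1) by simp
    fix k assume "int d dvd (\<Sum>j\<in>UNIV. k j * q' j)"
    then have "lmon m (dvec \<zeta> (Bvec A k)) = 1"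
      by (intro assms dvec_in_tor root E_dvec_Bvec)
    then have "int d dvd (\<Sum>j\<in>UNIV. m j * Bvec A k j)" by (simp add: lmon_dvec root(1) root_powi_eq_1)
    moreover have "(\<Sum>j\<in>UNIV. m j * Bvec A k j) = (\<Sum>l\<in>UNIV. k l * ?m l)"
      unfolding Bvec_def sum_distrib_left by (subst sum.swap) (simp add: mult_ac)
    ultimately show "int d dvd (\<Sum>l\<in>UNIV. k l * ?m l)" by simp
  qed
  then obtain r0 where r0: "\<And>l. int d dvd ?m l - r0 * q' l" by blast
  then have "\<forall>l. \<exists>r. ?m l - r0 * q' l = int d * r" by (simp add: dvd_def)
  then obtain r where r: "\<And>l. ?m l - r0 * q' l = int d * r l" by metis
  have "m k = r0 + (\<Sum>l\<in>UNIV. r l * a l k)" for k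
  proof -
    have "int d * m k = (\<Sum>j\<in>UNIV. m j * (\<Sum>l\<in>UNIV. B j l * a l k))"
      by (simp add: BA if_distrib[of "\<lambda>x. _ * x"] mult.commute cong: if_cong)
    also have "\<dots> = (\<Sum>l\<in>UNIV. ?m l * a l k)"
      unfolding sum_distrib_left sum_distrib_right by (subst sum.swap) (simp add: mult_ac)
    also have "\<dots> = (\<Sum>l\<in>UNIV. r0 * (q' l * a l k) + int d * (r l * a l k))"
    proof (intro sum.cong refl)
      fix l
      have "?m l = r0 * q' l + int d * r l" using r[of l] by simp
      then show "?m l * a l k = r0 * (q' l * a l k) + int d * (r l * a l k)"
        by (simp add: algebra_simps)
    qed
    also have "\<dots> = int d * (r0 + (\<Sum>l\<in>UNIV. r l * a l k))"
      unfolding sum.distrib sum_distrib_left[symmetric] qwt'_A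
      by (simp only: distrib_left mult.commute[of r0])
    finally show ?thesis using dnum(1) by simp
  qed
  then show ?thesis
    by (intro exI[of _ "case_option r0 r"]) (simp add: sum_UNIV_option)
qed

end

declare vec_1 [simp del]

section \<open>The Fermat variety\<close>

lemma complex_root_exists:
  fixes z :: complex
  assumes "z \<noteq> 0" "0 < n" shows "exp (Ln z / of_nat n) ^ n = z"
  using assms by (simp add: exp_of_nat_mult[symmetric])

definition fermat_cone :: "nat \<Rightarrow> (complex ^ 'n::finite) set set" where
  "fermat_cone d = {P \<in> points proj. \<forall>y\<in>P. (\<Sum>i\<in>UNIV. (y $ i) ^ d) = 0}"

lemma Fermat_eq: "Fermat d = sub_fspace proj (fermat_cone d)"
  by (simp add: Fermat_def fermat_cone_def)

lemma wscale_vec_1_nth: "wscale (vec 1) c y $ i = c * y $ i"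
  by (simp add: wscale_def)

lemma wpt_in_fermat_cone:
  "wpt (vec 1) y \<in> fermat_cone d \<longleftrightarrow> y \<noteq> 0 \<and> (\<Sum>i\<in>UNIV. (y $ i) ^ d) = 0"
proof -
  have "(\<Sum>i\<in>UNIV. (wscale (vec 1) c y $ i) ^ d) = c ^ d * (\<Sum>i\<in>UNIV. (y $ i) ^ d)" for c
    by (simp only: wscale_vec_1_nth power_mult_distrib sum_distrib_left)
  then have "(\<forall>x\<in>wpt (vec 1) y. (\<Sum>i\<in>UNIV. (x $ i) ^ d) = 0) \<longleftrightarrow> (\<Sum>i\<in>UNIV. (y $ i) ^ d) = 0"
    by (intro ball_wpt_iff) simp
  then show ?thesis
    unfolding fermat_cone_def mem_Collect_eq wpt_in_points_iff by (rule arg_cong)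
qed

lemma fermat_cone_points: "fermat_cone d \<subseteq> points proj"
  by (auto simp: fermat_cone_def)

lemma points_Fermat: "points (Fermat d) = fermat_cone d"
  using fermat_cone_points by (auto simp: Fermat_eq zar_sub_fspace)

text \<open>
  The vanishing coordinates of a point are perturbed to \<open>\<epsilon>\<close>, and one nonvanishing coordinate is
  corrected by a branch of the \<open>d\<close>-th root to stay on the Fermat cone.
\<close>

lemma fermat_cone_perturb:
  fixes x :: "complex ^ 'n::finite"
  assumes d: "0 < d" and x: "x \<noteq> 0" "(\<Sum>i\<in>UNIV. (x $ i) ^ d) = 0" and b: "polyfun b" "b x \<noteq> 0"
  shows "\<exists>y\<in>tor. (\<Sum>i\<in>UNIV. (y $ i) ^ d) = 0 \<and> b y \<noteq> 0"
proof -
  obtain k where k: "x $ k \<noteq> 0" using x(1) by (auto simp: vec_eq_iff)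
  define m where "m = card {j. x $ j = 0}"
  \<comment> \<open>Replacing the \<open>m\<close> zero coordinates by \<open>\<epsilon>\<close>
    adds \<open>m \<epsilon>^d\<close> to the Fermat sum. The factor \<open>s \<epsilon>\<close> on
    the \<open>d\<close>-th power of the coordinate \<open>k\<close> takes it away, and it tends to
    \<open>1\<close>, where \<open>Ln\<close> is continuous.\<close>
  define s where "s \<epsilon> = 1 - of_nat m * \<epsilon> ^ d / (x $ k) ^ d" for \<epsilon>
  define y :: "complex \<Rightarrow> complex ^ 'n" where "y \<epsilon> = (\<chi> j. if x $ j = 0 then \<epsilon>
      else if j = k then x $ k * exp (Ln (s \<epsilon>) / of_nat d) else x $ j)" for \<epsilon>
  have s: "(s \<longlongrightarrow> 1) (at 0)"
  proof -
    have "(s \<longlongrightarrow> 1 - of_nat m * 0 ^ d / (x $ k) ^ d) (at 0)"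
      unfolding s_def using k by (intro tendsto_intros) auto
    moreover have "1 - of_nat m * 0 ^ d / (x $ k) ^ d = 1" using d by (simp add: zero_power)
    ultimately show ?thesis by metis
  qed
  have "((\<lambda>\<epsilon>. x $ k * exp (Ln (s \<epsilon>) / of_nat d)) \<longlongrightarrow> x $ k * exp (Ln 1 / of_nat d)) (at 0)"
    using d by (intro tendsto_intros s) auto
  then have yk: "((\<lambda>\<epsilon>. x $ k * exp (Ln (s \<epsilon>) / of_nat d)) \<longlongrightarrow> x $ k) (at 0)" by simp
  have "(y \<longlongrightarrow> x) (at 0)"
  proof (rule vec_tendstoI)
    fix j
    show "((\<lambda>\<epsilon>. y \<epsilon> $ j) \<longlongrightarrow> x $ j) (at 0)"
      using yk by (cases "x $ j = 0"; cases "j = k") (auto simp: y_def)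
  qed
  moreover have "isCont b x"
    using polyfun_continuous[OF b(1)] by (simp add: continuous_on_eq_continuous_at)
  ultimately have "((\<lambda>\<epsilon>. b (y \<epsilon>)) \<longlongrightarrow> b x) (at 0)" by (rule isCont_tendsto_compose[rotated])
  then have "eventually (\<lambda>\<epsilon>. b (y \<epsilon>) \<noteq> 0) (at 0)" using b(2) by (rule tendsto_imp_eventually_ne)
  moreover have "eventually (\<lambda>\<epsilon>. s \<epsilon> \<noteq> 0) (at 0)"
    using s by (rule tendsto_imp_eventually_ne) simp
  moreover have "eventually (\<lambda>\<epsilon>::complex. \<epsilon> \<noteq> 0) (at 0)" by (rule eventually_neq_at_within)
  ultimately have "eventually (\<lambda>\<epsilon>. b (y \<epsilon>) \<noteq> 0 \<and> s \<epsilon> \<noteq> 0 \<and> \<epsilon> \<noteq> 0) (at (0::complex))"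
    by eventually_elim blast
  then obtain \<epsilon> where \<epsilon>: "b (y \<epsilon>) \<noteq> 0" "s \<epsilon> \<noteq> 0" "\<epsilon> \<noteq> 0"
    using eventually_happens' at_neq_bot by blast
  have "(y \<epsilon> $ j) ^ d = (x $ j) ^ d + (if x $ j = 0 then \<epsilon> ^ d else 0)
      - (if j = k then of_nat m * \<epsilon> ^ d else 0)" for j
  proof -
    have "(x $ k * exp (Ln (s \<epsilon>) / of_nat d)) ^ d = (x $ k) ^ d * s \<epsilon>"
      using complex_root_exists[OF \<epsilon>(2) d] by (simp add: power_mult_distrib)
    also have "\<dots> = (x $ k) ^ d - of_nat m * \<epsilon> ^ d" using k by (simp add: s_def field_simps)
    finally show ?thesis using k d by (simp add: y_def)
  qed
  then have "(\<Sum>j\<in>UNIV. (y \<epsilon> $ j) ^ d)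
      = (\<Sum>j\<in>UNIV. if x $ j = 0 then \<epsilon> ^ d else 0) - of_nat m * \<epsilon> ^ d"
    by (simp add: sum.distrib sum_subtractf x(2))
  also have "(\<Sum>j\<in>UNIV. if x $ j = 0 then \<epsilon> ^ d else 0) = of_nat m * \<epsilon> ^ d"
    by (simp add: m_def sum.If_cases)
  finally have "(\<Sum>j\<in>UNIV. (y \<epsilon> $ j) ^ d) = 0" by simp
  moreover have "y \<epsilon> \<in> tor" using k \<epsilon>(3) by (simp add: tor_def y_def)
  ultimately show ?thesis using \<epsilon>(1) by blast
qed

text \<open>The Fermat variety may be reducible (with two coordinates it is a set of
  \<open>d\<close> points), so one nonempty open set says nothing about density. Instead the torus
  is shown to meet every neighbourhood of every point.\<close>

lemma dense_open_Fermat_torus: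
  assumes "0 < d"
  shows "dense_open (Fermat d) (torus_part (vec 1 :: int ^ 'n::finite) (fermat_cone d))"
proof -
  let ?Z = "fermat_cone d :: (complex ^ 'n) set set"
  have "P \<in> Abstract_Topology.closure_of (zar (Fermat d)) (torus_part (vec 1) ?Z)" if P: "P \<in> ?Z" for P
    unfolding in_closure_of points_Fermat
  proof (intro conjI allI impI P)
    fix T assume T: "P \<in> T \<and> openin (zar (Fermat d)) T"
    obtain x where x: "P = wpt (vec 1) x" "x \<noteq> 0" "(\<Sum>i\<in>UNIV. (x $ i) ^ d) = 0"
      using P fermat_cone_points[of d] wpt_in_fermat_cone by (fastforce simp: points_wproj)
    have T': "openin (zar (sub_fspace proj ?Z)) T" using T by (simp add: Fermat_eq)
    have xT: "wpt (vec 1) x \<in> T" using T x(1) by simp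
    obtain b where b: "polyfun b" "b x \<noteq> 0"
      "\<forall>y. y \<noteq> 0 \<longrightarrow> wpt (vec 1) y \<in> ?Z \<longrightarrow> b y \<noteq> 0 \<longrightarrow> wpt (vec 1) y \<in> T"
      using T'[unfolded openin_wproj_sub_iff[OF fermat_cone_points], THEN conjunct2, rule_format,
          OF x(2) xT] by blast
    obtain y where y: "y \<in> tor" "(\<Sum>i\<in>UNIV. (y $ i) ^ d) = 0" "b y \<noteq> 0"
      using fermat_cone_perturb[OF assms x(2,3) b(1,2)] by blast
    have "wpt (vec 1) y \<in> torus_part (vec 1) ?Z"
      using y by (simp add: wpt_in_torus_part wpt_in_fermat_cone tor_nonzero)
    moreover have "wpt (vec 1) y \<in> T"
      using b(3) y by (simp add: wpt_in_fermat_cone tor_nonzero)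
    ultimately show "\<exists>y. y \<in> torus_part (vec 1) ?Z \<and> y \<in> T" by blast
  qed
  moreover have "openin (zar (Fermat d)) (torus_part (vec 1) ?Z)"
    unfolding Fermat_eq by (rule openin_torus_part[OF fermat_cone_points])
  ultimately show ?thesis
    using closure_of_subset_topspace[of "zar (Fermat d)" "torus_part (vec 1) ?Z"]
    unfolding dense_open_def points_Fermat by blast
qed

lemma Fermat_torus_nonempty:
  assumes "i \<noteq> (j :: 'n::finite)" "0 < d"
  shows "\<exists>y \<in> (tor :: (complex ^ 'n) set). (\<Sum>i\<in>UNIV. (y $ i) ^ d) = 0"
proof -
  define m where "m = card (UNIV - {i})"
  have "j \<in> UNIV - {i}" using assms(1) by simp
  then have "m \<noteq> 0" unfolding m_def by (subst card_0_eq) auto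
  then have r: "exp (Ln (- of_nat m) / of_nat d) ^ d = (- of_nat m :: complex)"
    using assms(2) by (intro complex_root_exists) auto
  \<comment> \<open>All other coordinates are \<open>1\<close>, so the remaining one must be a
    \<open>d\<close>-th root of minus their number, which is nonzero as there are at least two
    indices.\<close>
  define y :: "complex ^ 'n" where
    "y = (\<chi> k. if k = i then exp (Ln (- of_nat m) / of_nat d) else 1)"
  have "(\<Sum>k\<in>UNIV. (y $ k) ^ d) = (y $ i) ^ d + (\<Sum>k\<in>UNIV - {i}. (y $ k) ^ d)"
    by (rule sum.remove) auto
  also have "(\<Sum>k\<in>UNIV - {i}. (y $ k) ^ d) = (\<Sum>k\<in>UNIV - {i}. 1)"
    by (intro sum.cong) (auto simp: y_def)
  also have "(y $ i) ^ d + (\<Sum>k\<in>UNIV - {i}. 1) = 0"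
    unfolding m_def[symmetric] using r by (simp add: y_def m_def)
  finally have "(\<Sum>k\<in>UNIV. (y $ k) ^ d) = 0" .
  moreover have "y \<in> tor" by (simp add: y_def tor_def)
  ultimately show ?thesis by blast
qed

section \<open>The diagonal groups\<close>

context exponent_matrix_root
begin

abbreviation "DG \<equiv> diag_group A"
abbreviation "N \<equiv> generate DG {\<lambda>_. 1 mod int d}"

lemma diag_carrier: "k \<in> carrier DG \<longleftrightarrow>
    (\<forall>i. 0 \<le> k i \<and> k i < int d) \<and> int d dvd (\<Sum>j\<in>UNIV. k j * q' j)"
  using dnum(1) by (auto simp: diag_group_def ZdZn_def carrier_integer_mod_group PiE_def Pi_def)

lemma diag_mult: "k \<otimes>\<^bsub>DG\<^esub> l = (\<lambda>i. (k i + l i) mod int d)"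
  by (simp add: diag_group_def ZdZn_def restrict_def)

lemma diag_one: "\<one>\<^bsub>DG\<^esub> = (\<lambda>_. 0)"
  by (simp add: diag_group_def ZdZn_def restrict_def)

lemma dvd_sum_cong:
  fixes k l f :: "'n \<Rightarrow> int"
  assumes "\<And>i. int d dvd k i - l i"
  shows "int d dvd (\<Sum>j\<in>UNIV. k j * f j) \<longleftrightarrow> int d dvd (\<Sum>j\<in>UNIV. l j * f j)"
proof -
  have "int d dvd (\<Sum>j\<in>UNIV. (k j - l j) * f j)" using assms by (intro dvd_sum) auto
  moreover have "(\<Sum>j\<in>UNIV. k j * f j) = (\<Sum>j\<in>UNIV. (k j - l j) * f j) + (\<Sum>j\<in>UNIV. l j * f j)"
    by (simp add: sum.distrib[symmetric] algebra_simps)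
  ultimately show ?thesis by (simp add: dvd_add_right_iff)
qed

lemma mod_diff_dvd: "int d dvd e mod int d - e"
  by (metis dvd_minus_mod dvd_diff_commute)

lemma dvd_sum_mod:
  "int d dvd (\<Sum>j\<in>UNIV. (k j mod int d) * f j) \<longleftrightarrow> int d dvd (\<Sum>j\<in>UNIV. k j * f j)"
  for k f :: "'n \<Rightarrow> int"
  by (rule dvd_sum_cong) (rule mod_diff_dvd)

lemma comm_group_diag: "comm_group DG"
proof (rule comm_groupI)
  fix k l assume k: "k \<in> carrier DG" and l: "l \<in> carrier DG"
  have "int d dvd (\<Sum>j\<in>UNIV. (k j + l j) * q' j)"
    using k l by (simp add: diag_carrier distrib_right sum.distrib)
  then have "int d dvd (\<Sum>j\<in>UNIV. ((k j + l j) mod int d) * q' j)"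
    unfolding dvd_sum_mod .
  then show "k \<otimes>\<^bsub>DG\<^esub> l \<in> carrier DG"
    using dnum(1) by (simp add: diag_carrier diag_mult)
  show "k \<otimes>\<^bsub>DG\<^esub> l = l \<otimes>\<^bsub>DG\<^esub> k" by (simp add: diag_mult add.commute)
next
  show "\<one>\<^bsub>DG\<^esub> \<in> carrier DG" using dnum(1) by (simp add: diag_one diag_carrier)
next
  fix k l m show "k \<otimes>\<^bsub>DG\<^esub> l \<otimes>\<^bsub>DG\<^esub> m = k \<otimes>\<^bsub>DG\<^esub> (l \<otimes>\<^bsub>DG\<^esub> m)"
    by (simp add: diag_mult mod_simps add.assoc)
next
  fix k assume k: "k \<in> carrier DG"
  then show "\<one>\<^bsub>DG\<^esub> \<otimes>\<^bsub>DG\<^esub> k = k" by (simp add: diag_mult diag_one diag_carrier fun_eq_iff)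
  have "int d dvd (\<Sum>j\<in>UNIV. (- k j) * q' j)"
    using k by (simp add: diag_carrier sum_negf)
  then have "int d dvd (\<Sum>j\<in>UNIV. ((- k j) mod int d) * q' j)"
    unfolding dvd_sum_mod .
  then have "(\<lambda>j. (- k j) mod int d) \<in> carrier DG" using dnum(1) by (simp add: diag_carrier)
  moreover have "(\<lambda>j. (- k j) mod int d) \<otimes>\<^bsub>DG\<^esub> k = \<one>\<^bsub>DG\<^esub>"
    by (simp add: diag_mult diag_one mod_simps)
  ultimately show "\<exists>l\<in>carrier DG. l \<otimes>\<^bsub>DG\<^esub> k = \<one>\<^bsub>DG\<^esub>" by blast
qed

text \<open>This is the normalization that the \<open>q'\<close> sum to \<open>d\<close>. Writing
  \<open>1 mod int d\<close> covers \<open>d = 1\<close>, where the representative is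
  \<open>0\<close>.\<close>

lemma generator_in_diag: "(\<lambda>_. 1 mod int d) \<in> carrier DG"
proof -
  have "int d dvd (\<Sum>j\<in>UNIV. 1 * q' j)" by (simp add: sum_qwt')
  then have "int d dvd (\<Sum>j\<in>UNIV. (1 mod int d) * q' j)"
    unfolding dvd_sum_mod .
  then show ?thesis using dnum(1) by (simp add: diag_carrier)
qed

lemma N_normal: "N \<lhd> DG"
proof -
  interpret comm_group DG by (rule comm_group_diag)
  show ?thesis
    unfolding normal_iff_subgroup using generator_in_diag by (intro generate_is_subgroup) simp
qed

lemma group_Gamma: "group (Gamma_grp A)"
  unfolding Gamma_grp_def by (rule normal.factorgroup_is_group[OF N_normal])

lemma carrier_Gamma: "C \<in> carrier (Gamma_grp A) \<longleftrightarrow> (\<exists>k\<in>carrier DG. C = N #>\<^bsub>DG\<^esub> k)"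
  by (auto simp: Gamma_grp_def FactGroup_def RCOSETS_def)

lemma finite_Gamma: "finite (carrier (Gamma_grp A))"
proof -
  have "carrier DG \<subseteq> (\<Pi>\<^sub>E i\<in>UNIV. {0..<int d})" by (auto simp: diag_carrier)
  then have "finite (carrier DG)" by (rule finite_subset) (intro finite_PiE; simp)
  moreover have "carrier (Gamma_grp A) \<subseteq> (\<lambda>k. N #>\<^bsub>DG\<^esub> k) ` carrier DG"
    using carrier_Gamma by blast
  ultimately show ?thesis by (meson finite_imageI finite_subset)
qed

text \<open>Used with \<open>f k = k\<close> on projective space and with \<open>f k = B k\<close>
  on the weighted one. Additivity is required modulo \<open>d\<close> only, because the group
  reduces representatives. By \<open>gen\<close> the generator acts as the scaling by
  \<open>\<zeta>\<close>, hence trivially, and the action factors through the quotient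
  group.\<close>

lemma diag_action:
  fixes w :: "int ^ 'n" and f :: "('n \<Rightarrow> int) \<Rightarrow> 'n \<Rightarrow> int" and Z k
  defines "X \<equiv> sub_fspace (wproj w) Z"
  defines "act \<equiv> descend (\<lambda>k. restrict (gmap w \<zeta> (f k)) (points X))"
  assumes Z: "Z \<subseteq> points (wproj w)"
    and add: "\<And>k l j. int d dvd f (\<lambda>i. (k i + l i) mod int d) j - (f k j + f l j)"
    and gen: "\<And>j. int d dvd f (\<lambda>_. 1 mod int d) j - w $ j"
    and pres: "\<And>k y. k \<in> carrier DG \<Longrightarrow> wpt w y \<in> Z \<Longrightarrow> wpt w (dvec \<zeta> (f k) * y) \<in> Z"
  shows "act \<in> hom (Gamma_grp A) (aut_group X)"
    and "k \<in> carrier DG \<Longrightarrow> act (N #>\<^bsub>DG\<^esub> k) = restrict (gmap w \<zeta> (f k)) (points X)"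
proof -
  interpret comm_group DG by (rule comm_group_diag)
  have sh: "sheaf_like X" by (simp add: X_def sheaf_like_sub_fspace sheaf_like_wproj)
  have pts: "points X = Z" using Z by (auto simp: X_def zar_sub_fspace)
  have dvec_add: "dvec \<zeta> (f (k \<otimes>\<^bsub>DG\<^esub> l)) = dvec \<zeta> (f k) * dvec \<zeta> (f l)" for k l
  proof -
    have "dvec \<zeta> (f (k \<otimes>\<^bsub>DG\<^esub> l)) = dvec \<zeta> (\<lambda>j. f k j + f l j)"
      unfolding diag_mult by (rule dvec_cong[OF add])
    then show ?thesis by (simp add: vec_eq_iff dvec_nth power_int_add root(1))
  qed
  have dvec_1: "dvec \<zeta> (f \<one>\<^bsub>DG\<^esub>) = 1"
  proof -
    define v where "v = dvec \<zeta> (f \<one>\<^bsub>DG\<^esub>)"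
    \<comment> \<open>The neutral element gives an idempotent of the torus, so \<open>v = 1\<close>
      follows from \<open>add\<close> alone.\<close>
    have "v = v * v" using dvec_add[of "\<one>\<^bsub>DG\<^esub>" "\<one>\<^bsub>DG\<^esub>"] by (simp add: v_def)
    from arg_cong[OF this] have "v $ j = v $ j * v $ j" for j
      unfolding vector_mult_component[symmetric] .
    moreover have "v $ j \<noteq> 0" for j
      using dvec_in_tor[OF root(1), of "f \<one>\<^bsub>DG\<^esub>"] by (simp add: v_def tor_def)
    ultimately have "v $ j = 1" for j by (metis mult_cancel_left1)
    then show ?thesis by (simp add: vec_eq_iff v_def)
  qed
  have hom: "(\<lambda>k. restrict (gmap w \<zeta> (f k)) (points X)) \<in> hom DG (aut_group X)"
  proof (rule action_hom[OF is_group sh])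
    show "morphism X X (gmap w \<zeta> (f k))" if "k \<in> carrier DG" for k
      unfolding X_def by (rule morphism_gmap[OF root(1) Z]) (rule pres[OF that])
    fix P assume "P \<in> points X"
    then obtain y where y: "P = wpt w y" using pts Z by (auto simp: points_wproj)
    show "gmap w \<zeta> (f (k \<otimes>\<^bsub>DG\<^esub> l)) P = gmap w \<zeta> (f k) (gmap w \<zeta> (f l) P)" for k l
      by (simp add: y gmap_wpt_dvec dvec_add mult.assoc)
    show "gmap w \<zeta> (f \<one>\<^bsub>DG\<^esub>) P = P" by (simp add: y gmap_wpt_dvec dvec_1)
  qed
  interpret h: group_hom DG "aut_group X" "\<lambda>k. restrict (gmap w \<zeta> (f k)) (points X)"
    using hom group_aut_group[OF sh] is_group by (simp add: group_hom_def group_hom_axioms_def)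
  have "(\<lambda>_. 1 mod int d) \<in> kernel DG (aut_group X) (\<lambda>k. restrict (gmap w \<zeta> (f k)) (points X))"
  proof -
    have "gmap w \<zeta> (f (\<lambda>_. 1 mod int d)) P = P" if "P \<in> points X" for P
    proof -
      obtain y where y: "P = wpt w y" using \<open>P \<in> points X\<close> pts Z by (auto simp: points_wproj)
      have "dvec \<zeta> (f (\<lambda>_. 1 mod int d)) = dvec \<zeta> (\<lambda>j. w $ j)" by (rule dvec_cong[OF gen])
      then have "dvec \<zeta> (f (\<lambda>_. 1 mod int d)) * y = wscale w \<zeta> y"
        by (simp add: vec_eq_iff dvec_nth wscale_nth)
      then show ?thesis by (simp add: y gmap_wpt_dvec wpt_wscale root(1))
    qed
    then show ?thesis using generator_in_diag by (simp add: kernel_def aut_group_one restrict_def fun_eq_iff)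
  qed
  then have sub: "N \<subseteq> kernel DG (aut_group X) (\<lambda>k. restrict (gmap w \<zeta> (f k)) (points X))"
    by (intro generate_subgroup_incl h.subgroup_kernel) simp
  show "act \<in> hom (Gamma_grp A) (aut_group X)"
    unfolding act_def Gamma_grp_def by (rule descend_FactGroup(2)[OF h.group_hom_axioms N_normal sub])
  show "k \<in> carrier DG \<Longrightarrow> act (N #>\<^bsub>DG\<^esub> k) = restrict (gmap w \<zeta> (f k)) (points X)"
    unfolding act_def by (rule descend_FactGroup(1)[OF h.group_hom_axioms N_normal sub])
qed

section \<open>The diagonal actions on the two hypersurfaces\<close>

definition ZA :: "(complex ^ 'n) set set" where
  "ZA = {P \<in> points (wproj q). \<forall>x\<in>P. Fpoly A x = 0}"

lemma XA_eq: "XA A = sub_fspace (wproj q) ZA"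
  by (simp add: XA_def ZA_def)

lemma ZA_points: "ZA \<subseteq> points (wproj q)"
  by (auto simp: ZA_def)

lemma points_XA: "points (XA A) = ZA"
  using ZA_points by (auto simp: XA_eq zar_sub_fspace)

lemma wpt_in_ZA: "wpt q x \<in> ZA \<longleftrightarrow> x \<noteq> 0 \<and> Fpoly A x = 0"
proof -
  have "(\<forall>y\<in>wpt q x. Fpoly A y = 0) \<longleftrightarrow> Fpoly A x = 0"
    by (rule ball_wpt_iff) (simp add: Fpoly_wscale)
  then show ?thesis
    unfolding ZA_def mem_Collect_eq wpt_in_points_iff by (rule arg_cong)
qed

text \<open>Each monomial is invariant separately: by \<open>A B = d\<close> the \<open>i\<close>-th
  one is multiplied by \<open>\<zeta>\<close> to the power \<open>d * k i\<close>.\<close>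

lemma Fpoly_dvec_Bvec: "Fpoly A (dvec \<zeta> (Bvec A k) * x) = Fpoly A x"
  by (simp add: Fpoly_eq lmon_mult lmon_A_dvec_Bvec)

lemma fermat_dvec: "(\<Sum>i\<in>UNIV. ((dvec \<zeta> k * y) $ i) ^ d) = (\<Sum>i\<in>UNIV. (y $ i) ^ d)"
proof -
  have "(\<zeta> powi e) ^ d = 1" for e
    by (metis power_int_1_left power_int_mult power_int_of_nat mult.commute root(2))
  then show ?thesis by (simp add: power_mult_distrib dvec_nth)
qed

lemma Bvec_cong:
  assumes "\<And>i. int d dvd k i - l i" shows "int d dvd Bvec A k j - Bvec A l j"
proof -
  have "Bvec A k j - Bvec A l j = (\<Sum>i\<in>UNIV. B j i * (k i - l i))"
    by (simp add: Bvec_def sum_subtractf[symmetric] algebra_simps)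
  then show ?thesis using assms by (auto intro!: dvd_sum)
qed

lemma act_Fermat:
  "act_Fermat A \<zeta> \<in> hom (Gamma_grp A) (aut_group (Fermat d))"
  "k \<in> carrier DG \<Longrightarrow> act_Fermat A \<zeta> (N #>\<^bsub>DG\<^esub> k) = restrict (gmap (vec 1) \<zeta> k) (points (Fermat d))"
proof -
  have pres: "wpt (vec 1) (dvec \<zeta> k * y) \<in> fermat_cone d" if "wpt (vec 1) y \<in> fermat_cone d" for k and y :: "complex ^ 'n"
    using that by (simp add: wpt_in_fermat_cone fermat_dvec tor_mult_nonzero dvec_in_tor root(1) del: vector_mult_component)
  have add: "int d dvd (k j + l j) mod int d - (k j + l j)" for k l :: "'n \<Rightarrow> int" and j by (rule mod_diff_dvd)
  have gen: "int d dvd 1 mod int d - vec 1 $ j" for j :: 'n using mod_diff_dvd[of 1] by simp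
  show "act_Fermat A \<zeta> \<in> hom (Gamma_grp A) (aut_group (Fermat d))"
    unfolding act_Fermat_def Fermat_eq
    by (rule diag_action(1)[OF fermat_cone_points, of "\<lambda>k. k"]) (fact add gen | rule pres, assumption)+
  show "act_Fermat A \<zeta> (N #>\<^bsub>DG\<^esub> k) = restrict (gmap (vec 1) \<zeta> k) (points (Fermat d))"
    if "k \<in> carrier DG"
    unfolding act_Fermat_def Fermat_eq
    by (rule diag_action(2)[OF fermat_cone_points, of "\<lambda>k. k"]) (fact add gen that | rule pres, assumption)+
qed

lemma act_XA:
  "act_XA A \<zeta> \<in> hom (Gamma_grp A) (aut_group (XA A))"
  "k \<in> carrier DG \<Longrightarrow> act_XA A \<zeta> (N #>\<^bsub>DG\<^esub> k) = restrict (gmap q \<zeta> (Bvec A k)) (points (XA A))"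
proof -
  have pres: "wpt q (dvec \<zeta> (Bvec A k) * y) \<in> ZA" if "wpt q y \<in> ZA" for k y
    using that by (simp add: wpt_in_ZA Fpoly_dvec_Bvec tor_mult_nonzero dvec_in_tor root(1))
  have add: "int d dvd Bvec A (\<lambda>i. (k i + l i) mod int d) j - (Bvec A k j + Bvec A l j)" for k l j
  proof -
    have "Bvec A (\<lambda>i. k i + l i) j = Bvec A k j + Bvec A l j"
      by (simp add: Bvec_def distrib_left sum.distrib)
    then show ?thesis
      using Bvec_cong[of "\<lambda>i. (k i + l i) mod int d" "\<lambda>i. k i + l i" j] mod_diff_dvd by simp
  qed
  have gen: "int d dvd Bvec A (\<lambda>_. 1 mod int d) j - q $ j" for j
  proof -
    have "q $ j = Bvec A (\<lambda>_. 1) j" by (simp add: Bvec_def qwt_eq)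
    then show ?thesis using Bvec_cong[of "\<lambda>_. 1 mod int d" "\<lambda>_. 1" j] mod_diff_dvd by simp
  qed
  show "act_XA A \<zeta> \<in> hom (Gamma_grp A) (aut_group (XA A))"
    unfolding act_XA_def XA_eq
    by (rule diag_action(1)[OF ZA_points, of "Bvec A"]) (fact add gen | rule pres, assumption)+
  show "act_XA A \<zeta> (N #>\<^bsub>DG\<^esub> k) = restrict (gmap q \<zeta> (Bvec A k)) (points (XA A))"
    if "k \<in> carrier DG"
    unfolding act_XA_def XA_eq
    by (rule diag_action(2)[OF ZA_points, of "Bvec A"]) (fact add gen that | rule pres, assumption)+
qed

end

section \<open>The two quotient maps\<close>

locale irreducible_exponent_matrix = exponent_matrix_root A \<zeta>
  for A :: "nat ^ 'n ^ 'n::finite" and \<zeta> +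
  assumes qwt'_pos: "\<And>k. 0 < qwt' A $ k"
    and irr: "irreducible_fspace (XA A)"
begin

lemma sheaf_like_XA: "sheaf_like (XA A)" and sheaf_like_Fermat: "sheaf_like (Fermat d)"
  by (simp_all add: XA_eq Fermat_eq sheaf_like_sub_fspace sheaf_like_wproj)

lemma group_hom_act_XA: "group_hom (Gamma_grp A) (aut_group (XA A)) (act_XA A \<zeta>)"
  using act_XA(1) group_Gamma group_aut_group[OF sheaf_like_XA]
  by (simp add: group_hom_def group_hom_axioms_def)

lemma group_hom_act_Fermat: "group_hom (Gamma_grp A) (aut_group (Fermat d)) (act_Fermat A \<zeta>)"
  using act_Fermat(1) group_Gamma group_aut_group[OF sheaf_like_Fermat]
  by (simp add: group_hom_def group_hom_axioms_def)

lemma subgroup_GammaA: "subgroup (GammaA A \<zeta>) (Gamma_grp A)"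
  unfolding GammaA_def by (rule group_hom.subgroup_kernel[OF group_hom_act_XA])

lemma finite_GammaA: "finite (GammaA A \<zeta>)"
  using subgroup.subset[OF subgroup_GammaA] finite_Gamma by (rule finite_subset)

lemma subgroup_HA: "subgroup (HA A \<zeta>) (aut_group (XA A))"
  unfolding HA_def by (rule group_hom.img_is_subgroup[OF group_hom_act_XA])

lemma finite_HA: "finite (HA A \<zeta>)"
  unfolding HA_def using finite_Gamma by (rule finite_imageI)

lemma subgroup_act_GammaA: "subgroup (act_Fermat A \<zeta> ` GammaA A \<zeta>) (aut_group (Fermat d))"
  by (rule group_hom.subgroup_img_is_subgroup[OF group_hom_act_Fermat subgroup_GammaA])

lemma coset_in_GammaA:
  assumes "k \<in> carrier DG"
  shows "N #>\<^bsub>DG\<^esub> k \<in> GammaA A \<zeta> \<longleftrightarrow> (\<forall>P\<in>ZA. gmap q \<zeta> (Bvec A k) P = P)"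
proof -
  have "N #>\<^bsub>DG\<^esub> k \<in> carrier (Gamma_grp A)" using assms carrier_Gamma by blast
  then have "N #>\<^bsub>DG\<^esub> k \<in> GammaA A \<zeta> \<longleftrightarrow>
      restrict (gmap q \<zeta> (Bvec A k)) (points (XA A)) = (\<lambda>P\<in>points (XA A). P)"
    by (simp add: GammaA_def kernel_def aut_group_one act_XA(2)[OF assms])
  also have "\<dots> \<longleftrightarrow> (\<forall>P\<in>ZA. gmap q \<zeta> (Bvec A k) P = P)"
    unfolding points_XA by (auto simp: restrict_def fun_eq_iff)
  finally show ?thesis .
qed

lemma act_GammaA_cases:
  assumes "g \<in> act_Fermat A \<zeta> ` GammaA A \<zeta>"
  obtains k where "k \<in> carrier DG" "\<forall>P\<in>ZA. gmap q \<zeta> (Bvec A k) P = P"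
    "\<And>y. wpt (vec 1) y \<in> fermat_cone d \<Longrightarrow> g (wpt (vec 1) y) = wpt (vec 1) (dvec \<zeta> k * y)"
proof -
  obtain C where C: "C \<in> GammaA A \<zeta>" "g = act_Fermat A \<zeta> C" using assms by blast
  then obtain k where k: "k \<in> carrier DG" "C = N #>\<^bsub>DG\<^esub> k"
    using subgroup.subset[OF subgroup_GammaA] carrier_Gamma by blast
  show thesis
  proof (rule that[OF k(1)])
    show "\<forall>P\<in>ZA. gmap q \<zeta> (Bvec A k) P = P" using C(1) coset_in_GammaA[OF k(1)] k(2) by simp
    show "g (wpt (vec 1) y) = wpt (vec 1) (dvec \<zeta> k * y)" if "wpt (vec 1) y \<in> fermat_cone d" for y
      using that by (simp add: C(2) k(2) act_Fermat(2)[OF k(1)] points_Fermat gmap_wpt_dvec)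
  qed
qed

lemma HA_cases:
  assumes "g \<in> HA A \<zeta>"
  obtains k where "k \<in> carrier DG"
    "\<And>x. wpt q x \<in> ZA \<Longrightarrow> g (wpt q x) = wpt q (dvec \<zeta> (Bvec A k) * x)"
proof -
  obtain C where C: "C \<in> carrier (Gamma_grp A)" "g = act_XA A \<zeta> C" using assms by (auto simp: HA_def)
  then obtain k where k: "k \<in> carrier DG" "C = N #>\<^bsub>DG\<^esub> k" using carrier_Gamma by blast
  show thesis
    by (rule that[OF k(1)]) (simp add: C(2) k(2) act_XA(2)[OF k(1)] points_XA gmap_wpt_dvec)
qed

lemma act_GammaA_I:
  assumes "k \<in> carrier DG" "\<forall>P\<in>ZA. gmap q \<zeta> (Bvec A k) P = P"
  shows "\<exists>g\<in>act_Fermat A \<zeta> ` GammaA A \<zeta>. \<forall>y. wpt (vec 1) y \<in> fermat_cone d \<longrightarrow>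
    g (wpt (vec 1) y) = wpt (vec 1) (dvec \<zeta> k * y)"
proof (intro bexI allI impI)
  show "act_Fermat A \<zeta> (N #>\<^bsub>DG\<^esub> k) \<in> act_Fermat A \<zeta> ` GammaA A \<zeta>"
    using coset_in_GammaA[OF assms(1)] assms(2) by blast
qed (simp add: act_Fermat(2)[OF assms(1)] points_Fermat gmap_wpt_dvec)

lemma HA_I:
  assumes "k \<in> carrier DG"
  shows "\<exists>g\<in>HA A \<zeta>. \<forall>x. wpt q x \<in> ZA \<longrightarrow> g (wpt q x) = wpt q (dvec \<zeta> (Bvec A k) * x)"
proof (intro bexI allI impI)
  show "act_XA A \<zeta> (N #>\<^bsub>DG\<^esub> k) \<in> HA A \<zeta>"
    using assms carrier_Gamma by (auto simp: HA_def)
qed (simp add: act_XA(2)[OF assms] points_XA gmap_wpt_dvec)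

section \<open>Fibres of the two rational maps\<close>

lemma phi_cone:
  assumes "y \<in> tor"
  shows "wpt (vec 1) y \<in> fermat_cone d \<longleftrightarrow> wpt q (monmap B y) \<in> ZA"
  using assms monmap_tor[OF assms, of B]
  by (simp add: wpt_in_fermat_cone wpt_in_ZA Fpoly_phi tor_nonzero)

text \<open>If the images differ by a scaling \<open>c\<close>, then \<open>t = z / (c y)\<close>
  lies in the kernel of \<open>monmap B\<close>, and by \<open>A B = d\<close> its coordinates are
  \<open>d\<close>-th roots of unity. Conversely, an element of \<open>GammaA\<close> is known only
  to act trivially on X_A, and this is enough because the image of \<open>y\<close> is a point of
  X_A.\<close>

lemma phi_fibres:
  assumes y: "y \<in> tor" "wpt (vec 1) y \<in> fermat_cone d"
    and z: "z \<in> tor" "wpt (vec 1) z \<in> fermat_cone d"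
  shows "wpt q (monmap B y) = wpt q (monmap B z) \<longleftrightarrow>
    (\<exists>g\<in>act_Fermat A \<zeta> ` GammaA A \<zeta>. wpt (vec 1) z = g (wpt (vec 1) y))"
proof
  assume "wpt q (monmap B y) = wpt q (monmap B z)"
  then obtain c where c: "c \<noteq> 0" "monmap B z = wscale q c (monmap B y)" by (auto simp: wpt_eq_iff)
  define t where "t = (\<chi> k. z $ k / (c * y $ k))"
  have t: "t \<in> tor" and zt: "z = wscale (vec 1) c (t * y)"
    using y(1) z(1) c(1) by (auto simp: t_def tor_def vec_eq_iff wscale_vec_1_nth)
  have "z = t * wscale (vec 1) c y"
    using y(1) c(1) by (auto simp: t_def tor_def vec_eq_iff wscale_vec_1_nth)
  then have "monmap B z = monmap B t * monmap B (wscale (vec 1) c y)"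
    by (simp only: monmap_mult)
  then have "monmap B z = monmap B t * monmap B z"
    by (simp only: phi_wscale[OF c(1)] c(2)[symmetric])
  then have "monmap B z $ j = monmap B t $ j * monmap B z $ j" for j
    by (metis vector_mult_component)
  moreover have "monmap B z $ j \<noteq> 0" for j
    using monmap_tor[OF z(1), of B] by (simp only: tor_def mem_Collect_eq) blast
  ultimately have Bt: "monmap B t = 1" by (simp add: vec_eq_iff)
  have "(t $ i) ^ d = 1" for i using lmon_A_phi[OF t, of i] by (simp add: Bt)
  then obtain k where k: "\<And>i. 0 \<le> k i" "\<And>i. k i < int d" "t = dvec \<zeta> k"
    by (rule roots_of_unity_dvec) (rule that)
  have Bk: "dvec \<zeta> (Bvec A k) = 1" using Bt by (simp add: k(3) phi_dvec)
  have "int d dvd Bvec A k j" for j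
    using arg_cong[OF Bk, of "\<lambda>v. v $ j"] by (simp add: dvec_nth root_powi_eq_1)
  \<comment> \<open>The congruence defining the diagonal group comes for free: the entries of
    \<open>B k\<close> sum to \<open>k . q'\<close>.\<close>
  then have "int d dvd (\<Sum>j\<in>UNIV. Bvec A k j)" by (intro dvd_sum) auto
  then have kc: "k \<in> carrier DG" using k by (simp add: diag_carrier sum_Bvec)
  have "\<forall>P\<in>ZA. gmap q \<zeta> (Bvec A k) P = P"
    using ZA_points by (auto simp: points_wproj gmap_wpt_dvec Bk)
  from act_GammaA_I[OF kc this] obtain g where g: "g \<in> act_Fermat A \<zeta> ` GammaA A \<zeta>"
    "g (wpt (vec 1) y) = wpt (vec 1) (dvec \<zeta> k * y)" using y(2) by blast
  then have "wpt (vec 1) z = g (wpt (vec 1) y)"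
    by (simp add: zt k(3) wpt_wscale c(1))
  then show "\<exists>g\<in>act_Fermat A \<zeta> ` GammaA A \<zeta>. wpt (vec 1) z = g (wpt (vec 1) y)" using g(1) by blast
next
  assume "\<exists>g\<in>act_Fermat A \<zeta> ` GammaA A \<zeta>. wpt (vec 1) z = g (wpt (vec 1) y)"
  then obtain g where g: "g \<in> act_Fermat A \<zeta> ` GammaA A \<zeta>" "wpt (vec 1) z = g (wpt (vec 1) y)" by blast
  from g(1) obtain k where k: "\<forall>P\<in>ZA. gmap q \<zeta> (Bvec A k) P = P"
    "\<And>y. wpt (vec 1) y \<in> fermat_cone d \<Longrightarrow> g (wpt (vec 1) y) = wpt (vec 1) (dvec \<zeta> k * y)"
    by (rule act_GammaA_cases) blast
  have "wpt (vec 1) z = wpt (vec 1) (dvec \<zeta> k * y)" using g(2) k(2)[OF y(2)] by simp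
  then obtain c where c: "c \<noteq> 0" "dvec \<zeta> k * y = wscale (vec 1) c z" by (auto simp: wpt_eq_iff)
  have "wpt q (monmap B z) = wpt q (monmap B (dvec \<zeta> k * y))"
    by (simp only: c(2) phi_wscale[OF c(1)] wpt_wscale[OF c(1)])
  also have "\<dots> = gmap q \<zeta> (Bvec A k) (wpt q (monmap B y))"
    by (simp only: monmap_mult phi_dvec gmap_wpt_dvec)
  also have "\<dots> = wpt q (monmap B y)" using k(1) phi_cone[OF y(1)] y(2) by blast
  finally show "wpt q (monmap B y) = wpt q (monmap B z)" ..
qed

text \<open>Every monomial of \<open>E\<close> takes the value \<open>c\<close> at
  \<open>t = z / y\<close>. Writing \<open>t\<close> as the image of \<open>s\<close> under
  \<open>monmap B\<close>, the rows of \<open>A\<close> give that each \<open>s_i\<close> is a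
  \<open>d\<close>-th root of \<open>c\<close>; so \<open>s\<close> is a scaling of a vector of
  roots of unity, and the row of u_0 says that this vector belongs to the diagonal group.\<close>

lemma E_fibres:
  assumes y: "y \<in> tor" "wpt q y \<in> ZA" and z: "z \<in> tor" "wpt q z \<in> ZA"
  shows "wpt (vec 1) (monmap E y) = wpt (vec 1) (monmap E z) \<longleftrightarrow>
    (\<exists>g\<in>HA A \<zeta>. wpt q z = g (wpt q y))"
proof
  assume "wpt (vec 1) (monmap E y) = wpt (vec 1) (monmap E z)"
  then obtain c where c: "c \<noteq> 0" "monmap E z = wscale (vec 1) c (monmap E y)" by (auto simp: wpt_eq_iff)
  define t where "t = (\<chi> k. z $ k / y $ k)"
  have t: "t \<in> tor" and zt: "z = t * y"
    using y(1) z(1) by (auto simp: t_def tor_def vec_eq_iff)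
  have Et: "lmon (E r) t = c" for r
  proof -
    have "lmon (E r) t * lmon (E r) y = c * lmon (E r) y"
      using arg_cong[OF c(2), of "\<lambda>v. v $ r"] by (simp add: zt lmon_mult wscale_vec_1_nth)
    then show ?thesis using lmon_nonzero[OF y(1)] by simp
  qed
  obtain s where s: "s \<in> tor" "t = monmap B s" using phi_surj[OF t] by blast
  have sd: "(s $ i) ^ d = c" for i using Et[of "Some i"] by (simp add: s lmon_A_phi)
  have sq: "lmon q' s = c" using Et[of None] by (simp add: s lmon_1_phi)
  define e where "e = exp (Ln c / of_nat d)"
  have e: "e \<noteq> 0" "e ^ d = c" using complex_root_exists[OF c(1) dnum(1)] by (simp_all add: e_def)
  define s' where "s' = (\<chi> i. s $ i / e)"
  have s': "s = wscale (vec 1) e s'" using e(1) by (simp add: s'_def vec_eq_iff wscale_vec_1_nth)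
  have "(s' $ i) ^ d = 1" for i using sd e c(1) by (simp add: s'_def power_divide)
  then obtain k where k: "\<And>i. 0 \<le> k i" "\<And>i. k i < int d" "s' = dvec \<zeta> k"
    by (rule roots_of_unity_dvec) (rule that)
  have "lmon q' s = e powi (\<Sum>i\<in>UNIV. q' i * vec 1 $ i) * lmon q' s'"
    unfolding s' by (rule lmon_wscale[OF e(1)])
  \<comment> \<open>Because the \<open>q'\<close> sum to \<open>d\<close>, the scaling contributes
    exactly \<open>e ^ d = c\<close>, which cancels against the value of
    \<open>lmon q' s\<close>.\<close>
  then have "lmon q' s' = 1" using sq e(2) c(1) by (simp add: sum_qwt')
  then have "int d dvd (\<Sum>i\<in>UNIV. q' i * k i)" by (simp add: k(3) lmon_dvec root(1) root_powi_eq_1)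
  then have kc: "k \<in> carrier DG" using k by (simp add: diag_carrier mult.commute)
  from HA_I[OF this] obtain g where g: "g \<in> HA A \<zeta>" "g (wpt q y) = wpt q (dvec \<zeta> (Bvec A k) * y)"
    using y(2) by blast
  have "t = wscale q e (dvec \<zeta> (Bvec A k))"
    by (simp only: s(2) s' phi_wscale[OF e(1)] k(3) phi_dvec)
  then have "z = wscale q e (dvec \<zeta> (Bvec A k) * y)"
    by (simp add: zt vec_eq_iff wscale_nth)
  then have "wpt q z = g (wpt q y)" using g(2) by (simp add: wpt_wscale e(1))
  then show "\<exists>g\<in>HA A \<zeta>. wpt q z = g (wpt q y)" using g(1) by blast
next
  assume "\<exists>g\<in>HA A \<zeta>. wpt q z = g (wpt q y)"
  then obtain g where g: "g \<in> HA A \<zeta>" "wpt q z = g (wpt q y)" by blast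
  from g(1) obtain k where k: "k \<in> carrier DG"
    "\<And>x. wpt q x \<in> ZA \<Longrightarrow> g (wpt q x) = wpt q (dvec \<zeta> (Bvec A k) * x)"
    by (rule HA_cases) blast
  have "wpt q z = wpt q (dvec \<zeta> (Bvec A k) * y)" using g(2) k(2)[OF y(2)] by simp
  then obtain c where c: "c \<noteq> 0" "dvec \<zeta> (Bvec A k) * y = wscale q c z" by (auto simp: wpt_eq_iff)
  have "monmap E (dvec \<zeta> (Bvec A k)) = 1" using k(1) by (intro E_dvec_Bvec) (simp add: diag_carrier)
  then have "monmap E y = monmap E (wscale q c z)" by (simp add: c(2)[symmetric] monmap_mult)
  then show "wpt (vec 1) (monmap E y) = wpt (vec 1) (monmap E z)"
    using c(1) by (simp add: E_wscale wpt_wscale)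
qed

section \<open>Torus points, density and domains of definition\<close>

text \<open>Irreducibility includes nonemptiness, and with a single variable F_A would be one
  monomial, without zeros off the origin.\<close>

lemma exists_distinct: "\<exists>i j :: 'n. i \<noteq> j"
proof (rule ccontr)
  assume "\<not> ?thesis"
  then have eq: "i = j" for i j :: 'n by blast
  obtain P where "P \<in> ZA" using irr by (auto simp: irreducible_fspace_def points_XA)
  then obtain x where x: "wpt q x \<in> ZA" using ZA_points by (auto simp: points_wproj)
  then have "x \<noteq> 0" by (simp add: wpt_in_ZA)
  then obtain i where "x $ i \<noteq> 0" by (auto simp: vec_eq_iff)
  then have "x \<in> tor" using eq[of _ i] by (simp add: tor_def) metis
  have U: "UNIV = {i}" using eq by auto
  have "Fpoly A x = lmon (a i) x" unfolding Fpoly_eq U by simp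
  then have "Fpoly A x \<noteq> 0" using \<open>x \<in> tor\<close> by (simp add: lmon_nonzero)
  then show False using x by (simp add: wpt_in_ZA)
qed

lemma XA_torus_nonempty: "\<exists>x\<in>tor. wpt q x \<in> ZA"
proof -
  obtain y :: "complex ^ 'n" where y: "y \<in> tor" "(\<Sum>i\<in>UNIV. (y $ i) ^ d) = 0"
    using exists_distinct Fermat_torus_nonempty dnum(1) by blast
  then have "wpt (vec 1) y \<in> fermat_cone d" by (simp add: wpt_in_fermat_cone tor_nonzero)
  then show ?thesis using phi_cone[OF y(1)] monmap_tor[OF y(1)] by blast
qed

lemma dense_open_XA_torus: "dense_open (XA A) (torus_part q ZA)"
proof (rule dense_open_irreducible[OF irr])
  show "openin (zar (XA A)) (torus_part q ZA)"
    unfolding XA_eq by (rule openin_torus_part[OF ZA_points])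
  show "torus_part q ZA \<noteq> {}" using XA_torus_nonempty wpt_in_torus_part by blast
qed

lemma phi_dom_eq: "phi_dom A = torus_part (vec 1) (fermat_cone d)"
proof -
  have "wpt (vec 1) y \<in> phi_dom A \<longleftrightarrow> wpt (vec 1) y \<in> torus_part (vec 1) (fermat_cone d)" for y
  proof -
    have "(\<forall>x\<in>wpt (vec 1) y. x \<in> tor) \<longleftrightarrow> y \<in> tor"
      by (rule ball_wpt_iff) (rule wscale_in_tor_iff)
    then show ?thesis unfolding wpt_in_torus_part by (auto simp: phi_dom_def points_Fermat tor_def)
  qed
  moreover have "phi_dom A \<subseteq> fermat_cone d" by (auto simp: phi_dom_def points_Fermat)
  then have "phi_dom A \<subseteq> points proj" by (rule subset_trans[OF _ fermat_cone_points])
  moreover have "torus_part (vec 1) (fermat_cone d) \<subseteq> points proj"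
    by (rule subset_trans[OF torus_part_subset fermat_cone_points])
  ultimately show ?thesis by (auto simp: points_wproj)
qed

lemma wpt_in_q_dom: "wpt q x \<in> q_dom A \<longleftrightarrow> wpt q x \<in> ZA \<and> monmap E x \<noteq> 0"
proof -
  have "(\<forall>y\<in>wpt q x. monmap E y \<noteq> 0) \<longleftrightarrow> monmap E x \<noteq> 0"
    by (rule ball_wpt_iff) (simp add: E_wscale wscale_eq_0_iff)
  then show ?thesis by (simp add: q_dom_def points_XA q_coords_eq)
qed

lemma q_dom_subset: "q_dom A \<subseteq> ZA"
  by (auto simp: q_dom_def points_XA)

lemma torus_part_q_dom: "torus_part q ZA \<subseteq> q_dom A"
  by (auto elim!: torus_part_cases simp: wpt_in_q_dom monmap_tor tor_nonzero)

lemma E_nonneg: "0 \<le> E r j"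
  by (simp add: E_def split: option.split)

lemma openin_q_dom: "openin (zar (XA A)) (q_dom A)"
  unfolding XA_eq openin_wproj_sub_iff[OF ZA_points]
proof (intro conjI allI impI q_dom_subset)
  fix x assume "wpt q x \<in> q_dom A"
  then obtain r where "lmon (E r) x \<noteq> 0" by (auto simp: wpt_in_q_dom vec_eq_iff)
  then show "\<exists>b. polyfun b \<and> b x \<noteq> 0 \<and>
      (\<forall>y. y \<noteq> 0 \<longrightarrow> wpt q y \<in> ZA \<longrightarrow> b y \<noteq> 0 \<longrightarrow> wpt q y \<in> q_dom A)"
    by (intro exI[of _ "lmon (E r)"]) (auto simp: wpt_in_q_dom vec_eq_iff polyfun_lmon E_nonneg)
qed

lemma dense_open_q_dom: "dense_open (XA A) (q_dom A)"
  using dense_open_irreducible[OF irr openin_q_dom] XA_torus_nonempty torus_part_q_dom wpt_in_torus_part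
  by blast

lemma morphism_phiA: "morphism (sub_fspace (Fermat d) (phi_dom A)) (XA A) (phiA A)"
  unfolding Fermat_eq XA_eq phi_dom_eq
proof (rule morphism_wprojI[OF fermat_cone_points ZA_points openin_torus_part[OF fermat_cone_points]])
  show "phiA A (wpt (vec 1) y) = wpt q (monmap B y) \<and> wpt q (monmap B y) \<in> ZA"
    if "wpt (vec 1) y \<in> torus_part (vec 1) (fermat_cone d)" for y
    using that phi_cone[of y] by (simp add: phiA_wpt phi_coords_eq wpt_in_torus_part)
  fix f g :: "complex ^ 'n \<Rightarrow> complex" assume fg: "polyfun f" "polyfun g"
  obtain f' g' where "polyfun f'" "polyfun g'"
    "\<forall>y\<in>tor. \<exists>s. s \<noteq> 0 \<and> f' y = s * f (monmap B y) \<and> g' y = s * g (monmap B y)"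
    by (rule monmap_pullback_pair[OF fg])
  then show "\<exists>f' g'. polyfun f' \<and> polyfun g' \<and> (\<forall>y. y \<noteq> 0 \<longrightarrow>
      wpt (vec 1) y \<in> torus_part (vec 1) (fermat_cone d) \<longrightarrow>
      (\<exists>s. s \<noteq> 0 \<and> f' y = s * f (monmap B y) \<and> g' y = s * g (monmap B y)))"
    unfolding wpt_in_torus_part by blast
qed

text \<open>The target \<open>Z'\<close> is left open: the lemma is used with all of projective
  space, to get the continuity that puts the image into the closure \<open>ZS\<close>, and then with
  \<open>ZS\<close> itself.\<close>

lemma morphism_qA:
  assumes "Z' \<subseteq> points proj" "\<And>x. wpt q x \<in> q_dom A \<Longrightarrow> wpt (vec 1) (monmap E x) \<in> Z'"
  shows "morphism (sub_fspace (XA A) (q_dom A)) (sub_fspace proj Z') (qA A)"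
  unfolding XA_eq
proof (rule morphism_wprojI[OF ZA_points assms(1) openin_q_dom[unfolded XA_eq]])
  show "qA A (wpt q y) = wpt (vec 1) (monmap E y) \<and> wpt (vec 1) (monmap E y) \<in> Z'"
    if "wpt q y \<in> q_dom A" for y
    using that assms(2) by (simp add: qA_wpt)
  fix f g :: "complex ^ 'n option \<Rightarrow> complex" assume "polyfun f" "polyfun g"
  then have "polyfun (\<lambda>y. f (monmap E y))" "polyfun (\<lambda>y. g (monmap E y))"
    using polyfun_comp[of _ "monmap E"] by (simp_all add: polyfun_lmon E_nonneg)
  then show "\<exists>f' g'. polyfun f' \<and> polyfun g' \<and> (\<forall>y. y \<noteq> 0 \<longrightarrow> wpt q y \<in> q_dom A \<longrightarrow>
      (\<exists>s. s \<noteq> 0 \<and> f' y = s * f (monmap E y) \<and> g' y = s * g (monmap E y)))"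
    by (intro exI[of _ "\<lambda>y. f (monmap E y)"] exI[of _ "\<lambda>y. g (monmap E y)"] conjI allI impI
        exI[of _ 1]) simp_all
qed

section \<open>The Shioda quotient\<close>

definition ZS :: "(complex ^ 'n option) set set" where
  "ZS = Abstract_Topology.closure_of (zar proj) (qA A ` torus_part q ZA)"

text \<open>Since \<open>monmap B\<close> is onto the torus and matches the two cones, the image of
  phi_A on its domain is the whole torus part of X_A, on which q_A is defined.\<close>

lemma shioda_eq: "shioda_quotient A = sub_fspace proj ZS"
proof -
  have "phiA A ` {P \<in> phi_dom A. phiA A P \<in> q_dom A} = torus_part q ZA"
  proof (intro subset_antisym subsetI)
    fix Q assume "Q \<in> phiA A ` {P \<in> phi_dom A. phiA A P \<in> q_dom A}"
    then obtain P where P: "P \<in> torus_part (vec 1) (fermat_cone d)" "Q = phiA A P"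
      by (auto simp: phi_dom_eq)
    from P(1) obtain y where y: "P = wpt (vec 1) y" "y \<in> tor" "wpt (vec 1) y \<in> fermat_cone d"
      by (rule torus_part_cases)
    then show "Q \<in> torus_part q ZA"
      using P(2) phi_cone[OF y(2)] by (simp add: phiA_wpt phi_coords_eq wpt_in_torus_part monmap_tor)
  next
    fix Q assume Q: "Q \<in> torus_part q ZA"
    then obtain x where x: "Q = wpt q x" "x \<in> tor" "wpt q x \<in> ZA" by (rule torus_part_cases)
    obtain y where y: "y \<in> tor" "x = monmap B y" using phi_surj[OF x(2)] by blast
    have "wpt (vec 1) y \<in> phi_dom A"
      using phi_cone[OF y(1)] x(3) y by (simp add: phi_dom_eq wpt_in_torus_part)
    moreover have "phiA A (wpt (vec 1) y) = Q" by (simp add: phiA_wpt phi_coords_eq x(1) y(2))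
    ultimately show "Q \<in> phiA A ` {P \<in> phi_dom A. phiA A P \<in> q_dom A}"
      using Q torus_part_q_dom by blast
  qed
  then show ?thesis unfolding shioda_quotient_def ZS_def image_comp[symmetric] by simp
qed

lemma ZS_points: "ZS \<subseteq> points proj"
  unfolding ZS_def by (rule closure_of_subset_topspace)

lemma image_in_ZS:
  assumes "x \<in> tor" "wpt q x \<in> ZA" shows "wpt (vec 1) (monmap E x) \<in> ZS"
proof -
  have "qA A ` torus_part q ZA \<subseteq> points proj"
    by (auto elim!: torus_part_cases simp: qA_wpt wpt_in_points_iff monmap_tor tor_nonzero)
  then have "qA A ` torus_part q ZA \<subseteq> ZS" unfolding ZS_def by (rule closure_of_subset)
  moreover have "wpt (vec 1) (monmap E x) \<in> qA A ` torus_part q ZA"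
    using assms by (auto simp: qA_wpt[symmetric] wpt_in_torus_part)
  ultimately show ?thesis by blast
qed

text \<open>By continuity: the torus part is dense in X_A, so points of the larger domain are sent
  into the closure of its image.\<close>

lemma q_dom_in_ZS:
  assumes x: "wpt q x \<in> q_dom A" shows "wpt (vec 1) (monmap E x) \<in> ZS"
  unfolding ZS_def in_closure_of
proof (intro conjI allI impI)
  show "wpt (vec 1) (monmap E x) \<in> points proj" using x by (simp add: wpt_in_q_dom wpt_in_points_iff)
  fix T assume T: "wpt (vec 1) (monmap E x) \<in> T \<and> openin (zar proj) T"
  have "morphism (sub_fspace (XA A) (q_dom A)) (sub_fspace proj (points proj)) (qA A)"
    by (rule morphism_qA) (simp_all add: wpt_in_q_dom wpt_in_points_iff)
  from morphism_open_subD(2)[OF sheaf_like_XA openin_q_dom this, of T]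
  have W: "openin (zar (XA A)) {P \<in> q_dom A. qA A P \<in> T}" using T by (simp add: zar_sub_fspace)
  have xW: "wpt q x \<in> {P \<in> q_dom A. qA A P \<in> T}" using x T by (simp add: qA_wpt)
  have "wpt q x \<in> Abstract_Topology.closure_of (zar (XA A)) (torus_part q ZA)"
    using dense_open_XA_torus x q_dom_subset points_XA by (auto simp: dense_open_def)
  from this[unfolded in_closure_of, THEN conjunct2, rule_format, OF conjI[OF xW W]]
  show "\<exists>P. P \<in> qA A ` torus_part q ZA \<and> P \<in> T" by blast
qed

text \<open>
  The torus part of the image is cut out by \<open>\<Sum>\<^sub>i u\<^sub>i = 0\<close> and the primitive relation
  \<open>u\<^sub>0\<^bsup>d/g\<^esup> = \<Prod>\<^sub>k u\<^sub>k\<^bsup>q'\<^sub>k/g\<^esup>\<close> with \<open>g = gcd(d, q'\<^sub>1, \<dots>, q'\<^sub>n)\<close>, so passing to the closure adds no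
  torus points.
\<close>

lemma ZS_torus:
  assumes u: "u \<in> tor" "wpt (vec 1) u \<in> ZS"
  shows "\<exists>x\<in>tor. u = monmap E x \<and> Fpoly A x = 0"
proof -
  obtain g k0 l where g: "0 \<le> g" "g dvd int d" "\<forall>j. g dvd q' j"
    "g = (\<Sum>j\<in>UNIV. k0 j * q' j) + int d * l"
    using bezout_family[of UNIV "int d" q'] by auto
  obtain e where e: "int d = g * e" using g(2) by (elim dvdE)
  define p where "p j = q' j div g" for j
  have p: "q' j = g * p j" for j using g(3) by (simp add: p_def)
  have gpos: "0 < g" using g(1) e dnum(1) by (cases "g = 0") auto
  have "0 < g * e" using e dnum(1) by simp
  then have epos: "0 < e" using gpos by (simp add: zero_less_mult_iff)
  \<comment> \<open>Positivity of the \<open>q'\<close> enters here: with nonnegative exponents the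
    right-hand side of the relation is a polynomial, so its zero set is closed.\<close>
  have ppos: "0 \<le> p j" for j using qwt'_pos[of j] gpos by (simp add: p_def pos_imp_zdiv_nonneg_iff)
  have "g * (\<Sum>j\<in>UNIV. p j) = g * e" using sum_qwt' by (simp add: p sum_distrib_left e)
  then have sum_p: "(\<Sum>j\<in>UNIV. p j) = e" using gpos by simp
  \<comment> \<open>The exponent \<open>0\<close> belongs to u_0. As the \<open>p j\<close> sum to
    \<open>e\<close>, both terms of \<open>b2\<close> have degree \<open>e\<close> and the relation
    is homogeneous.\<close>
  define P where "P r = case_option 0 p r" for r
  define b1 :: "complex ^ 'n option \<Rightarrow> complex" where "b1 u = (\<Sum>i\<in>UNIV. u $ Some i)" for u
  define b2 where "b2 u = u $ None powi e - lmon P u" for u :: "complex ^ 'n option"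
  have b1: "polyfun b1" unfolding b1_def by (intro polyfun_sum polyfun_coord)
  have b2: "polyfun b2" unfolding b2_def
    using epos ppos by (intro polyfun_diff polyfun_lmon)
      (auto simp: power_int_def P_def split: option.split intro: polyfun_power polyfun_coord)
  have h1: "b1 (wscale (vec 1) c y) = c * b1 y" for c y
    by (simp add: b1_def wscale_vec_1_nth sum_distrib_left)
  have h2: "b2 (wscale (vec 1) c y) = c powi e * b2 y" if "c \<noteq> 0" for c y
    using that by (simp add: b2_def lmon_wscale wscale_vec_1_nth power_int_mult_distrib
        sum_UNIV_option P_def sum_p right_diff_distrib)
  let ?C = "\<lambda>b. wpt (vec 1) ` {y :: complex ^ 'n option. y \<noteq> 0 \<and> b y = (0::complex)}"
  have cl: "closedin (zar proj) (?C b1)" "closedin (zar proj) (?C b2)"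
    using h1 h2 by (intro closedin_wproj_vanishing(1) b1 b2; simp)+
  have mem: "wpt (vec 1) y \<in> ?C b1 \<longleftrightarrow> y \<noteq> 0 \<and> b1 y = 0"
    "wpt (vec 1) y \<in> ?C b2 \<longleftrightarrow> y \<noteq> 0 \<and> b2 y = 0" for y
    using h1 h2 by (intro closedin_wproj_vanishing(2) b1 b2; simp)+
  have "qA A ` torus_part q ZA \<subseteq> ?C b1 \<inter> ?C b2"
  proof
    fix Q assume "Q \<in> qA A ` torus_part q ZA"
    then obtain x where x: "Q = wpt (vec 1) (monmap E x)" "x \<in> tor" "Fpoly A x = 0"
      by (auto elim!: torus_part_cases simp: qA_wpt wpt_in_ZA)
    obtain y where y: "y \<in> tor" "x = monmap B y" using phi_surj[OF x(2)] by blast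
    have "b1 (monmap E x) = 0" using x(3) by (simp add: b1_def Fpoly_eq)
    moreover have "b2 (monmap E x) = 0"
    proof -
      have "lmon P (monmap E x) = lmon (\<lambda>k. \<Sum>j\<in>UNIV. p j * a j k) x"
        using x(2) by (simp add: lmon_monmap sum_UNIV_option P_def)
      also have "(\<lambda>k. \<Sum>j\<in>UNIV. p j * a j k) = (\<lambda>k. e * 1)"
      proof
        fix k
        have "g * (\<Sum>j\<in>UNIV. p j * a j k) = g * e"
          using qwt'_A[of k] by (simp add: p sum_distrib_left mult.assoc e)
        then show "(\<Sum>j\<in>UNIV. p j * a j k) = e * 1" using gpos by simp
      qed
      also have "lmon (\<lambda>k. e * 1) x = lmon (\<lambda>_. 1) x powi e" by (rule lmon_smult)
      finally show ?thesis by (simp add: b2_def)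
    qed
    ultimately show "Q \<in> ?C b1 \<inter> ?C b2"
      using x(1) mem tor_nonzero[OF monmap_tor[OF x(2), of E]] by blast
  qed
  then have "ZS \<subseteq> ?C b1 \<inter> ?C b2" unfolding ZS_def using cl by (intro closure_of_minimal) auto
  then have bu: "b1 u = 0" "b2 u = 0" using u(2) mem by blast+
  define y :: "complex ^ 'n" where "y = (\<chi> k. exp (Ln (u $ Some k) / of_nat d))"
  have y: "y \<in> tor" "\<And>k. (y $ k) ^ d = u $ Some k"
    using u(1) dnum(1) complex_root_exists by (auto simp: y_def tor_def)
  \<comment> \<open>Arbitrary \<open>d\<close>-th roots \<open>y k\<close> already give the
    coordinates \<open>Some k\<close>; \<open>\<epsilon>\<close> is the error they leave in
    u_0.\<close>
  define \<epsilon> where "\<epsilon> = u $ None / lmon q' y"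
  have \<epsilon>e: "\<epsilon> powi e = 1"
  proof -
    have "lmon q' y powi e = lmon (\<lambda>k. e * q' k) y" by (rule lmon_smult[symmetric])
    also have "(\<lambda>k. e * q' k) = (\<lambda>k. int d * p k)" by (simp add: p e fun_eq_iff)
    also have "lmon (\<lambda>k. int d * p k) y = (\<Prod>k\<in>UNIV. ((y $ k) powi int d) powi p k)"
      by (simp add: lmon_def power_int_mult)
    also have "\<dots> = (\<Prod>k\<in>UNIV. (u $ Some k) powi p k)" by (simp add: y(2))
    also have "\<dots> = lmon P u" by (simp add: lmon_def P_def UNIV_option_conv prod.reindex)
    also have "\<dots> = u $ None powi e" using bu(2) by (simp add: b2_def)
    finally show ?thesis using u(1) by (simp add: \<epsilon>_def power_int_divide_distrib tor_def)
  qed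
  have "\<epsilon> powi int d = 1" unfolding e by (subst mult.commute) (simp add: power_int_mult \<epsilon>e)
  then have "\<epsilon> ^ d = 1" by simp
  then obtain i where i: "\<epsilon> = \<zeta> powi i" using root_of_unity_powi by blast
  \<comment> \<open>The exponent \<open>e = d / g\<close> in the relation is what gives
    \<open>g dvd i\<close>. From \<open>\<epsilon> ^ d = 1\<close> alone, \<open>i\<close> would be
    arbitrary, while changing the roots \<open>y k\<close> alters the exponent of
    \<open>\<zeta>\<close> only by multiples of \<open>g\<close>.\<close>
  have "int d dvd i * e" using \<epsilon>e by (simp add: i power_int_mult[symmetric] root_powi_eq_1)
  then have "g dvd i" using epos e by simp
  then obtain s where s: "i = g * s" by (elim dvdE)
  \<comment> \<open>Twisting by \<open>s\<close> times the Bezout vector leaves all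
    \<open>d\<close>-th powers unchanged and multiplies \<open>lmon q' y\<close> by
    \<open>\<zeta>\<close> to the power \<open>s * (g - d * l)\<close>, which equals
    \<open>\<epsilon>\<close>.\<close>
  define y' where "y' = dvec \<zeta> (\<lambda>j. s * k0 j) * y"
  have y': "y' \<in> tor" unfolding y'_def by (intro mult_in_tor dvec_in_tor root y)
  have yd: "(y' $ k) ^ d = u $ Some k" for k
  proof -
    have "(\<zeta> powi (s * k0 k)) ^ d = \<zeta> powi ((s * k0 k) * int d)" by (simp add: power_int_mult)
    also have "\<dots> = 1" by (simp add: root_powi_eq_1)
    finally show ?thesis by (simp add: y'_def dvec_nth power_mult_distrib y(2))
  qed
  have "lmon q' y' = u $ None"
  proof -
    have "(\<Sum>j\<in>UNIV. q' j * (s * k0 j)) = s * (\<Sum>j\<in>UNIV. k0 j * q' j)"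
      by (simp add: sum_distrib_left mult_ac)
    also have "\<dots> = s * (g - int d * l)" using g(4) by simp
    finally have "lmon q' y' = \<zeta> powi (s * (g - int d * l)) * lmon q' y"
      by (simp add: y'_def lmon_mult lmon_dvec root(1))
    also have "\<zeta> powi (s * (g - int d * l)) = \<epsilon>"
      unfolding i s by (rule root_powi_cong) (simp add: algebra_simps)
    finally show ?thesis using lmon_nonzero[OF y(1)] by (simp add: \<epsilon>_def)
  qed
  then have "u $ r = monmap E (monmap B y') $ r" for r
    using y' yd by (cases r) (simp_all add: lmon_1_phi lmon_A_phi)
  then have "u = monmap E (monmap B y')" by (simp add: vec_eq_iff)
  moreover have "Fpoly A (monmap B y') = 0" using bu(1) y' by (simp add: Fpoly_phi yd b1_def)
  ultimately show ?thesis using monmap_tor[OF y'] by blast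
qed

lemma dense_open_shioda_torus: "dense_open (sub_fspace proj ZS) (torus_part (vec 1) ZS)"
proof -
  let ?T = "torus_part (vec 1) ZS"
  have "qA A ` torus_part q ZA \<subseteq> ?T"
    by (auto elim!: torus_part_cases simp: qA_wpt wpt_in_torus_part monmap_tor image_in_ZS)
  then have "ZS \<subseteq> Abstract_Topology.closure_of (zar proj) ?T"
    unfolding ZS_def by (rule closure_of_mono)
  then have "Abstract_Topology.closure_of (zar (sub_fspace proj ZS)) ?T = points (sub_fspace proj ZS)"
    using torus_part_subset[of "vec 1" ZS] ZS_points
    by (auto simp: zar_sub_fspace closure_of_subtopology Int_absorb1)
  then show ?thesis
    unfolding dense_open_def using openin_torus_part[OF ZS_points] by blast
qed

text \<open>For the converse, \<open>ZS_torus\<close> gives a point of the cone with the same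
  \<open>monmap E\<close>, and F_A is the sum of the coordinates \<open>Some i\<close> of
  \<open>monmap E\<close>, so its vanishing depends on the image only.\<close>

lemma E_cone:
  assumes "x \<in> tor" shows "wpt q x \<in> ZA \<longleftrightarrow> wpt (vec 1) (monmap E x) \<in> ZS"
proof
  assume "wpt (vec 1) (monmap E x) \<in> ZS"
  then obtain x' where x': "x' \<in> tor" "monmap E x = monmap E x'" "Fpoly A x' = 0"
    using ZS_torus[OF monmap_tor[OF assms]] by blast
  have "lmon (a i) x = lmon (a i) x'" for i
    using arg_cong[OF x'(2), of "\<lambda>v. v $ Some i"] by simp
  then have "Fpoly A x = 0" using x'(3) by (simp add: Fpoly_eq)
  then show "wpt q x \<in> ZA" using assms by (simp add: wpt_in_ZA tor_nonzero)
qed (rule image_in_ZS[OF assms])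

section \<open>The two maps as quotient maps\<close>

lemma phiA_quotient:
  "birationally_equivalent_maps (Fermat d) (XA A) (phi_dom A) (phiA A)
     (Fermat_mod_GammaA A \<zeta>) (points (Fermat d)) (orbit_of (act_Fermat A \<zeta> ` GammaA A \<zeta>))
   \<and> birational (XA A) (Fermat_mod_GammaA A \<zeta>)"
  unfolding Fermat_mod_GammaA_def Fermat_eq XA_eq phi_dom_eq
proof (rule monomial_quotient[OF fermat_cone_points ZA_points phi_chars phi_cone])
  show "\<exists>y\<in>tor. x = monmap B y" if "x \<in> tor" for x by (rule phi_surj[OF that])
  show "phiA A (wpt (vec 1) y) = wpt q (monmap B y)" for y by (simp add: phiA_wpt phi_coords_eq)
  show "subgroup (act_Fermat A \<zeta> ` GammaA A \<zeta>) (aut_group (sub_fspace proj (fermat_cone d)))"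
    using subgroup_act_GammaA unfolding Fermat_eq .
  show "g P \<in> torus_part (vec 1) (fermat_cone d)"
    if g: "g \<in> act_Fermat A \<zeta> ` GammaA A \<zeta>" and P: "P \<in> torus_part (vec 1) (fermat_cone d)" for g P
  proof -
    obtain y where y: "P = wpt (vec 1) y" "y \<in> tor" "wpt (vec 1) y \<in> fermat_cone d"
      using P by (rule torus_part_cases)
    from g obtain k where "\<And>y. wpt (vec 1) y \<in> fermat_cone d \<Longrightarrow>
        g (wpt (vec 1) y) = wpt (vec 1) (dvec \<zeta> k * y)"
      by (rule act_GammaA_cases) blast
    then have "g P = wpt (vec 1) (dvec \<zeta> k * y)" using y by simp
    moreover have "dvec \<zeta> k * y \<in> tor" by (intro mult_in_tor dvec_in_tor root y)
    moreover have "(\<Sum>i\<in>UNIV. ((dvec \<zeta> k * y) $ i) ^ d) = 0"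
      unfolding fermat_dvec using y(3) by (simp add: wpt_in_fermat_cone)
    ultimately show ?thesis
      by (simp add: wpt_in_torus_part wpt_in_fermat_cone tor_nonzero del: vector_mult_component)
  qed
  show "wpt q (monmap B y) = wpt q (monmap B z) \<longleftrightarrow>
      (\<exists>g\<in>act_Fermat A \<zeta> ` GammaA A \<zeta>. wpt (vec 1) z = g (wpt (vec 1) y))"
    if "y \<in> tor" "z \<in> tor" "wpt (vec 1) y \<in> fermat_cone d" "wpt (vec 1) z \<in> fermat_cone d" for y z
    using phi_fibres that by blast
  show "rational_map (sub_fspace proj (fermat_cone d)) (sub_fspace (wproj q) ZA)
      (torus_part (vec 1) (fermat_cone d)) (phiA A)"
    using morphism_phiA dense_open_Fermat_torus[OF dnum(1)]
    by (simp add: rational_map_def Fermat_eq XA_eq phi_dom_eq)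
  show "dense_open (sub_fspace proj (fermat_cone d)) (torus_part (vec 1) (fermat_cone d))"
    using dense_open_Fermat_torus[OF dnum(1)] by (simp add: Fermat_eq)
  show "dense_open (sub_fspace (wproj q) ZA) (torus_part q ZA)"
    using dense_open_XA_torus by (simp add: XA_eq)
qed auto

lemma qA_quotient:
  "birationally_equivalent_maps (XA A) (shioda_quotient A) (q_dom A) (qA A)
     (XA_mod_HA A \<zeta>) (points (XA A)) (orbit_of (HA A \<zeta>))
   \<and> birational (shioda_quotient A) (XA_mod_HA A \<zeta>)"
  unfolding XA_mod_HA_def shioda_eq XA_eq
proof (rule monomial_quotient[OF ZA_points ZS_points E_chars E_cone])
  \<comment> \<open>Lifting is possible only over \<open>ZS\<close>: \<open>monmap E\<close> maps an
    \<open>n\<close>-dimensional torus into an (\<open>n+1\<close>)-dimensional one and is not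
    onto.\<close>
  show "\<exists>x\<in>tor. u = monmap E x" if "u \<in> tor" "wpt (vec 1) u \<in> ZS" for u
    using ZS_torus[OF that] by blast
  show "qA A (wpt q y) = wpt (vec 1) (monmap E y)" for y by (rule qA_wpt)
  show "subgroup (HA A \<zeta>) (aut_group (sub_fspace (wproj q) ZA))"
    using subgroup_HA unfolding XA_eq .
  show "g P \<in> torus_part q ZA" if g: "g \<in> HA A \<zeta>" and P: "P \<in> torus_part q ZA" for g P
  proof -
    obtain y where y: "P = wpt q y" "y \<in> tor" "wpt q y \<in> ZA" using P by (rule torus_part_cases)
    from g obtain k where "\<And>x. wpt q x \<in> ZA \<Longrightarrow> g (wpt q x) = wpt q (dvec \<zeta> (Bvec A k) * x)"
      by (rule HA_cases) blast
    then have "g P = wpt q (dvec \<zeta> (Bvec A k) * y)" using y by simp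
    moreover have "dvec \<zeta> (Bvec A k) * y \<in> tor" by (intro mult_in_tor dvec_in_tor root y)
    ultimately show ?thesis
      using y(3) by (simp add: wpt_in_torus_part wpt_in_ZA tor_nonzero Fpoly_dvec_Bvec)
  qed
  show "wpt (vec 1) (monmap E y) = wpt (vec 1) (monmap E z) \<longleftrightarrow> (\<exists>g\<in>HA A \<zeta>. wpt q z = g (wpt q y))"
    if "y \<in> tor" "z \<in> tor" "wpt q y \<in> ZA" "wpt q z \<in> ZA" for y z
    using E_fibres that by blast
  show "rational_map (sub_fspace (wproj q) ZA) (sub_fspace proj ZS) (q_dom A) (qA A)"
    using morphism_qA[OF ZS_points q_dom_in_ZS] dense_open_q_dom
    by (simp add: rational_map_def XA_eq)
  show "torus_part q ZA \<subseteq> q_dom A" by (rule torus_part_q_dom)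
  show "dense_open (sub_fspace (wproj q) ZA) (torus_part q ZA)"
    using dense_open_XA_torus by (simp add: XA_eq)
  show "dense_open (sub_fspace proj ZS) (torus_part (vec 1) ZS)" by (rule dense_open_shioda_torus)
qed auto

end

theorem corollary3p2:
  fixes A :: "nat ^ 'n ^ 'n::finite" and \<zeta> :: complex
  assumes "det (map_matrix of_nat A :: rat ^ 'n ^ 'n) \<noteq> 0"
    and "(\<Sum>i\<in>UNIV. (Ainv A *v vec 1) $ i) = 1"
    and "\<And>j. 0 < qwt A $ j"
    and "\<And>k. 0 < qwt' A $ k"
    and "irreducible_fspace (XA A)"
    and "primitive_root_of_unity (dnum A) \<zeta>"
  shows "act_Fermat A \<zeta> \<in> hom (Gamma_grp A) (aut_group (Fermat (dnum A)))
    \<and> finite (GammaA A \<zeta>) \<and> subgroup (GammaA A \<zeta>) (Gamma_grp A)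
    \<and> finite (HA A \<zeta>) \<and> subgroup (HA A \<zeta>) (aut_group (XA A))
    \<and> birationally_equivalent_maps (Fermat (dnum A))
        (XA A) (phi_dom A) (phiA A)
        (Fermat_mod_GammaA A \<zeta>) (points (Fermat (dnum A))) (orbit_of (act_Fermat A \<zeta> ` GammaA A \<zeta>))
    \<and> birationally_equivalent_maps (XA A)
        (shioda_quotient A) (q_dom A) (qA A)
        (XA_mod_HA A \<zeta>) (points (XA A)) (orbit_of (HA A \<zeta>))
    \<and> birational (XA A) (Fermat_mod_GammaA A \<zeta>)
    \<and> birational (shioda_quotient A) (XA_mod_HA A \<zeta>)"
proof -
  interpret irreducible_exponent_matrix A \<zeta>
    by unfold_locales (rule assms)+
  show ?thesis
    using act_Fermat(1) finite_GammaA subgroup_GammaA finite_HA subgroup_HA phiA_quotient qA_quotient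
    by blast
qed

end
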